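(* Let $\varphi$ be a linear-fractional, non-automorphism self-map of $\mathbb{D}$ that fixes a point $\zeta \in \mathbb{T}$, and suppose $\psi$ is a linear-fractional self-map of $\mathbb{D}$ that satisfies $\|\psi\|_{\infty}=1$ and $C_{\psi} \neq I$. Then $C_{\psi} \in C^{*}(C_{\varphi}, \mathcal{K})$ if and only if $\psi(\zeta)=\zeta$, $\psi'(\zeta)=\left(\varphi'(\zeta)\right)^n$ for some $n \in \mathbb{Z}$, and $\psi$ is not an automorphism of $\mathbb{D}$.
   Context: $\mathbb{D}$ is the open unit disk and $\mathbb{T}$ the unit circle in $\mathbb{C}$. $H^2(\mathbb{D})$ is the Hardy space of analytic functions $f(z)=\sum_{n\ge 0}a_nz^n$ on $\mathbb{D}$ with $\|f\|^2=\sum|a_n|^2<\infty$. For an analytic $\varphi:\mathbb{D}\to\mathbb{D}$, $C_\varphi$ is the bounded composition operator $f\mapsto f\circ\varphi$ on $H^2(\mathbb{D})$, and $\|\varphi\|_\infty=\sup\{|\varphi(z)|:z\in\mathbb{D}\}$. A linear-fractional self-map of $\mathbb{D}$ is a map $z\mapsto (az+b)/(cz+d)$ taking $\mathbb{D}$ into $\mathbb{D}$; it is a non-automorphism if it is not a bijection of $\mathbb{D}$ onto itself. $\mathcal{K}$ is the ideal of compact operators on $H^2(\mathbb{D})$, $I$ is the identity operator, and $C^*(C_\varphi,\mathcal{K})$ is the unital C$^*$-algebra of operators on $H^2(\mathbb{D})$ generated by $C_\varphi$ and $\mathcal{K}$. *)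

theory Defs
  imports "HOL-Complex_Analysis.Complex_Analysis"
begin

section \<open>The Hardy space of the unit disk\<close>

abbreviation unit_disk :: "complex set" (\<open>\<D>\<close>)
  where "\<D> \<equiv> ball 0 1"

abbreviation unit_circle :: "complex set" (\<open>\<T>\<close>)
  where "\<T> \<equiv> sphere 0 1"

definition taylor_coeff :: "(complex \<Rightarrow> complex) \<Rightarrow> nat \<Rightarrow> complex"
  where "taylor_coeff f n = (deriv ^^ n) f 0 / fact n"

text \<open>Functions on the disk are represented by total functions vanishing off the disk, so that
  equality in the type below is equality on the disk.\<close>

definition hardy_set :: "(complex \<Rightarrow> complex) set"
  where "hardy_set =
    {f. f holomorphic_on \<D> \<and> summable (\<lambda>n. (cmod (taylor_coeff f n))\<^sup>2) \<and> (\<forall>z. z \<notin> \<D> \<longrightarrow> f z = 0)}"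

lemma taylor_coeff_add:
  assumes "f holomorphic_on \<D>" "g holomorphic_on \<D>"
  shows "taylor_coeff (\<lambda>z. f z + g z) n = taylor_coeff f n + taylor_coeff g n"
  unfolding taylor_coeff_def using higher_deriv_add[OF assms, of 0 n] by (simp add: add_divide_distrib)

lemma taylor_coeff_cmult:
  assumes "f holomorphic_on \<D>"
  shows "taylor_coeff (\<lambda>z. c * f z) n = c * taylor_coeff f n"
  unfolding taylor_coeff_def using higher_deriv_cmult[OF assms, of 0 n c] by simp

lemma taylor_coeff_zero [simp]: "taylor_coeff (\<lambda>z. 0) n = 0"
  using taylor_coeff_cmult[of "\<lambda>z. 0" 0 n] by simp

lemma square_summable_add:
  fixes a b :: "nat \<Rightarrow> complex"
  assumes "summable (\<lambda>n. (cmod (a n))\<^sup>2)" "summable (\<lambda>n. (cmod (b n))\<^sup>2)"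
  shows "summable (\<lambda>n. (cmod (a n + b n))\<^sup>2)"
proof (rule summable_comparison_test')
  show "summable (\<lambda>n. 2 * (cmod (a n))\<^sup>2 + 2 * (cmod (b n))\<^sup>2)"
    using assms by (intro summable_add summable_mult)
  fix n :: nat
  have "(cmod (a n + b n))\<^sup>2 \<le> (cmod (a n) + cmod (b n))\<^sup>2"
    by (intro power_mono norm_triangle_ineq) auto
  also have "\<dots> \<le> 2 * (cmod (a n))\<^sup>2 + 2 * (cmod (b n))\<^sup>2"
    using sum_squares_ge_zero[of "cmod (a n) - cmod (b n)" 0]
    by (simp add: power2_eq_square algebra_simps)
  finally show "norm ((cmod (a n + b n))\<^sup>2) \<le> 2 * (cmod (a n))\<^sup>2 + 2 * (cmod (b n))\<^sup>2"
    by simp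
qed

lemma square_summable_mult_cnj:
  fixes a b :: "nat \<Rightarrow> complex"
  assumes "summable (\<lambda>n. (cmod (a n))\<^sup>2)" "summable (\<lambda>n. (cmod (b n))\<^sup>2)"
  shows "summable (\<lambda>n. a n * cnj (b n))"
proof (rule summable_comparison_test')
  show "summable (\<lambda>n. (cmod (a n))\<^sup>2 + (cmod (b n))\<^sup>2)"
    using assms by (intro summable_add)
  fix n :: nat
  have "cmod (a n) * cmod (b n) \<le> (cmod (a n))\<^sup>2 + (cmod (b n))\<^sup>2"
    using sum_squares_bound[of "cmod (a n)" "cmod (b n)"]
      mult_nonneg_nonneg[OF norm_ge_zero norm_ge_zero, of "a n" "b n"] by linarith
  then show "norm (a n * cnj (b n)) \<le> (cmod (a n))\<^sup>2 + (cmod (b n))\<^sup>2"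
    by (simp add: norm_mult)
qed

lemma hardy_set_zero: "(\<lambda>z. 0) \<in> hardy_set"
  by (simp add: hardy_set_def)

lemma hardy_set_add: "f \<in> hardy_set \<Longrightarrow> g \<in> hardy_set \<Longrightarrow> (\<lambda>z. f z + g z) \<in> hardy_set"
  by (auto simp: hardy_set_def taylor_coeff_add intro!: square_summable_add holomorphic_intros)

lemma hardy_set_cmult: "f \<in> hardy_set \<Longrightarrow> (\<lambda>z. c * f z) \<in> hardy_set"
  by (auto simp: hardy_set_def taylor_coeff_cmult norm_mult power_mult_distrib
      intro!: summable_mult holomorphic_intros)

typedef hardy = hardy_set
  morphisms hardy_fun Abs_hardy
  using hardy_set_zero by blast

setup_lifting type_definition_hardy

definition hardy_coeff :: "hardy \<Rightarrow> nat \<Rightarrow> complex"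
  where "hardy_coeff f = taylor_coeff (hardy_fun f)"

lemma hardy_fun_holomorphic: "hardy_fun f holomorphic_on \<D>"
  using hardy_fun[of f] by (simp add: hardy_set_def)

lemma hardy_coeff_square_summable: "summable (\<lambda>n. (cmod (hardy_coeff f n))\<^sup>2)"
  using hardy_fun[of f] by (simp add: hardy_set_def hardy_coeff_def)

lift_definition hardy_scaleC :: "complex \<Rightarrow> hardy \<Rightarrow> hardy" (infixr \<open>*\<^sub>C\<close> 75)
  is "\<lambda>c f z. c * f z"
  by (rule hardy_set_cmult)

definition hardy_cinner :: "hardy \<Rightarrow> hardy \<Rightarrow> complex"
  where "hardy_cinner f g = (\<Sum>n. hardy_coeff f n * cnj (hardy_coeff g n))"

lemma hardy_coeff_scaleC: "hardy_coeff (c *\<^sub>C f) n = c * hardy_coeff f n"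
  by (simp add: hardy_coeff_def hardy_scaleC.rep_eq taylor_coeff_cmult hardy_fun_holomorphic)

text \<open>The real inner product is the real part of \<^const>\<open>hardy_cinner\<close>; it induces the same norm,
  and makes the library's bounded linear operators and their norm topology available.\<close>

instantiation hardy :: real_inner
begin

lift_definition zero_hardy :: hardy is "\<lambda>z. 0"
  by (rule hardy_set_zero)

lift_definition plus_hardy :: "hardy \<Rightarrow> hardy \<Rightarrow> hardy" is "\<lambda>f g z. f z + g z"
  by (rule hardy_set_add)

lift_definition uminus_hardy :: "hardy \<Rightarrow> hardy" is "\<lambda>f z. - f z"
  using hardy_set_cmult[of _ "-1"] by simp

definition minus_hardy :: "hardy \<Rightarrow> hardy \<Rightarrow> hardy"
  where "f - g = f + (- g)" for f g :: hardy

definition scaleR_hardy :: "real \<Rightarrow> hardy \<Rightarrow> hardy"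
  where "scaleR_hardy r f = complex_of_real r *\<^sub>C f"

definition inner_hardy :: "hardy \<Rightarrow> hardy \<Rightarrow> real"
  where "inner_hardy f g = Re (hardy_cinner f g)"

definition norm_hardy :: "hardy \<Rightarrow> real"
  where "norm_hardy f = sqrt (\<Sum>n. (cmod (hardy_coeff f n))\<^sup>2)"

definition sgn_hardy :: "hardy \<Rightarrow> hardy"
  where "sgn_hardy f = inverse (norm f) *\<^sub>R f"

definition dist_hardy :: "hardy \<Rightarrow> hardy \<Rightarrow> real"
  where "dist_hardy f g = norm (f - g)"

definition uniformity_hardy :: "(hardy \<times> hardy) filter"
  where "uniformity_hardy = (INF e\<in>{0<..}. principal {(x, y). dist x y < e})"

definition open_hardy :: "hardy set \<Rightarrow> bool"
  where "open_hardy U \<longleftrightarrow> (\<forall>x\<in>U. eventually (\<lambda>(x', y). x' = x \<longrightarrow> y \<in> U) uniformity)"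

instance
proof
  fix f g h :: hardy and r s :: real
  show "f + g + h = f + (g + h)" "f + g = g + f" "0 + f = f" "- f + f = 0"
    by (transfer; simp add: algebra_simps)+
  show "f - g = f + - g"
    by (rule minus_hardy_def)
  show "r *\<^sub>R (f + g) = r *\<^sub>R f + r *\<^sub>R g" "(r + s) *\<^sub>R f = r *\<^sub>R f + s *\<^sub>R f"
    "r *\<^sub>R s *\<^sub>R f = (r * s) *\<^sub>R f" "1 *\<^sub>R f = f"
    unfolding scaleR_hardy_def by (transfer; simp add: algebra_simps)+
  show "sgn f = inverse (norm f) *\<^sub>R f"
    by (rule sgn_hardy_def)
  show "dist f g = norm (f - g)"
    by (rule dist_hardy_def)
  show "(uniformity :: (hardy \<times> hardy) filter) = (INF e\<in>{0<..}. principal {(x, y). dist x y < e})"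
    by (rule uniformity_hardy_def)
  show "open U \<longleftrightarrow> (\<forall>x\<in>U. eventually (\<lambda>(x', y). x' = x \<longrightarrow> y \<in> U) uniformity)" for U :: "hardy set"
    by (rule open_hardy_def)
  have summ: "summable (\<lambda>n. hardy_coeff u n * cnj (hardy_coeff v n))" for u v
    by (intro square_summable_mult_cnj hardy_coeff_square_summable)
  have coeff_add: "hardy_coeff (u + v) n = hardy_coeff u n + hardy_coeff v n" for u v n
    by (simp add: hardy_coeff_def plus_hardy.rep_eq taylor_coeff_add hardy_fun_holomorphic)
  have inner_self: "inner u u = (\<Sum>n. (cmod (hardy_coeff u n))\<^sup>2)" for u
    unfolding inner_hardy_def hardy_cinner_def
    unfolding Re_suminf[OF summ] cmod_power2 by (simp add: power2_eq_square)
  show "inner f g = inner g f"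
    unfolding inner_hardy_def hardy_cinner_def
    by (simp add: Re_suminf[OF summ] mult.commute)
  show "inner (f + g) h = inner f h + inner g h"
    unfolding inner_hardy_def hardy_cinner_def
    by (simp add: coeff_add algebra_simps suminf_add[OF summ summ, symmetric])
  show "inner (r *\<^sub>R f) g = r * inner f g"
    unfolding inner_hardy_def hardy_cinner_def scaleR_hardy_def
    by (simp add: hardy_coeff_scaleC mult.assoc suminf_mult[OF summ])
  show "0 \<le> inner f f"
    unfolding inner_self by (intro suminf_nonneg hardy_coeff_square_summable) auto
  show "norm f = sqrt (inner f f)"
    unfolding inner_self by (rule norm_hardy_def)
  show "inner f f = 0 \<longleftrightarrow> f = 0"
  proof
    assume "inner f f = 0"
    then have "hardy_coeff f n = 0" for n
      using suminf_eq_zero_iff[OF hardy_coeff_square_summable[of f]] by (simp add: inner_self)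
    then have "(deriv ^^ n) (hardy_fun f) 0 = 0" for n
      by (simp add: hardy_coeff_def taylor_coeff_def)
    then have "hardy_fun f z = 0" if "z \<in> \<D>" for z
      using holomorphic_fun_eq_0_on_ball[OF hardy_fun_holomorphic that] by blast
    moreover have "hardy_fun f z = 0" if "z \<notin> \<D>" for z
      using hardy_fun[of f] that by (simp add: hardy_set_def)
    ultimately have "hardy_fun f = (\<lambda>z. 0)"
      by blast
    then show "f = 0"
      by (simp add: hardy_fun_inject[symmetric] zero_hardy.rep_eq)
  next
    assume "f = 0"
    then show "inner f f = 0"
      by (simp add: inner_self hardy_coeff_def zero_hardy.rep_eq)
  qed
qed

end


section \<open>Operators on the Hardy space\<close>

text \<open>\<^typ>\<open>hardy \<Rightarrow>\<^sub>L hardy\<close> consists of the bounded real-linear operators; \<open>clinear_op\<close> singles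
  out the complex-linear ones.\<close>

definition clinear_op :: "(hardy \<Rightarrow>\<^sub>L hardy) \<Rightarrow> bool"
  where "clinear_op T \<longleftrightarrow> (\<forall>c f. blinfun_apply T (c *\<^sub>C f) = c *\<^sub>C blinfun_apply T f)"

lift_definition scaleC_op :: "complex \<Rightarrow> hardy \<Rightarrow>\<^sub>L hardy" is "\<lambda>c f. c *\<^sub>C f"
proof (rule bounded_linear_intro)
  fix c r and f g :: hardy
  show "c *\<^sub>C (f + g) = c *\<^sub>C f + c *\<^sub>C g"
    by transfer (simp add: algebra_simps)
  show "c *\<^sub>C (r *\<^sub>R f) = r *\<^sub>R (c *\<^sub>C f)"
    unfolding scaleR_hardy_def by transfer (simp add: algebra_simps)
  show "norm (c *\<^sub>C f) \<le> norm f * cmod c"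
    by (simp add: norm_hardy_def hardy_coeff_scaleC norm_mult power_mult_distrib
        suminf_mult[OF hardy_coeff_square_summable] real_sqrt_mult)
qed

definition is_adjoint_op :: "(hardy \<Rightarrow>\<^sub>L hardy) \<Rightarrow> (hardy \<Rightarrow>\<^sub>L hardy) \<Rightarrow> bool"
  where "is_adjoint_op T S \<longleftrightarrow>
    (\<forall>f g. hardy_cinner (blinfun_apply T f) g = hardy_cinner f (blinfun_apply S g))"

definition compact_ops :: "(hardy \<Rightarrow>\<^sub>L hardy) set"
  where "compact_ops = {T. clinear_op T \<and> compact (closure (blinfun_apply T ` cball 0 1))}"

definition unital_cstar_subalgebra :: "(hardy \<Rightarrow>\<^sub>L hardy) set \<Rightarrow> bool"
  where "unital_cstar_subalgebra A \<longleftrightarrow>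
    (\<forall>T\<in>A. clinear_op T) \<and>
    id_blinfun \<in> A \<and>
    (\<forall>S\<in>A. \<forall>T\<in>A. S + T \<in> A) \<and>
    (\<forall>c. \<forall>T\<in>A. scaleC_op c o\<^sub>L T \<in> A) \<and>
    (\<forall>S\<in>A. \<forall>T\<in>A. S o\<^sub>L T \<in> A) \<and>
    (\<forall>T\<in>A. \<forall>S. is_adjoint_op T S \<longrightarrow> S \<in> A) \<and>
    closed A"

definition cstar_generated :: "(hardy \<Rightarrow>\<^sub>L hardy) set \<Rightarrow> (hardy \<Rightarrow>\<^sub>L hardy) set"
  where "cstar_generated G = \<Inter>{A. unital_cstar_subalgebra A \<and> G \<subseteq> A}"

text \<open>For analytic \<open>\<phi>\<close> mapping the disk into itself, the operator below exists by Littlewood's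
  subordination theorem; it is unique because elements of \<^typ>\<open>hardy\<close> are determined by their values
  on the disk.\<close>

definition composition_op :: "(complex \<Rightarrow> complex) \<Rightarrow> (hardy \<Rightarrow>\<^sub>L hardy)"
  where "composition_op \<phi> =
    (THE T. \<forall>f. \<forall>z\<in>\<D>. hardy_fun (blinfun_apply T f) z = hardy_fun f (\<phi> z))"


section \<open>Linear-fractional self-maps of the disk\<close>

text \<open>The formula is required on the whole plane, so that it also gives the values and derivatives
  at points of the unit circle; a non-constant such map has no pole on the closed disk. Constant
  maps are not excluded here; they neither fix a point of the unit circle nor have supremum norm
  one on the disk.\<close>

definition linear_fractional_self_map :: "(complex \<Rightarrow> complex) \<Rightarrow> bool"
  where "linear_fractional_self_map \<phi> \<longleftrightarrow>
    (\<exists>a b c d. (\<forall>z. \<phi> z = (a * z + b) / (c * z + d)) \<and> (\<forall>z\<in>\<D>. c * z + d \<noteq> 0)) \<and> \<phi> ` \<D> \<subseteq> \<D>"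

definition disk_automorphism :: "(complex \<Rightarrow> complex) \<Rightarrow> bool"
  where "disk_automorphism \<phi> \<longleftrightarrow> linear_fractional_self_map \<phi> \<and> bij_betw \<phi> \<D> \<D>"

definition disk_sup_norm :: "(complex \<Rightarrow> complex) \<Rightarrow> real"
  where "disk_sup_norm \<phi> = (SUP z\<in>\<D>. cmod (\<phi> z))"

end

theory Submission
  imports Defs
begin

text \<open>Let \<open>p = 1 - cnj \<zeta> * z\<close> (below \<open>gap \<zeta> z\<close>) and \<open>w = 1 / p\<close>. The coordinate \<open>w\<close> maps the disk
  onto the half-plane \<open>Re w > 1/2\<close> and sends \<open>\<zeta>\<close> to infinity, so a linear-fractional self-map
  fixing \<open>\<zeta>\<close> becomes an affine map \<open>w \<mapsto> l w + b\<close> with real \<open>l > 0\<close> and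
  \<open>\<kappa> = l + 2 Re b - 1 \<ge> 0\<close>. Its derivative at \<open>\<zeta>\<close> is \<open>1 / l\<close>, and it is an automorphism
  exactly when \<open>\<kappa> = 0\<close>.

  The operators to look at are \<open>W(l, b) f = (f \<circ> \<phi>) / (l + b p)\<close>, where \<open>\<phi>\<close> is the map with
  parameters \<open>(l, b)\<close>. Unlike composition operators they are closed under adjoints up to
  scalars: \<open>W(l, b) W(m, c) = W(l m, m b + c)\<close> and
  \<open>W(l, b)\<^sup>* = W(1 / l, 1 + (cnj b - 1) / l) / l\<close>, without any compact error. The composition
  operator is \<open>C = (l + b P) W(l, b)\<close> with \<open>P\<close> the multiplication by \<open>p\<close>, and \<open>P W(l, b)\<close> is
  compact if \<open>\<kappa> > 0\<close> (\<open>compact_gap_Wop\<close>). Hence a C*-algebra that contains the compact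
  operators contains \<open>C\<close> iff it contains \<open>W(l, b)\<close> (\<open>composition_op_mem_iff_Wop_mem\<close>).

  Sufficiency (\<open>Wop_generated\<close>). An algebra containing \<open>W(l, b)\<close> contains \<open>W(1 / l, _)\<close>, hence
  the translation \<open>E = W(1, t)\<close> with \<open>t = \<kappa> / l > 0\<close>, and some \<open>W(l\<^sup>n, c)\<close> for every integer
  \<open>n\<close>. Multiplying by powers of \<open>E\<close> moves \<open>c\<close> to \<open>c + k t\<close>. As \<open>E\<close> is self-adjoint with
  \<open>0 \<le> E \<le> 1\<close>, the Newton series \<open>\<Sum>j. (s gchoose j) (E - 1)^j\<close> converges in norm for
  \<open>Re s > 0\<close>, and multiplication by its sum moves \<open>c\<close> to \<open>c + s t\<close>; this reaches every
  parameter with large \<open>\<kappa>\<close>. In the other direction, \<open>W(m, c) (1 - E)^N\<close> tends to zero in norm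
  if \<open>W(m, c - t)\<close> is still one of the operators, so \<open>W(m, c)\<close> is recovered from the operators
  \<open>W(m, c + k t)\<close> with \<open>k \<ge> 1\<close>; this descends to every parameter with \<open>\<kappa> > 0\<close>.

  Necessity. Fix a set \<open>J\<close> of weakly null sequences of unit vectors. The operators \<open>T\<close> that
  have a common asymptotic eigenvalue \<open>c\<close>, meaning that \<open>T g\<^sub>n - c g\<^sub>n\<close> and
  \<open>T\<^sup>* g\<^sub>n - cnj c g\<^sub>n\<close> tend to zero for all \<open>g\<close> in \<open>J\<close>, form a unital C*-algebra that
  contains the compact operators (\<open>character_algebra_cstar\<close>, \<open>compact_in_character_algebra\<close>).
  It remains to choose \<open>J\<close> so that the first composition operator belongs to this algebra and
  the second does not.

  Normalized kernels approaching boundary points other than \<open>\<zeta>\<close> are asymptotically killed by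
  \<open>C\<close> and its adjoint if \<open>\<kappa> > 0\<close>. A second map other than the identity whose operator lies in
  this algebra touches the circle only by sending \<open>\<zeta>\<close> to \<open>\<zeta>\<close>, and it is no automorphism
  (\<open>composition_in_kernel_character_algebra\<close>).

  For the derivative, take the normalized powers \<open>w\<^sup>\<alpha>\<close>, which are in the Hardy space for
  \<open>Re \<alpha> < 1/2\<close>, and let \<open>\<alpha>\<close> tend to \<open>1/2 + \<i> \<xi>\<close>. As \<open>W(l, b) w\<^sup>\<alpha>\<close> is \<open>l powr (\<alpha> - 1) w\<^sup>\<alpha>\<close> up
  to a bounded function, while the norm of \<open>w\<^sup>\<alpha>\<close> tends to infinity, the asymptotic eigenvalue
  of \<open>W(l, b)\<close> is \<open>l powr (- 1/2 + \<i> \<xi>)\<close>. If \<open>m\<close> is no integer power of \<open>l\<close>, then some \<open>\<xi>\<close> has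
  \<open>l powr (\<i> \<xi>) = 1\<close> but \<open>m powr (\<i> \<xi>) \<noteq> 1\<close>. So the exponents \<open>1/2\<close> and \<open>1/2 + \<i> \<xi>\<close> give the
  same eigenvalue for \<open>W(l, b)\<close> and different ones for \<open>W(m, c)\<close> (\<open>dilation_factor_is_power\<close>).\<close>

section \<open>Coefficients, inner product and completeness\<close>

lemma hardy_eqI:
  assumes "\<And>z. z \<in> \<D> \<Longrightarrow> hardy_fun f z = hardy_fun g z"
  shows "f = g"
proof -
  have "hardy_fun f z = hardy_fun g z" for z
    using assms hardy_fun[of f] hardy_fun[of g] by (cases "z \<in> \<D>") (auto simp: hardy_set_def)
  then show ?thesis
    by (simp add: hardy_fun_inject[symmetric] fun_eq_iff)
qed

lemma hardy_sums:
  assumes "z \<in> \<D>"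
  shows "(\<lambda>n. hardy_coeff f n * z ^ n) sums hardy_fun f z"
  using holomorphic_power_series[OF hardy_fun_holomorphic assms, of f]
  by (simp add: hardy_coeff_def taylor_coeff_def)

lemma hardy_coeff_inject:
  assumes "\<And>n. hardy_coeff f n = hardy_coeff g n"
  shows "f = g"
proof (rule hardy_eqI)
  fix z assume "z \<in> \<D>"
  then show "hardy_fun f z = hardy_fun g z"
    using hardy_sums[of z f] hardy_sums[of z g] assms by (simp add: sums_iff)
qed

lemma hardy_fun_simps [simp]:
  "hardy_fun (f + g) z = hardy_fun f z + hardy_fun g z"
  "hardy_fun (- f) z = - hardy_fun f z"
  "hardy_fun (c *\<^sub>C f) z = c * hardy_fun f z"
  "hardy_fun (r *\<^sub>R f) z = of_real r * hardy_fun f z"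
  "hardy_fun 0 z = 0"
  by (simp_all add: plus_hardy.rep_eq uminus_hardy.rep_eq hardy_scaleC.rep_eq zero_hardy.rep_eq
      scaleR_hardy_def)

lemma hardy_fun_diff [simp]: "hardy_fun (f - g) z = hardy_fun f z - hardy_fun g z"
  unfolding minus_hardy_def[of f g] hardy_fun_simps(1,2) by (rule add_uminus_conv_diff)

lemma hardy_coeff_simps [simp]:
  "hardy_coeff (f + g) n = hardy_coeff f n + hardy_coeff g n"
  "hardy_coeff (c *\<^sub>C f) n = c * hardy_coeff f n"
  "hardy_coeff 0 n = 0"
  by (simp_all add: hardy_coeff_def plus_hardy.rep_eq zero_hardy.rep_eq taylor_coeff_add
      hardy_fun_holomorphic hardy_scaleC.rep_eq taylor_coeff_cmult)

lemma hardy_uminus_eq: "- f = (- 1) *\<^sub>C f" for f :: hardy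
  by (rule hardy_eqI) simp

lemma hardy_coeff_simps' [simp]:
  "hardy_coeff (- f) n = - hardy_coeff f n"
  "hardy_coeff (r *\<^sub>R f) n = of_real r * hardy_coeff f n"
  by (simp_all add: hardy_uminus_eq scaleR_hardy_def)

lemma hardy_coeff_diff [simp]: "hardy_coeff (f - g) n = hardy_coeff f n - hardy_coeff g n"
  unfolding minus_hardy_def[of f g] hardy_coeff_simps(1) hardy_coeff_simps'(1)
  by (rule add_uminus_conv_diff)

lemma hardy_coeff_sum [simp]: "hardy_coeff (sum F A) n = (\<Sum>i\<in>A. hardy_coeff (F i) n)"
  by (induction A rule: infinite_finite_induct) auto

lemma norm_hardy_sq: "(norm f)\<^sup>2 = (\<Sum>n. (cmod (hardy_coeff f n))\<^sup>2)"
  by (simp add: norm_hardy_def suminf_nonneg hardy_coeff_square_summable)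

lemma square_summable_powser:
  assumes "summable (\<lambda>n. (cmod (a n))\<^sup>2)" and "z \<in> \<D>"
  shows "summable (\<lambda>n. a n * z ^ n)"
proof -
  have "norm ((cmod z)\<^sup>2) < 1"
    using assms(2) by (simp add: norm_power power_less_one_iff)
  then have "summable (\<lambda>n. ((cmod z)\<^sup>2) ^ n)"
    by (rule summable_geometric)
  then have "summable (\<lambda>n. (cmod (cnj z ^ n))\<^sup>2)"
    by (simp add: norm_power power_mult [symmetric] mult.commute)
  from square_summable_mult_cnj[OF assms(1) this] show ?thesis
    by simp
qed

text \<open>Constructs elements whose values and coefficients are both known; the coefficients are
  identified by uniqueness of power series.\<close>

lemma hardy_from_power_series:
  assumes a: "summable (\<lambda>n. (cmod (a n))\<^sup>2)"
    and F: "\<And>z. z \<in> \<D> \<Longrightarrow> (\<lambda>n. a n * z ^ n) sums F z"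
  shows "\<exists>f. (\<forall>n. hardy_coeff f n = a n) \<and> (\<forall>z\<in>\<D>. hardy_fun f z = F z)"
proof -
  \<comment> \<open>elements of the space vanish off the disk\<close>
  define G where "G = (\<lambda>z. if z \<in> \<D> then F z else 0)"
  have "(\<lambda>n. a n * (z - 0) ^ n) sums G z" if "z \<in> \<D>" for z
    using F[OF that] that by (simp add: G_def)
  then have hol: "G holomorphic_on \<D>"
    by (rule power_series_holomorphic)
  have "conv_radius a \<ge> 1"
  proof (rule conv_radius_geI_ex)
    fix r :: real assume r: "0 < r" "ereal r < 1"
    then have "complex_of_real r \<in> \<D>" by simp
    from square_summable_powser[OF a this] r show "\<exists>z. norm z = r \<and> summable (\<lambda>n. a n * z ^ n)"
      by (intro exI[of _ "of_real r"]) auto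
  qed
  then have "G has_fps_expansion Abs_fps a"
    unfolding has_fps_expansion_def
  proof (intro conjI)
    have "eventually (\<lambda>z. z \<in> \<D>) (nhds (0::complex))"
      by (rule eventually_nhds_in_open) auto
    then show "\<forall>\<^sub>F z in nhds 0. eval_fps (Abs_fps a) z = G z"
      by eventually_elim (use F in \<open>auto simp: eval_fps_def G_def sums_iff\<close>)
    show "0 < fps_conv_radius (Abs_fps a)"
      using \<open>conv_radius a \<ge> 1\<close> by (simp add: fps_conv_radius_def order_less_le_trans[of _ 1])
  qed
  from fps_nth_fps_expansion[OF this] have coeff: "taylor_coeff G n = a n" for n
    by (simp add: taylor_coeff_def)
  have G: "G \<in> hardy_set"
    using hol a by (simp add: hardy_set_def coeff) (simp add: G_def)
  have "hardy_coeff (Abs_hardy G) n = a n" for n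
    using G coeff by (simp add: hardy_coeff_def Abs_hardy_inverse)
  moreover have "hardy_fun (Abs_hardy G) z = F z" if "z \<in> \<D>" for z
    using G that by (simp add: Abs_hardy_inverse G_def)
  ultimately show ?thesis
    by blast
qed

lemma hardy_with_coeffs:
  assumes "summable (\<lambda>n. (cmod (a n))\<^sup>2)"
  shows "\<exists>f. \<forall>n. hardy_coeff f n = a n"
  using hardy_from_power_series[OF assms, of "\<lambda>z. \<Sum>n. a n * z ^ n"]
    summable_sums[OF square_summable_powser[OF assms]] by auto

lemma norm_hardy_le_iff:
  assumes "0 \<le> C"
  shows "norm f \<le> C \<longleftrightarrow> (\<forall>N. (\<Sum>n<N. (cmod (hardy_coeff f n))\<^sup>2) \<le> C\<^sup>2)"
proof -
  have "norm f \<le> C \<longleftrightarrow> (norm f)\<^sup>2 \<le> C\<^sup>2"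
    using assms by (simp add: power_mono_iff)
  also have "\<dots> \<longleftrightarrow> (\<forall>N. (\<Sum>n<N. (cmod (hardy_coeff f n))\<^sup>2) \<le> C\<^sup>2)"
    unfolding norm_hardy_sq
    using sum_le_suminf[OF hardy_coeff_square_summable[of f]]
      suminf_le_const[OF hardy_coeff_square_summable[of f]]
    by (meson finite_lessThan order_trans zero_le_power2)
  finally show ?thesis .
qed

lemma hardy_coeff_le_norm: "cmod (hardy_coeff f n) \<le> norm f"
proof -
  have "(\<Sum>k<Suc n. (cmod (hardy_coeff f k))\<^sup>2) \<le> (norm f)\<^sup>2"
    using norm_hardy_le_iff[of "norm f" f] by (meson norm_ge_zero order_refl)
  moreover have "(cmod (hardy_coeff f n))\<^sup>2 \<le> (\<Sum>k<Suc n. (cmod (hardy_coeff f k))\<^sup>2)"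
    by (simp add: sum_nonneg)
  ultimately show ?thesis
    by (meson norm_ge_zero order_trans power2_le_imp_le)
qed

lemma hardy_cinner_summable: "summable (\<lambda>n. hardy_coeff f n * cnj (hardy_coeff g n))"
  by (intro square_summable_mult_cnj hardy_coeff_square_summable)

lemma hardy_cinner_add_left: "hardy_cinner (f + g) h = hardy_cinner f h + hardy_cinner g h"
  by (simp add: hardy_cinner_def algebra_simps
      suminf_add[OF hardy_cinner_summable hardy_cinner_summable, symmetric])

lemma hardy_cinner_scaleC_left [simp]: "hardy_cinner (c *\<^sub>C f) h = c * hardy_cinner f h"
  by (simp add: hardy_cinner_def mult.assoc suminf_mult[OF hardy_cinner_summable])

lemma hardy_cinner_commute: "hardy_cinner g f = cnj (hardy_cinner f g)"
proof -
  have "(\<lambda>n. cnj (hardy_coeff f n * cnj (hardy_coeff g n))) sums cnj (hardy_cinner f g)"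
    unfolding hardy_cinner_def using summable_sums[OF hardy_cinner_summable] by (simp only: sums_cnj)
  then show ?thesis
    by (simp add: hardy_cinner_def sums_iff mult.commute)
qed

lemma hardy_cinner_add_right: "hardy_cinner f (g + h) = hardy_cinner f g + hardy_cinner f h"
  by (metis hardy_cinner_commute hardy_cinner_add_left complex_cnj_add)

lemma hardy_cinner_scaleC_right [simp]: "hardy_cinner f (c *\<^sub>C g) = cnj c * hardy_cinner f g"
  by (metis hardy_cinner_commute hardy_cinner_scaleC_left complex_cnj_mult)

lemma hardy_cinner_self: "hardy_cinner f f = of_real ((norm f)\<^sup>2)"
proof -
  have "hardy_coeff f n * cnj (hardy_coeff f n) = of_real ((cmod (hardy_coeff f n))\<^sup>2)" for n
    by (rule complex_norm_square [symmetric])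
  then show ?thesis
    unfolding hardy_cinner_def norm_hardy_sq
    by (simp add: suminf_of_real[OF hardy_coeff_square_summable, symmetric] del: of_real_power)
qed

lemma norm_hardy_scaleC [simp]: "norm (c *\<^sub>C f) = cmod c * norm f"
  by (simp add: norm_hardy_def norm_mult power_mult_distrib
        suminf_mult[OF hardy_coeff_square_summable] real_sqrt_mult)

text \<open>Multiplying \<open>f\<close> by a unimodular number makes the complex inner product real and nonnegative,
  where the Cauchy-Schwarz inequality of the real inner product applies.\<close>

lemma hardy_cinner_Cauchy_Schwarz: "cmod (hardy_cinner f g) \<le> norm f * norm g"
proof (cases "hardy_cinner f g = 0")
  case False
  define c where "c = cnj (sgn (hardy_cinner f g))"
  have c: "cmod c = 1"
    using False by (simp add: c_def norm_sgn)
  have "c * hardy_cinner f g = of_real (cmod (hardy_cinner f g))"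
    using False unfolding c_def sgn_eq
    by (simp add: complex_norm_square [symmetric] power2_eq_square mult.commute)
  then have "cmod (hardy_cinner f g) = inner (c *\<^sub>C f) g"
    by (simp add: inner_hardy_def)
  also have "\<dots> \<le> norm (c *\<^sub>C f) * norm g"
    by (rule norm_cauchy_schwarz)
  finally show ?thesis
    using c by simp
qed (simp)

interpretation hardy_cinner: bounded_bilinear hardy_cinner
proof
  show "\<exists>K. \<forall>a b. norm (hardy_cinner a b) \<le> norm a * norm b * K"
    using hardy_cinner_Cauchy_Schwarz by (intro exI[of _ 1]) auto
qed (simp_all add: hardy_cinner_add_left hardy_cinner_add_right scaleR_hardy_def scaleR_conv_of_real)

interpretation hardy_scaleC: bounded_bilinear hardy_scaleC
proof
  show "(a + b) *\<^sub>C f = a *\<^sub>C f + b *\<^sub>C f" for a b f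
    by (rule hardy_eqI) (simp add: algebra_simps)
  show "a *\<^sub>C (f + g) = a *\<^sub>C f + a *\<^sub>C g" for a f g
    by (rule hardy_eqI) (simp add: algebra_simps)
  show "(r *\<^sub>R a) *\<^sub>C f = r *\<^sub>R (a *\<^sub>C f)" for r a f
    by (rule hardy_eqI) (simp add: scaleR_conv_of_real)
  show "a *\<^sub>C (r *\<^sub>R f) = r *\<^sub>R (a *\<^sub>C f)" for r a f
    by (rule hardy_eqI) (simp)
  show "\<exists>K. \<forall>a b. norm (a *\<^sub>C b) \<le> norm a * norm b * K"
    by (intro exI[of _ 1]) auto
qed

lemma hardy_scaleC_simps [simp]: "1 *\<^sub>C f = f" "a *\<^sub>C (b *\<^sub>C f) = (a * b) *\<^sub>C f"
  by (rule hardy_eqI; simp)+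

lemma Re_hardy_cinner: "Re (hardy_cinner f g) = inner f g"
  by (simp add: inner_hardy_def)

text \<open>Coefficients of a Cauchy sequence converge one by one. The bound on finite partial sums of
  squares survives the limit, which gives both square summability of the limit and convergence
  in norm.\<close>

instance hardy :: banach
proof
  fix X :: "nat \<Rightarrow> hardy" assume X: "Cauchy X"
  have "Cauchy (\<lambda>m. hardy_coeff (X m) n)" for n
  proof (rule metric_CauchyI)
    fix e :: real assume "e > 0"
    then obtain M where "\<And>m k. m \<ge> M \<Longrightarrow> k \<ge> M \<Longrightarrow> dist (X m) (X k) < e"
      using metric_CauchyD[OF X \<open>e > 0\<close>] by blast
    moreover have "dist (hardy_coeff (X m) n) (hardy_coeff (X k) n) \<le> dist (X m) (X k)" for m k
      using hardy_coeff_le_norm[of "X m - X k" n] by (simp add: dist_norm)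
    ultimately have "dist (hardy_coeff (X m) n) (hardy_coeff (X k) n) < e" if "m \<ge> M" "k \<ge> M" for m k
      using that le_less_trans by blast
    then show "\<exists>M. \<forall>m\<ge>M. \<forall>k\<ge>M. dist (hardy_coeff (X m) n) (hardy_coeff (X k) n) < e"
      by blast
  qed
  then have "\<exists>l. (\<lambda>m. hardy_coeff (X m) n) \<longlonglongrightarrow> l" for n
    by (simp add: Cauchy_convergent_iff convergent_def)
  then obtain a where a: "\<And>n. (\<lambda>m. hardy_coeff (X m) n) \<longlonglongrightarrow> a n"
    by metis
  have tail: "\<exists>M. \<forall>m\<ge>M. \<forall>N. (\<Sum>n<N. (cmod (hardy_coeff (X m) n - a n))\<^sup>2) \<le> e\<^sup>2"
    if "e > 0" for e :: real
  proof -
    obtain M where M: "\<And>m k. m \<ge> M \<Longrightarrow> k \<ge> M \<Longrightarrow> norm (X m - X k) < e"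
      using CauchyD[OF X \<open>e > 0\<close>] by blast
    have "(\<Sum>n<N. (cmod (hardy_coeff (X m) n - a n))\<^sup>2) \<le> e\<^sup>2" if "m \<ge> M" for m N
    proof (rule LIMSEQ_le_const2)
      show "(\<lambda>k. \<Sum>n<N. (cmod (hardy_coeff (X m) n - hardy_coeff (X k) n))\<^sup>2)
        \<longlonglongrightarrow> (\<Sum>n<N. (cmod (hardy_coeff (X m) n - a n))\<^sup>2)"
        by (intro tendsto_intros a)
      have "(\<Sum>n<N. (cmod (hardy_coeff (X m) n - hardy_coeff (X k) n))\<^sup>2) \<le> e\<^sup>2" if "k \<ge> M" for k
        using norm_hardy_le_iff[of e "X m - X k"] M[OF \<open>m \<ge> M\<close> that] \<open>e > 0\<close> by simp
      then show "\<exists>M. \<forall>k\<ge>M. (\<Sum>n<N. (cmod (hardy_coeff (X m) n - hardy_coeff (X k) n))\<^sup>2) \<le> e\<^sup>2"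
        by blast
    qed
    then show ?thesis by blast
  qed
  obtain M where M: "\<And>N. (\<Sum>n<N. (cmod (hardy_coeff (X M) n - a n))\<^sup>2) \<le> 1\<^sup>2"
    using tail[of 1] by auto
  have "summable (\<lambda>n. (cmod (hardy_coeff (X M) n - a n))\<^sup>2)"
    by (rule bounded_imp_summable[of _ 1]) (use M[of "Suc _"] in \<open>auto simp: lessThan_Suc_atMost\<close>)
  then have "summable (\<lambda>n. (cmod (hardy_coeff (- X M) n + a n))\<^sup>2)"
    by (simp add: norm_minus_commute)
  from square_summable_add[OF hardy_coeff_square_summable[of "X M"] this]
  have "\<exists>f. \<forall>n. hardy_coeff f n = a n"
    by (intro hardy_with_coeffs) simp
  then obtain f where f: "\<And>n. hardy_coeff f n = a n"
    by blast
  have "X \<longlonglongrightarrow> f"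
  proof (rule LIMSEQ_I)
    fix e :: real assume "e > 0"
    then obtain M where "\<And>m N. m \<ge> M \<Longrightarrow> (\<Sum>n<N. (cmod (hardy_coeff (X m) n - a n))\<^sup>2) \<le> (e/2)\<^sup>2"
      using tail[of "e/2"] by auto
    then have "norm (X m - f) \<le> e/2" if "m \<ge> M" for m
      using that \<open>e > 0\<close> by (subst norm_hardy_le_iff) (auto simp: f)
    then show "\<exists>M. \<forall>m\<ge>M. norm (X m - f) < e"
      using \<open>e > 0\<close> by (intro exI[of _ M]) force
  qed
  then show "convergent X"
    by (auto simp: convergent_def)
qed

section \<open>Kernels and monomials\<close>

lemma summable_powers_sq: "w \<in> \<D> \<Longrightarrow> summable (\<lambda>n. (cmod (w ^ n))\<^sup>2)"
  and suminf_powers_sq: "w \<in> \<D> \<Longrightarrow> (\<Sum>n. (cmod (w ^ n))\<^sup>2) = 1 / (1 - (cmod w)\<^sup>2)"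
proof -
  assume "w \<in> \<D>"
  then have *: "norm ((cmod w)\<^sup>2) < 1"
    by (simp add: norm_power power_less_one_iff)
  have "(\<lambda>n. (cmod (w ^ n))\<^sup>2) = (\<lambda>n. ((cmod w)\<^sup>2) ^ n)"
    by (simp add: norm_power power_mult [symmetric] mult.commute)
  with summable_geometric[OF *] suminf_geometric[OF *]
  show "summable (\<lambda>n. (cmod (w ^ n))\<^sup>2)" "(\<Sum>n. (cmod (w ^ n))\<^sup>2) = 1 / (1 - (cmod w)\<^sup>2)"
    by simp_all
qed

definition hardy_kernel :: "complex \<Rightarrow> hardy"
  where "hardy_kernel w = (SOME f. \<forall>n. hardy_coeff f n = cnj w ^ n)"

lemma hardy_coeff_kernel [simp]:
  assumes "w \<in> \<D>"
  shows "hardy_coeff (hardy_kernel w) n = cnj w ^ n"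
proof -
  have "cnj w \<in> \<D>"
    using assms by simp
  then obtain f where "\<forall>n. hardy_coeff f n = cnj w ^ n"
    using hardy_with_coeffs[OF summable_powers_sq[of "cnj w"]] by blast
  then show ?thesis
    unfolding hardy_kernel_def by (rule someI2) simp
qed

lemma hardy_cinner_kernel: "w \<in> \<D> \<Longrightarrow> hardy_cinner f (hardy_kernel w) = hardy_fun f w"
  using hardy_sums[of w f] by (simp add: hardy_cinner_def sums_iff)

lemma hardy_fun_kernel:
  assumes "w \<in> \<D>" "z \<in> \<D>"
  shows "hardy_fun (hardy_kernel w) z = 1 / (1 - cnj w * z)"
proof -
  have "cmod (cnj w * z) < 1"
    using assms mult_strict_mono'[of "cmod w" 1 "cmod z" 1] by (simp add: norm_mult)
  then have "(\<lambda>n. (cnj w * z) ^ n) sums (1 / (1 - cnj w * z))"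
    by (rule geometric_sums)
  moreover have "(\<lambda>n. (cnj w * z) ^ n) sums hardy_fun (hardy_kernel w) z"
    using hardy_sums[OF assms(2), of "hardy_kernel w"] assms(1)
    by (simp add: power_mult_distrib)
  ultimately show ?thesis
    using sums_unique2 by blast
qed

lemma norm_hardy_kernel_sq: "w \<in> \<D> \<Longrightarrow> (norm (hardy_kernel w))\<^sup>2 = 1 / (1 - (cmod w)\<^sup>2)"
  using suminf_powers_sq[of "cnj w"] by (simp add: norm_hardy_sq)

lemma hardy_fun_le:
  assumes "w \<in> \<D>"
  shows "cmod (hardy_fun f w) \<le> norm f * norm (hardy_kernel w)"
  using hardy_cinner_Cauchy_Schwarz[of f "hardy_kernel w"] assms by (simp add: hardy_cinner_kernel)

text \<open>Point evaluation is the inner product with a kernel, hence continuous.\<close>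

lemma tendsto_hardy_fun:
  assumes "(X \<longlongrightarrow> f) F" "w \<in> \<D>"
  shows "((\<lambda>n. hardy_fun (X n) w) \<longlongrightarrow> hardy_fun f w) F"
  using hardy_cinner.tendsto[OF assms(1) tendsto_const, of "hardy_kernel w"] assms(2)
  by (simp add: hardy_cinner_kernel)

definition hardy_monomial :: "nat \<Rightarrow> hardy"
  where "hardy_monomial n = (SOME f. \<forall>k. hardy_coeff f k = (if k = n then 1 else 0))"

lemma hardy_coeff_monomial [simp]:
  "hardy_coeff (hardy_monomial n) k = (if k = n then 1 else 0)"
proof -
  have "summable (\<lambda>k. (cmod (if k = n then 1 else 0))\<^sup>2)"
    by (rule summable_finite[of "{n}"]) auto
  from hardy_with_coeffs[OF this] obtain f where "\<forall>k. hardy_coeff f k = (if k = n then 1 else 0)"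
    by blast
  then show ?thesis
    unfolding hardy_monomial_def by (rule someI2) simp
qed

lemma hardy_taylor_tendsto: "(\<lambda>N. \<Sum>n<N. hardy_coeff f n *\<^sub>C hardy_monomial n) \<longlonglongrightarrow> f"
proof -
  let ?P = "\<lambda>N. \<Sum>n<N. hardy_coeff f n *\<^sub>C hardy_monomial n"
  let ?a = "\<lambda>n. (cmod (hardy_coeff f n))\<^sup>2"
  have coeff: "hardy_coeff (?P N) k = (if k < N then hardy_coeff f k else 0)" for N k
  proof -
    have "hardy_coeff (?P N) k = (\<Sum>n<N. if k = n then hardy_coeff f n else 0)"
      by (simp add: if_distrib cong: if_cong)
    also have "\<dots> = (if k < N then hardy_coeff f k else 0)"
      by (subst sum.delta') auto
    finally show ?thesis .
  qed
  have "(norm (f - ?P N))\<^sup>2 = (\<Sum>n. ?a (n + N))" for N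
  proof -
    have "summable (\<lambda>k. (cmod (hardy_coeff (f - ?P N) k))\<^sup>2)"
      by (rule hardy_coeff_square_summable)
    from suminf_split_initial_segment[OF this, of N] show ?thesis
      unfolding norm_hardy_sq by (simp add: coeff del: hardy_coeff_sum)
  qed
  then have "(norm (f - ?P N))\<^sup>2 = (\<Sum>n. ?a n) - (\<Sum>n<N. ?a n)" for N
    by (simp add: suminf_minus_initial_segment[OF hardy_coeff_square_summable])
  moreover have "(\<lambda>N. (\<Sum>n. ?a n) - (\<Sum>n<N. ?a n)) \<longlonglongrightarrow> (\<Sum>n. ?a n) - (\<Sum>n. ?a n)"
    by (intro tendsto_diff tendsto_const summable_LIMSEQ hardy_coeff_square_summable)
  ultimately have "(\<lambda>N. (norm (f - ?P N))\<^sup>2) \<longlonglongrightarrow> 0"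
    by simp
  then have "(\<lambda>N. norm (f - ?P N)) \<longlonglongrightarrow> 0"
    by (simp add: power_tendsto_0_iff)
  then have "(\<lambda>N. norm (?P N - f)) \<longlonglongrightarrow> 0"
    by (simp only: norm_minus_commute[of f])
  from LIM_zero_cancel[OF tendsto_norm_zero_cancel[OF this]] show ?thesis .
qed

lemma hardy_closed_subspace_sum:
  assumes "0 \<in> S" "\<And>f g. f \<in> S \<Longrightarrow> g \<in> S \<Longrightarrow> f + g \<in> S" "\<And>i. i \<in> A \<Longrightarrow> F i \<in> S"
  shows "sum F A \<in> (S :: hardy set)"
  using assms(3) by (induction A rule: infinite_finite_induct) (auto intro: assms)

lemma hardy_monomials_dense:
  assumes "closed S" "0 \<in> S" "\<And>f g. f \<in> S \<Longrightarrow> g \<in> S \<Longrightarrow> f + g \<in> S"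
    and "\<And>c f. f \<in> S \<Longrightarrow> c *\<^sub>C f \<in> S" and "\<And>n. hardy_monomial n \<in> S"
  shows "f \<in> S"
proof (rule closed_sequentially[OF assms(1) _ hardy_taylor_tendsto])
  show "(\<Sum>n<N. hardy_coeff f n *\<^sub>C hardy_monomial n) \<in> S" for N
    by (intro hardy_closed_subspace_sum assms)
qed

text \<open>The kernels on one open radius span a dense subspace. With \<open>q = cnj \<zeta> r\<close>, the kernel at
  \<open>\<zeta> r\<close> has coefficients \<open>q^k\<close>; subtracting the monomials below \<open>n\<close> and dividing by \<open>q^n\<close>
  leaves a vector that tends to the \<open>n\<close>-th monomial as \<open>r \<rightarrow> 0\<close>. Induction on \<open>n\<close> puts all
  monomials into the closed subspace.\<close>

lemma hardy_kernels_dense: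
  assumes "closed S" "0 \<in> S" and add: "\<And>f g. f \<in> S \<Longrightarrow> g \<in> S \<Longrightarrow> f + g \<in> S"
    and scale: "\<And>c f. f \<in> S \<Longrightarrow> c *\<^sub>C f \<in> S"
    and ker: "\<And>r. 0 < r \<Longrightarrow> r < 1 \<Longrightarrow> hardy_kernel (\<zeta> * of_real r) \<in> S" and "cmod \<zeta> = 1"
  shows "f \<in> S"
proof (rule hardy_monomials_dense[OF assms(1-4)])
  fix n
  show "hardy_monomial n \<in> S"
  proof (induction n rule: less_induct)
    case (less n)
    define q where "q r = cnj \<zeta> * complex_of_real r" for r
    define y where "y r = (1 / q r ^ n) *\<^sub>C (hardy_kernel (\<zeta> * of_real r) +
      (- 1) *\<^sub>C (\<Sum>j<n. q r ^ j *\<^sub>C hardy_monomial j))" for r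
    have y: "y r \<in> S" if "0 < r" "r < 1" for r
      unfolding y_def by (intro add scale ker hardy_closed_subspace_sum less assms that) auto
    have dist: "(norm (y r - hardy_monomial n))\<^sup>2 \<le> 2 * r" if r: "0 < r" "r \<le> 1/2" for r
    proof -
      have in_D: "\<zeta> * of_real r \<in> \<D>" "of_real r \<in> \<D>"
        using r \<open>cmod \<zeta> = 1\<close> by (auto simp: norm_mult)
      have q: "q r \<noteq> 0" "cmod (q r) = r"
        using r \<open>cmod \<zeta> = 1\<close> by (auto simp: q_def norm_mult)
      have "hardy_coeff (y r) k = (if k < n then 0 else q r ^ (k - n))" for k
      proof -
        have "(\<Sum>j<n. q r ^ j * (if k = j then 1 else 0)) = (if k < n then q r ^ k else 0)"
          by (simp add: if_distrib sum.delta' cong: if_cong)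
        then show ?thesis
          using in_D q unfolding y_def by (simp add: q_def power_diff del: power_mult_distrib)
      qed
      then have coeff: "hardy_coeff (y r - hardy_monomial n) k = (if k \<le> n then 0 else q r ^ (k - n))"
        for k by auto
      have "(norm (y r - hardy_monomial n))\<^sup>2
          = (\<Sum>k. (cmod (hardy_coeff (y r - hardy_monomial n) (k + Suc n)))\<^sup>2)"
        unfolding norm_hardy_sq
        by (subst suminf_split_initial_segment[OF hardy_coeff_square_summable, of _ "Suc n"])
          (simp add: coeff del: hardy_coeff_diff)
      also have "\<dots> = (\<Sum>k. r\<^sup>2 * (cmod (complex_of_real r ^ k))\<^sup>2)"
        using r q by (simp add: coeff norm_power norm_mult power_mult_distrib del: hardy_coeff_diff)
      also have "\<dots> = r\<^sup>2 * (1 / (1 - r\<^sup>2))"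
        using suminf_mult[OF summable_powers_sq[OF in_D(2)], of "r\<^sup>2"] suminf_powers_sq[OF in_D(2)]
        by (simp del: power_mult_distrib)
      also have "\<dots> \<le> 2 * r"
      proof -
        have "r\<^sup>2 \<le> (1/2)\<^sup>2" using r by (intro power_mono) auto
        then have "r * (r * 1) \<le> r * (2 * (1 - r\<^sup>2))"
          using r by (intro mult_left_mono) (auto simp: power2_eq_square)
        then show ?thesis
          using \<open>r\<^sup>2 \<le> (1/2)\<^sup>2\<close> by (simp add: field_simps power2_eq_square)
      qed
      finally show ?thesis .
    qed
    define r where "r m = inverse (real (Suc (Suc m)))" for m
    have r: "0 < r m" "r m \<le> 1/2" for m
      by (auto simp: r_def field_simps)
    have "r \<longlonglongrightarrow> 0"
      unfolding r_def using LIMSEQ_Suc[OF LIMSEQ_inverse_real_of_nat] by simp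
    then have "(\<lambda>m. 2 * r m) \<longlonglongrightarrow> 0"
      by (simp add: tendsto_mult_right_zero)
    then have "(\<lambda>m. (norm (y (r m) - hardy_monomial n))\<^sup>2) \<longlonglongrightarrow> 0"
      by (rule tendsto_sandwich[OF _ _ tendsto_const, rotated 2])
        (use dist r in \<open>auto intro!: always_eventually\<close>)
    then have "(\<lambda>m. norm (y (r m) - hardy_monomial n)) \<longlonglongrightarrow> 0"
      by (simp add: power_tendsto_0_iff)
    then have lim: "(\<lambda>m. y (r m)) \<longlonglongrightarrow> hardy_monomial n"
      by (simp only: tendsto_norm_zero_iff LIM_zero_iff)
    have "y (r m) \<in> S" for m
      using r[of m] by (intro y) auto
    then show ?case
      by (rule closed_sequentially[OF \<open>closed S\<close> _ lim])
  qed
qed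

lemma hardy_eq_0_if_orthogonal_kernels:
  assumes "\<And>r. 0 < r \<Longrightarrow> r < 1 \<Longrightarrow> hardy_cinner f (hardy_kernel (\<zeta> * of_real r)) = 0" "cmod \<zeta> = 1"
  shows "f = 0"
proof -
  have "f \<in> {g. hardy_cinner f g = 0}"
  proof (rule hardy_kernels_dense[where \<zeta> = \<zeta>])
    show "closed {g. hardy_cinner f g = 0}"
      by (intro closed_Collect_eq continuous_intros
          linear_continuous_on hardy_cinner.bounded_linear_right)
  qed (use assms in \<open>auto simp: hardy_cinner_add_right hardy_cinner.zero_right\<close>)
  then show ?thesis
    by (simp add: hardy_cinner_self)
qed

section \<open>Weighted composition operators, the shift and compactness\<close>

text \<open>The weighted composite of an element of the space need not belong to the space; the
  predicate demands this together with the norm bound, and \<open>wcomp\<close> is meaningful only under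
  it.\<close>

definition wcomp_bounded :: "real \<Rightarrow> (complex \<Rightarrow> complex) \<Rightarrow> (complex \<Rightarrow> complex) \<Rightarrow> bool"
  where "wcomp_bounded C h \<phi> \<longleftrightarrow>
    (\<forall>f. \<exists>g. (\<forall>z\<in>\<D>. hardy_fun g z = h z * hardy_fun f (\<phi> z)) \<and> norm g \<le> C * norm f)"

definition wcomp :: "(complex \<Rightarrow> complex) \<Rightarrow> (complex \<Rightarrow> complex) \<Rightarrow> (hardy \<Rightarrow>\<^sub>L hardy)"
  where "wcomp h \<phi> = Blinfun (\<lambda>f. THE g. \<forall>z\<in>\<D>. hardy_fun g z = h z * hardy_fun f (\<phi> z))"

lemma
  assumes "wcomp_bounded C h \<phi>"
  shows hardy_fun_wcomp: "z \<in> \<D> \<Longrightarrow> hardy_fun (wcomp h \<phi> f) z = h z * hardy_fun f (\<phi> z)"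
    and norm_wcomp_apply: "norm (wcomp h \<phi> f) \<le> C * norm f"
proof -
  define T where "T = (\<lambda>f. THE g. \<forall>z\<in>\<D>. hardy_fun g z = h z * hardy_fun f (\<phi> z))"
  have T: "(\<forall>z\<in>\<D>. hardy_fun (T f) z = h z * hardy_fun f (\<phi> z)) \<and> norm (T f) \<le> C * norm f" for f
  proof -
    obtain g where g: "\<forall>z\<in>\<D>. hardy_fun g z = h z * hardy_fun f (\<phi> z)" "norm g \<le> C * norm f"
      using assms unfolding wcomp_bounded_def by blast
    have "T f = g"
      unfolding T_def by (rule the_equality) (use g in \<open>auto intro: hardy_eqI\<close>)
    with g show ?thesis by simp
  qed
  have "bounded_linear T"
  proof (rule bounded_linear_intro)
    show "T (f + g) = T f + T g" for f g
      by (rule hardy_eqI) (simp add: T algebra_simps)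
    show "T (r *\<^sub>R f) = r *\<^sub>R T f" for r f
      by (rule hardy_eqI) (simp add: T algebra_simps)
    show "norm (T f) \<le> norm f * C" for f
      using T by (simp add: mult.commute)
  qed
  then have "blinfun_apply (wcomp h \<phi>) = T"
    unfolding wcomp_def T_def[symmetric] by (rule bounded_linear_Blinfun_apply)
  then show "z \<in> \<D> \<Longrightarrow> hardy_fun (wcomp h \<phi> f) z = h z * hardy_fun f (\<phi> z)"
    "norm (wcomp h \<phi> f) \<le> C * norm f"
    using T by auto
qed

lemma clinear_wcomp:
  assumes "wcomp_bounded C h \<phi>"
  shows "clinear_op (wcomp h \<phi>)"
  unfolding clinear_op_def
  by (intro allI hardy_eqI) (simp add: hardy_fun_wcomp[OF assms])

lemma blinfun_hardy_eqI:
  fixes S T :: "hardy \<Rightarrow>\<^sub>L hardy"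
  assumes "\<And>f z. z \<in> \<D> \<Longrightarrow> hardy_fun (S f) z = hardy_fun (T f) z"
  shows "S = T"
  by (intro blinfun_eqI hardy_eqI assms)

text \<open>Any bounded operator with the right values identifies the composition operator, which is
  otherwise known only by description.\<close>

lemma composition_op_eqI:
  fixes T :: "hardy \<Rightarrow>\<^sub>L hardy"
  assumes "\<And>f z. z \<in> \<D> \<Longrightarrow> hardy_fun (T f) z = hardy_fun f (\<phi> z)"
  shows "composition_op \<phi> = T"
  unfolding composition_op_def
  by (rule the_equality) (use assms in \<open>auto intro: blinfun_hardy_eqI\<close>)

lemma clinear_hardyD: "clinear_op T \<Longrightarrow> T (c *\<^sub>C f) = c *\<^sub>C T f"
  by (simp add: clinear_op_def)

lemma scaleC_op_apply [simp]: "scaleC_op c f = c *\<^sub>C f"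
  by (simp add: scaleC_op.rep_eq)

lemma clinear_op_intros [intro]:
  "clinear_op id_blinfun" "clinear_op (scaleC_op c)"
  "clinear_op S \<Longrightarrow> clinear_op T \<Longrightarrow> clinear_op (S + T)"
  "clinear_op S \<Longrightarrow> clinear_op T \<Longrightarrow> clinear_op (S - T)"
  "clinear_op S \<Longrightarrow> clinear_op T \<Longrightarrow> clinear_op (S o\<^sub>L T)"
  by (simp_all add: clinear_op_def blinfun.bilinear_simps hardy_scaleC.add_right
      hardy_scaleC.diff_right mult.commute)

lemma
  shows shift_bounded: "wcomp_bounded 1 (\<lambda>z. z) (\<lambda>z. z)"
    and norm_shift [simp]: "norm (wcomp (\<lambda>z. z) (\<lambda>z. z) f) = norm f"
    and hardy_coeff_shift:
      "hardy_coeff (wcomp (\<lambda>z. z) (\<lambda>z. z) f) n = (case n of 0 \<Rightarrow> 0 | Suc m \<Rightarrow> hardy_coeff f m)"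
proof -
  have ex: "\<exists>g. (\<forall>z\<in>\<D>. hardy_fun g z = z * hardy_fun f z) \<and> norm g = norm f \<and>
    (\<forall>n. hardy_coeff g n = (case n of 0 \<Rightarrow> 0 | Suc m \<Rightarrow> hardy_coeff f m))" for f
  proof -
    let ?b = "\<lambda>n. case n of 0 \<Rightarrow> 0 | Suc m \<Rightarrow> hardy_coeff f m"
    have s: "summable (\<lambda>n. (cmod (?b n))\<^sup>2)"
      using hardy_coeff_square_summable[of f] by (subst summable_Suc_iff[symmetric]) simp
    have "(\<lambda>n. ?b n * z ^ n) sums (z * hardy_fun f z)" if "z \<in> \<D>" for z
      using sums_mult[OF hardy_sums[OF that, of f], of z]
      by (subst sums_Suc_iff[symmetric, where f = "\<lambda>n. ?b n * z ^ n", simplified])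
        (simp add: algebra_simps)
    from hardy_from_power_series[OF s this] obtain g where
      g: "\<And>n. hardy_coeff g n = ?b n" "\<And>z. z \<in> \<D> \<Longrightarrow> hardy_fun g z = z * hardy_fun f z"
      by blast
    have "(norm g)\<^sup>2 = (norm f)\<^sup>2"
      unfolding norm_hardy_sq g using suminf_split_head[OF s] by simp
    then have "norm g = norm f"
      by (simp add: power2_eq_iff_nonneg)
    with g show ?thesis by blast
  qed
  then show b: "wcomp_bounded 1 (\<lambda>z. z) (\<lambda>z. z)"
    unfolding wcomp_bounded_def by (metis mult_1 order_refl)
  obtain g where g: "\<forall>z\<in>\<D>. hardy_fun g z = z * hardy_fun f z" "norm g = norm f"
    "\<forall>n. hardy_coeff g n = (case n of 0 \<Rightarrow> 0 | Suc m \<Rightarrow> hardy_coeff f m)"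
    using ex by blast
  have "wcomp (\<lambda>z. z) (\<lambda>z. z) f = g"
    by (rule hardy_eqI) (simp add: g hardy_fun_wcomp[OF b])
  with g show "norm (wcomp (\<lambda>z. z) (\<lambda>z. z) f) = norm f"
    "hardy_coeff (wcomp (\<lambda>z. z) (\<lambda>z. z) f) n = (case n of 0 \<Rightarrow> 0 | Suc m \<Rightarrow> hardy_coeff f m)"
    by auto
qed

abbreviation hardy_shift :: "hardy \<Rightarrow>\<^sub>L hardy"
  where "hardy_shift \<equiv> wcomp (\<lambda>z. z) (\<lambda>z. z)"

lemma hardy_fun_shift [simp]: "z \<in> \<D> \<Longrightarrow> hardy_fun (hardy_shift f) z = z * hardy_fun f z"
  by (rule hardy_fun_wcomp[OF shift_bounded])

lemma hardy_coeff_shift_funpow: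
  "hardy_coeff ((blinfun_apply hardy_shift ^^ N) f) n = (if n < N then 0 else hardy_coeff f (n - N))"
  by (induction N arbitrary: n) (auto simp: hardy_coeff_shift split: nat.split)

text \<open>A sum of finitely many compact sets is compact; the sets here are images of the closed unit
  disk.\<close>

lemma compact_disk_combinations:
  "compact {\<Sum>n<N. c n *\<^sub>C v n | c. \<forall>n. cmod (c n) \<le> 1}" for v :: "nat \<Rightarrow> hardy"
proof (induction N)
  case 0
  have "{\<Sum>n<0. c n *\<^sub>C v n | c. \<forall>n. cmod (c n) \<le> 1} = {0}"
    by (auto intro: exI[of _ "\<lambda>_. 0"])
  then show ?case
    by (simp only: compact_sing)
next
  case (Suc N)
  let ?K = "\<lambda>N. {\<Sum>n<N. c n *\<^sub>C v n | c. \<forall>n. cmod (c n) \<le> 1}"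
  have "compact {x + y | x y. x \<in> ?K N \<and> y \<in> (\<lambda>c. c *\<^sub>C v N) ` cball 0 1}"
    by (intro compact_sums Suc.IH compact_continuous_image
        linear_continuous_on hardy_scaleC.bounded_linear_left compact_cball)
  also have "{x + y | x y. x \<in> ?K N \<and> y \<in> (\<lambda>c. c *\<^sub>C v N) ` cball 0 1} = ?K (Suc N)"
  proof (intro equalityI subsetI)
    fix u assume "u \<in> {x + y | x y. x \<in> ?K N \<and> y \<in> (\<lambda>c. c *\<^sub>C v N) ` cball 0 1}"
    then obtain c d where cd: "u = (\<Sum>n<N. c n *\<^sub>C v n) + d *\<^sub>C v N" "\<forall>n. cmod (c n) \<le> 1" "cmod d \<le> 1"
      by auto
    then have "u = (\<Sum>n<Suc N. (c(N := d)) n *\<^sub>C v n)"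
      by simp
    moreover have "\<forall>n. cmod ((c(N := d)) n) \<le> 1"
      using cd by simp
    ultimately show "u \<in> ?K (Suc N)"
      by blast
  next
    fix u assume "u \<in> ?K (Suc N)"
    then obtain c where "u = (\<Sum>n<N. c n *\<^sub>C v n) + c N *\<^sub>C v N" "\<forall>n. cmod (c n) \<le> 1"
      by auto
    moreover from this have "c N *\<^sub>C v N \<in> (\<lambda>c. c *\<^sub>C v N) ` cball 0 1"
      by auto
    ultimately show "u \<in> {x + y | x y. x \<in> ?K N \<and> y \<in> (\<lambda>c. c *\<^sub>C v N) ` cball 0 1}"
      by blast
  qed
  finally show ?case .
qed

text \<open>Every \<open>f\<close> in the unit ball is a polynomial of degree below \<open>N\<close> plus \<open>S^N g\<close> with \<open>\<parallel>g\<parallel> \<le> 1\<close>,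
  \<open>S\<close> the shift. The images of the polynomials lie in a compact set and the image of the rest
  is small, so the image of the ball is totally bounded.\<close>

lemma compact_op_if_small_on_shifts:
  assumes T: "clinear_op T" and lim: "\<epsilon> \<longlonglongrightarrow> 0"
    and small: "\<And>N f. norm (T ((blinfun_apply hardy_shift ^^ N) f)) \<le> \<epsilon> N * norm f"
  shows "T \<in> compact_ops"
proof -
  have "\<exists>k. finite k \<and> closure (T ` cball 0 1) \<subseteq> (\<Union>x\<in>k. ball x e)" if "e > 0" for e :: real
  proof -
    have "eventually (\<lambda>N. \<epsilon> N < e/4) sequentially"
      using \<open>e > 0\<close> by (intro order_tendstoD[OF lim]) auto
    then obtain N where N: "\<epsilon> N < e/4"
      by (auto simp: eventually_sequentially)
    let ?K = "{\<Sum>n<N. c n *\<^sub>C T (hardy_monomial n) | c. \<forall>n. cmod (c n) \<le> 1}"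
    obtain k where k: "finite k" "?K \<subseteq> (\<Union>x\<in>k. ball x (e/4))"
      using compact_disk_combinations[where N = N and v = "\<lambda>n. T (hardy_monomial n)"] \<open>e > 0\<close>
      unfolding compact_eq_totally_bounded by (meson divide_pos_pos zero_less_numeral)
    have "T ` cball 0 1 \<subseteq> (\<Union>x\<in>k. cball x (e/2))"
    proof (rule image_subsetI)
      fix f :: hardy assume f: "f \<in> cball 0 1"
      have s: "summable (\<lambda>n. (cmod (hardy_coeff f (n + N)))\<^sup>2)"
        by (rule summable_ignore_initial_segment[OF hardy_coeff_square_summable])
      from hardy_with_coeffs[OF s] obtain g where g: "\<And>n. hardy_coeff g n = hardy_coeff f (n + N)"
        by blast
      have "(norm g)\<^sup>2 \<le> (norm f)\<^sup>2"
        unfolding norm_hardy_sq g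
        by (subst suminf_split_initial_segment[OF hardy_coeff_square_summable[of f], of N])
          (simp add: sum_nonneg)
      then have "norm g \<le> 1"
        using f by (auto simp: power2_le_iff_abs_le intro: order_trans)
      have split: "f = (\<Sum>n<N. hardy_coeff f n *\<^sub>C hardy_monomial n) + (blinfun_apply hardy_shift ^^ N) g"
      proof (rule hardy_coeff_inject)
        fix n
        have "(\<Sum>j<N. hardy_coeff f j * (if n = j then 1 else 0)) = (if n < N then hardy_coeff f n else 0)"
          by (simp add: if_distrib sum.delta' cong: if_cong)
        then show "hardy_coeff f n
          = hardy_coeff ((\<Sum>n<N. hardy_coeff f n *\<^sub>C hardy_monomial n) + (blinfun_apply hardy_shift ^^ N) g) n"
          by (simp add: hardy_coeff_shift_funpow g)
      qed
      have "(\<Sum>n<N. hardy_coeff f n *\<^sub>C T (hardy_monomial n)) \<in> ?K"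
        using hardy_coeff_le_norm[of f] f by (auto intro: order_trans)
      then obtain x where x: "x \<in> k" "dist x (\<Sum>n<N. hardy_coeff f n *\<^sub>C T (hardy_monomial n)) < e/4"
        using k(2) by auto
      have "T f = (\<Sum>n<N. hardy_coeff f n *\<^sub>C T (hardy_monomial n)) + T ((blinfun_apply hardy_shift ^^ N) g)"
        by (subst split) (simp add: blinfun.bilinear_simps blinfun.sum_right clinear_hardyD[OF T])
      then have "dist (\<Sum>n<N. hardy_coeff f n *\<^sub>C T (hardy_monomial n)) (T f)
          = norm (T ((blinfun_apply hardy_shift ^^ N) g))"
        by (simp add: dist_norm)
      also have "\<dots> \<le> \<epsilon> N * norm g"
        by (rule small)
      also have "\<dots> \<le> e/4 * 1"
        using N \<open>norm g \<le> 1\<close> \<open>e > 0\<close> by (intro mult_mono) auto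
      finally have "dist x (T f) \<le> e/2"
        using x(2) dist_triangle[of x "T f" "\<Sum>n<N. hardy_coeff f n *\<^sub>C T (hardy_monomial n)"] by linarith
      with x(1) show "T f \<in> (\<Union>x\<in>k. cball x (e/2))"
        by auto
    qed
    then have "closure (T ` cball 0 1) \<subseteq> (\<Union>x\<in>k. cball x (e/2))"
      using k(1) by (intro closure_minimal closed_UN) auto
    also have "\<dots> \<subseteq> (\<Union>x\<in>k. ball x e)"
      using \<open>e > 0\<close> by force
    finally show ?thesis
      using k(1) by blast
  qed
  then show ?thesis
    using T by (auto simp: compact_ops_def compact_eq_totally_bounded complete_eq_closed)
qed

section \<open>Linear-fractional maps in the half-plane coordinate\<close>

text \<open>The reciprocal of the half-plane coordinate at the boundary point \<open>\<zeta>\<close>.\<close>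

definition gap :: "complex \<Rightarrow> complex \<Rightarrow> complex"
  where "gap \<zeta> u = 1 - cnj \<zeta> * u"

text \<open>In the half-plane coordinate the weight is \<open>w / (l w + b)\<close>.\<close>

definition lfw :: "complex \<Rightarrow> real \<Rightarrow> complex \<Rightarrow> complex \<Rightarrow> complex"
  where "lfw \<zeta> l b u = 1 / (of_real l + b * gap \<zeta> u)"

text \<open>In the coordinate \<open>w = 1 / gap \<zeta> u\<close> this is the affine map \<open>w \<mapsto> l w + b\<close>; lemma \<open>gap_lft\<close>
  says so.\<close>

definition lft :: "complex \<Rightarrow> real \<Rightarrow> complex \<Rightarrow> complex \<Rightarrow> complex"
  where "lft \<zeta> l b u = \<zeta> * (1 - gap \<zeta> u * lfw \<zeta> l b u)"

text \<open>Twice the amount by which the half-plane \<open>Re w > 1/2\<close> is pushed into itself by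
  \<open>w \<mapsto> l w + b\<close>, as the boundary line is mapped to \<open>Re w = 1/2 + kap l b / 2\<close>.\<close>

definition kap :: "real \<Rightarrow> complex \<Rightarrow> real"
  where "kap l b = l + 2 * Re b - 1"

text \<open>Division by \<open>(cmod (gap \<zeta> u))\<^sup>2\<close> turns the right-hand side into \<open>2 Re w - 1\<close>: the defect of
  \<open>u\<close> from the unit circle measures the distance of \<open>w\<close> from the boundary of the half-plane.\<close>

lemma gap_identity:
  assumes "cmod \<zeta> = 1"
  shows "1 - (cmod u)\<^sup>2 = 2 * Re (gap \<zeta> u) - (cmod (gap \<zeta> u))\<^sup>2"
proof -
  have "cmod u = cmod (cnj \<zeta> * u)"
    using assms by (simp add: norm_mult)
  moreover have "1 - (cmod w)\<^sup>2 = 2 * Re (1 - w) - (cmod (1 - w))\<^sup>2" for w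
    unfolding cmod_power2 by (simp add: power2_eq_square algebra_simps)
  ultimately show ?thesis
    unfolding gap_def by metis
qed

lemma one_minus_cnj_mult:
  assumes "cmod \<zeta> = 1"
  shows "1 - cnj z * u = gap \<zeta> u + cnj (gap \<zeta> z) - gap \<zeta> u * cnj (gap \<zeta> z)"
proof -
  have "\<zeta> * cnj \<zeta> = 1"
    using assms by (simp add: complex_norm_square [symmetric])
  then have "cnj z * u = (\<zeta> * cnj z) * (cnj \<zeta> * u)"
    by (simp add: mult_ac)
  then show ?thesis
    by (simp add: gap_def algebra_simps)
qed

lemma gap_zero_iff:
  assumes "cmod \<zeta> = 1"
  shows "gap \<zeta> u = 0 \<longleftrightarrow> u = \<zeta>"
proof -
  have "\<zeta> * cnj \<zeta> = 1"
    using assms by (simp add: complex_norm_square [symmetric])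
  then show ?thesis
    unfolding gap_def by (auto simp: mult.commute) (metis mult.assoc mult.commute mult.right_neutral)
qed

lemma norm_gap_le: "cmod \<zeta> = 1 \<Longrightarrow> cmod u \<le> 1 \<Longrightarrow> cmod (gap \<zeta> u) \<le> 2"
  unfolding gap_def using norm_triangle_ineq4[of 1 "cnj \<zeta> * u"] by (simp add: norm_mult)

lemma gap_boundary_point: "cmod \<zeta> = 1 \<Longrightarrow> gap \<zeta> (\<zeta> * of_real r) = of_real (1 - r)"
  by (simp add: gap_def mult.assoc[symmetric] complex_norm_square[symmetric] mult.commute[of "cnj \<zeta>"])

text \<open>The denominator is \<open>gap \<zeta> u\<close> times the image \<open>l w + b\<close>, whose real part is at least \<open>1/2\<close>.
  The factor \<open>cnj (gap \<zeta> u)\<close> in the proof makes that real part visible without dividing.\<close>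

lemma lfw_denominator_nonzero:
  assumes "cmod \<zeta> = 1" "cmod u \<le> 1" "0 < l" "0 \<le> kap l b"
  shows "of_real l + b * gap \<zeta> u \<noteq> 0"
proof (cases "gap \<zeta> u = 0")
  case False
  let ?p = "gap \<zeta> u"
  have "Re (cnj ?p * (of_real l + b * ?p)) = l * Re ?p + Re b * (cmod ?p)\<^sup>2"
    unfolding cmod_power2 by (simp add: power2_eq_square algebra_simps)
  also have "\<dots> = (l * (1 - (cmod u)\<^sup>2) + (kap l b + 1) * (cmod ?p)\<^sup>2) / 2"
    unfolding gap_identity[OF assms(1)] kap_def by (simp add: algebra_simps)
  also have "\<dots> > 0"
  proof -
    have "(cmod u)\<^sup>2 \<le> 1"
      using assms(2) by (simp add: power_le_one)
    moreover have "0 < (kap l b + 1) * (cmod ?p)\<^sup>2"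
      using False assms(4) by (intro mult_pos_pos) auto
    ultimately show ?thesis
      using assms(3) by (simp add: add_nonneg_pos)
  qed
  finally show ?thesis
    by (metis less_irrefl mult_zero_right zero_complex.simps(1))
qed (use assms in simp)

lemma gap_lft:
  assumes "cmod \<zeta> = 1"
  shows "gap \<zeta> (lft \<zeta> l b u) = gap \<zeta> u * lfw \<zeta> l b u"
proof -
  have "cnj \<zeta> * \<zeta> = 1"
    using assms by (simp add: complex_norm_square [symmetric] mult.commute)
  moreover have "gap \<zeta> (lft \<zeta> l b u) = 1 - (cnj \<zeta> * \<zeta>) * (1 - gap \<zeta> u * lfw \<zeta> l b u)"
    by (subst gap_def) (simp only: lft_def mult.assoc)
  ultimately show ?thesis
    by simp
qed

text \<open>In the half-plane this reads \<open>2 Re (l w + b) - 1 = l (2 Re w - 1) + kap l b\<close>.\<close>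

lemma one_minus_norm_lft:
  assumes "cmod \<zeta> = 1" "cmod u \<le> 1" "0 < l" "0 \<le> kap l b"
  shows "1 - (cmod (lft \<zeta> l b u))\<^sup>2
    = (l * (1 - (cmod u)\<^sup>2) + kap l b * (cmod (gap \<zeta> u))\<^sup>2) / (cmod (of_real l + b * gap \<zeta> u))\<^sup>2"
proof -
  let ?p = "gap \<zeta> u"
  let ?d = "of_real l + b * ?p"
  have d: "?d \<noteq> 0"
    by (rule lfw_denominator_nonzero[OF assms])
  have "1 - (cmod (lft \<zeta> l b u))\<^sup>2 = 2 * Re (?p / ?d) - (cmod (?p / ?d))\<^sup>2"
    by (simp add: gap_identity[OF assms(1)] gap_lft[OF assms(1)] lfw_def)
  also have "2 * Re (?p / ?d) = 2 * Re (?p * cnj ?d) / (cmod ?d)\<^sup>2"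
    by (simp only: complex_div_cnj[of ?p] Re_divide_of_real of_real_power[symmetric])
  also have "2 * Re (?p * cnj ?d) = 2 * l * Re ?p + 2 * Re b * (cmod ?p)\<^sup>2"
    unfolding cmod_power2 by (simp add: power2_eq_square algebra_simps)
  also have "2 * l * Re ?p = l * (1 - (cmod u)\<^sup>2) + l * (cmod ?p)\<^sup>2"
    by (simp add: gap_identity[OF assms(1), of u] algebra_simps)
  finally show ?thesis
    by (simp add: norm_divide power_divide kap_def diff_divide_distrib[symmetric] algebra_simps)
qed

lemma lft_in_disk:
  assumes "cmod \<zeta> = 1" "u \<in> \<D>" "0 < l" "0 \<le> kap l b"
  shows "lft \<zeta> l b u \<in> \<D>"
proof -
  have u: "cmod u \<le> 1" "0 < 1 - (cmod u)\<^sup>2"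
    using assms(2) by (auto simp: power_less_one_iff abs_square_less_1)
  have "0 < 1 - (cmod (lft \<zeta> l b u))\<^sup>2"
    unfolding one_minus_norm_lft[OF assms(1) u(1) assms(3,4)]
    using lfw_denominator_nonzero[OF assms(1) u(1) assms(3,4)] assms u
    by (intro divide_pos_pos add_pos_nonneg mult_pos_pos) auto
  then show ?thesis
    by (simp add: abs_square_less_1)
qed

lemma lft_one_zero: "cmod \<zeta> = 1 \<Longrightarrow> lft \<zeta> 1 0 z = z"
  by (simp add: lft_def lfw_def gap_def mult.assoc[symmetric] complex_norm_square[symmetric])

lemma
  assumes "cmod \<zeta> = 1" "0 < l" "0 \<le> kap l b" "z \<in> \<D>"
  shows lfw_compose: "lfw \<zeta> l b z * lfw \<zeta> m c (lft \<zeta> l b z) = lfw \<zeta> (l * m) (of_real m * b + c) z"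
    and lft_compose: "lft \<zeta> m c (lft \<zeta> l b z) = lft \<zeta> (l * m) (of_real m * b + c) z"
proof -
  let ?d = "of_real l + b * gap \<zeta> z"
  have d: "?d \<noteq> 0"
    using assms by (intro lfw_denominator_nonzero) auto
  have "lfw \<zeta> l b z * lfw \<zeta> m c (lft \<zeta> l b z) = 1 / (?d * (of_real m + c * (gap \<zeta> z / ?d)))"
    by (simp add: lfw_def gap_lft[OF assms(1)])
  also have "?d * (of_real m + c * (gap \<zeta> z / ?d)) = ?d * of_real m + c * gap \<zeta> z"
    using d by (simp add: distrib_left)
  finally show w: "lfw \<zeta> l b z * lfw \<zeta> m c (lft \<zeta> l b z) = lfw \<zeta> (l * m) (of_real m * b + c) z"
    by (simp add: lfw_def algebra_simps)
  have "lft \<zeta> m c (lft \<zeta> l b z) = \<zeta> * (1 - gap \<zeta> z * (lfw \<zeta> l b z * lfw \<zeta> m c (lft \<zeta> l b z)))"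
    by (subst lft_def) (simp only: gap_lft[OF assms(1)] mult.assoc)
  also have "\<dots> = lft \<zeta> (l * m) (of_real m * b + c) z"
    by (subst w) (rule lft_def [symmetric])
  finally show "lft \<zeta> m c (lft \<zeta> l b z) = lft \<zeta> (l * m) (of_real m * b + c) z" .
qed

lemma kap_compose: "kap (l * m) (of_real m * b + c) = m * kap l b + kap m c"
  by (simp add: kap_def algebra_simps)

section \<open>Boundedness of the weighted operators\<close>

text \<open>The image of the kernel at \<open>z\<close> under the weighted operator (lemma
  \<open>hardy_fun_kernel_image_weighted\<close>), written as a multiple of the kernel at the image of \<open>z\<close>
  under the adjoint map. In this form it is an element of the space before the operator is
  known to be bounded.\<close>

definition kernel_image :: "complex \<Rightarrow> real \<Rightarrow> complex \<Rightarrow> complex \<Rightarrow> hardy"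
  where "kernel_image \<zeta> l b z =
    (cnj (lfw \<zeta> (1 / l) (1 + (cnj b - 1) / of_real l) z) / of_real l) *\<^sub>C
      hardy_kernel (lft \<zeta> (1 / l) (1 + (cnj b - 1) / of_real l) z)"

lemma kap_adjoint: "0 < l \<Longrightarrow> kap (1 / l) (1 + (cnj b - 1) / of_real l) = kap l b / l"
  by (simp add: kap_def field_simps)

lemma kernel_image_scalar:
  fixes l :: real and b d p q :: complex
  assumes "l > 0" "d \<noteq> 0" and d: "d = 1 / of_real l + (1 + (b - 1) / of_real l) * q"
  shows "of_real l * d * (p + q * (1 / d) - p * (q * (1 / d))) = of_real l * q + p + (b - 1) * p * q"
proof -
  have "of_real l * d * (p + q * (1 / d) - p * (q * (1 / d))) = of_real l * (d * p + q - p * q)"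
    using assms(2) by (simp add: field_simps)
  also have "\<dots> = (of_real l * d) * p + of_real l * q - of_real l * p * q"
    by (simp add: algebra_simps)
  also have "\<dots> = (1 + (of_real l + b - 1) * q) * p + of_real l * q - of_real l * p * q"
  proof -
    have "of_real l * d = 1 + (of_real l + b - 1) * q"
      using assms(1) unfolding d by (simp add: field_simps)
    then show ?thesis
      by (simp only:)
  qed
  finally show ?thesis
    by (simp add: algebra_simps)
qed

lemma cancel_denominator:
  fixes d l p q c :: complex
  assumes "d \<noteq> 0"
  shows "d * (l * q + p / d + c * (p / d) * q) = (l * d) * q + p + c * p * q"
    and "d * (p / d + q - p / d * q) = p + d * q - p * q"
  using assms by (simp_all add: field_simps)

lemma hardy_fun_kernel_image:
  assumes "cmod \<zeta> = 1" "0 < l" "0 \<le> kap l b" "z \<in> \<D>" "u \<in> \<D>"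
  shows "hardy_fun (kernel_image \<zeta> l b z) u
    = 1 / (of_real l * cnj (gap \<zeta> z) + gap \<zeta> u + (b - 1) * gap \<zeta> u * cnj (gap \<zeta> z))"
proof -
  let ?b = "1 + (cnj b - 1) / of_real l"
  let ?v = "lft \<zeta> (1 / l) ?b z"
  let ?d = "cnj (of_real (1 / l) + ?b * gap \<zeta> z)"
  have k: "0 \<le> kap (1 / l) ?b" "0 < 1 / l"
    using assms kap_adjoint[of l b] by auto
  have "of_real (1 / l) + ?b * gap \<zeta> z \<noteq> 0"
    using assms(4) by (intro lfw_denominator_nonzero[OF assms(1) _ k(2,1)]) simp
  then have d: "?d \<noteq> 0"
    by (simp only: complex_cnj_zero_iff not_False_eq_True)
  have v: "?v \<in> \<D>"
    by (rule lft_in_disk[OF assms(1,4) k(2,1)])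
  have "hardy_fun (kernel_image \<zeta> l b z) u = (1 / ?d / of_real l) * (1 / (1 - cnj ?v * u))"
    using v assms(5) by (simp add: kernel_image_def hardy_fun_kernel lfw_def)
  also have "\<dots> = 1 / (of_real l * ?d * (1 - cnj ?v * u))"
    by (simp add: mult_ac)
  also have "1 - cnj ?v * u
    = gap \<zeta> u + cnj (gap \<zeta> z) * (1 / ?d) - gap \<zeta> u * (cnj (gap \<zeta> z) * (1 / ?d))"
    by (simp add: one_minus_cnj_mult[OF assms(1)] gap_lft[OF assms(1)] lfw_def)
  also have "of_real l * ?d * \<dots> = of_real l * cnj (gap \<zeta> z) + gap \<zeta> u + (b - 1) * gap \<zeta> u * cnj (gap \<zeta> z)"
    using d by (intro kernel_image_scalar) (use assms in auto)
  finally show ?thesis .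
qed

lemma hardy_fun_kernel_image_weighted:
  assumes "cmod \<zeta> = 1" "0 < l" "0 \<le> kap l b" "z \<in> \<D>" "u \<in> \<D>"
  shows "hardy_fun (kernel_image \<zeta> l b z) u
    = lfw \<zeta> l b u * hardy_fun (hardy_kernel z) (lft \<zeta> l b u)"
proof -
  let ?d = "of_real l + b * gap \<zeta> u"
  have d: "?d \<noteq> 0"
    using lfw_denominator_nonzero[OF assms(1) _ assms(2,3), of u] assms(5) by simp
  have "hardy_fun (hardy_kernel z) (lft \<zeta> l b u) = 1 / (1 - cnj z * lft \<zeta> l b u)"
    by (intro hardy_fun_kernel lft_in_disk assms)
  also have "1 - cnj z * lft \<zeta> l b u
    = gap \<zeta> u / ?d + cnj (gap \<zeta> z) - gap \<zeta> u / ?d * cnj (gap \<zeta> z)"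
    by (simp add: one_minus_cnj_mult[OF assms(1)] gap_lft[OF assms(1)] lfw_def)
  finally have "lfw \<zeta> l b u * hardy_fun (hardy_kernel z) (lft \<zeta> l b u)
    = 1 / (?d * (gap \<zeta> u / ?d + cnj (gap \<zeta> z) - gap \<zeta> u / ?d * cnj (gap \<zeta> z)))"
    by (simp add: lfw_def)
  also have "?d * (gap \<zeta> u / ?d + cnj (gap \<zeta> z) - gap \<zeta> u / ?d * cnj (gap \<zeta> z))
    = of_real l * cnj (gap \<zeta> z) + gap \<zeta> u + (b - 1) * gap \<zeta> u * cnj (gap \<zeta> z)"
    unfolding cancel_denominator(2)[OF d] by (simp add: algebra_simps)
  finally show ?thesis
    by (simp add: hardy_fun_kernel_image[OF assms])
qed

text \<open>Up to the factor \<open>1 / l\<close>, the Gram matrix depends on \<open>(l, b)\<close> only through \<open>kap l b\<close>, and by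
  lemma \<open>hardy_fun_kernel_image\<close> it equals the matrix of inner products of images of kernels
  under the translation by \<open>kap l b\<close> with the kernels themselves. All norm bounds below come
  from this.\<close>

lemma kernel_image_Gram:
  assumes "cmod \<zeta> = 1" "0 < l" "0 \<le> kap l b" "z \<in> \<D>" "u \<in> \<D>"
  shows "hardy_cinner (kernel_image \<zeta> l b z) (kernel_image \<zeta> l b u) = 1 / of_real l *
    (1 / (cnj (gap \<zeta> z) + gap \<zeta> u + (of_real (kap l b) - 1) * gap \<zeta> u * cnj (gap \<zeta> z)))"
proof -
  let ?b = "1 + (cnj b - 1) / of_real l"
  let ?v = "lft \<zeta> (1 / l) ?b u"
  let ?d = "of_real (1 / l) + ?b * gap \<zeta> u"
  have k: "0 \<le> kap (1 / l) ?b" "0 < 1 / l"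
    using assms kap_adjoint[of l b] by auto
  have d: "?d \<noteq> 0"
    using lfw_denominator_nonzero[OF assms(1) _ k(2,1), of u] assms(5) by simp
  have v: "?v \<in> \<D>"
    by (rule lft_in_disk[OF assms(1,5) k(2,1)])
  have "hardy_cinner (kernel_image \<zeta> l b z) (kernel_image \<zeta> l b u)
    = (1 / ?d / of_real l) * hardy_fun (kernel_image \<zeta> l b z) ?v"
    unfolding kernel_image_def[of \<zeta> l b u] using v by (simp add: hardy_cinner_kernel lfw_def)
  also have "hardy_fun (kernel_image \<zeta> l b z) ?v = 1 / (of_real l * cnj (gap \<zeta> z)
      + gap \<zeta> u / ?d + (b - 1) * (gap \<zeta> u / ?d) * cnj (gap \<zeta> z))"
    unfolding hardy_fun_kernel_image[OF assms(1-4) v] gap_lft[OF assms(1)] by (simp add: lfw_def)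
  also have "(1 / ?d / of_real l) * \<dots> = 1 / of_real l * (1 / (?d * (of_real l * cnj (gap \<zeta> z)
      + gap \<zeta> u / ?d + (b - 1) * (gap \<zeta> u / ?d) * cnj (gap \<zeta> z))))"
    by (simp add: mult_ac)
  also have "?d * (of_real l * cnj (gap \<zeta> z) + gap \<zeta> u / ?d + (b - 1) * (gap \<zeta> u / ?d) * cnj (gap \<zeta> z))
    = (of_real l * ?d) * cnj (gap \<zeta> z) + gap \<zeta> u + (b - 1) * gap \<zeta> u * cnj (gap \<zeta> z)"
    by (rule cancel_denominator(1)[OF d])
  also have "of_real l * ?d = 1 + (of_real l + cnj b - 1) * gap \<zeta> u"
    using assms(2) by (simp add: field_simps)
  also have "(1 + (of_real l + cnj b - 1) * gap \<zeta> u) * cnj (gap \<zeta> z) + gap \<zeta> u + (b - 1) * gap \<zeta> u * cnj (gap \<zeta> z)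
    = cnj (gap \<zeta> z) + gap \<zeta> u + (of_real l + (b + cnj b) - 2) * gap \<zeta> u * cnj (gap \<zeta> z)"
    by (simp add: algebra_simps)
  also have "of_real l + (b + cnj b) - 2 = complex_of_real (kap l b) - 1"
    by (simp add: kap_def complex_add_cnj)
  finally show ?thesis .
qed

lemma norm_kernel_image_sq:
  assumes "cmod \<zeta> = 1" "0 < l" "0 \<le> kap l b" "z \<in> \<D>"
  shows "(norm (kernel_image \<zeta> l b z))\<^sup>2
    = 1 / (l * (1 - (cmod z)\<^sup>2 + kap l b * (cmod (gap \<zeta> z))\<^sup>2))"
proof -
  let ?p = "gap \<zeta> z"
  have "complex_of_real ((norm (kernel_image \<zeta> l b z))\<^sup>2)
    = 1 / of_real l * (1 / (cnj ?p + ?p + (of_real (kap l b) - 1) * ?p * cnj ?p))"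
    unfolding hardy_cinner_self[symmetric] by (rule kernel_image_Gram[OF assms(1-4,4)])
  also have "cnj ?p + ?p + (of_real (kap l b) - 1) * ?p * cnj ?p
    = of_real (2 * Re ?p + (kap l b - 1) * (cmod ?p)\<^sup>2)"
    using complex_add_cnj[of ?p] complex_norm_square[of ?p] by (simp add: algebra_simps)
  also have "1 / of_real l * (1 / complex_of_real (2 * Re ?p + (kap l b - 1) * (cmod ?p)\<^sup>2))
    = of_real (1 / (l * (2 * Re ?p + (kap l b - 1) * (cmod ?p)\<^sup>2)))"
    by simp
  finally have "(norm (kernel_image \<zeta> l b z))\<^sup>2
    = 1 / (l * (2 * Re ?p + (kap l b - 1) * (cmod ?p)\<^sup>2))"
    by (simp only: of_real_eq_iff)
  then show ?thesis
    by (simp add: gap_identity[OF assms(1)] algebra_simps)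
qed

lemma norm_kernel_image_translation:
  assumes "cmod \<zeta> = 1" "0 \<le> b" "z \<in> \<D>"
  shows "norm (kernel_image \<zeta> 1 (of_real b) z) \<le> norm (hardy_kernel z)"
proof -
  have pos: "0 < 1 - (cmod z)\<^sup>2"
    using assms(3) by (simp add: abs_square_less_1)
  have "kap 1 (complex_of_real b) = 2 * b"
    by (simp add: kap_def)
  then have "(norm (kernel_image \<zeta> 1 (of_real b) z))\<^sup>2
    = 1 / (1 - (cmod z)\<^sup>2 + 2 * b * (cmod (gap \<zeta> z))\<^sup>2)"
    using norm_kernel_image_sq[OF assms(1), of 1 "of_real b" z] assms by simp
  also have "\<dots> \<le> 1 / (1 - (cmod z)\<^sup>2)"
    using pos assms(2) by (intro divide_left_mono mult_pos_pos add_pos_nonneg) auto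
  also have "\<dots> = (norm (hardy_kernel z))\<^sup>2"
    using norm_hardy_kernel_sq[OF assms(3)] by simp
  finally show ?thesis
    by (simp add: power2_le_iff_abs_le)
qed

text \<open>Finite linear combinations are given by lists of coefficients and points, so that their sums
  and multiples are list operations.\<close>

definition comb :: "(complex \<Rightarrow> hardy) \<Rightarrow> (complex \<times> complex) list \<Rightarrow> hardy"
  where "comb K xs = (\<Sum>x\<leftarrow>xs. fst x *\<^sub>C K (snd x))"

lemma comb_simps [simp]:
  "comb K [] = 0" "comb K (x # xs) = fst x *\<^sub>C K (snd x) + comb K xs"
  "comb K (xs @ ys) = comb K xs + comb K ys"
  by (simp_all add: comb_def)

lemma comb_scale: "comb K (map (\<lambda>x. (c * fst x, snd x)) xs) = c *\<^sub>C comb K xs"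
  by (induction xs) (simp_all add: hardy_scaleC.add_right hardy_scaleC.zero_right)

lemma comb_cinner_cong:
  assumes "\<And>z u. z \<in> \<D> \<Longrightarrow> u \<in> \<D> \<Longrightarrow> hardy_cinner (A z) (B u) = c * hardy_cinner (A' z) (B' u)"
    and "snd ` set xs \<subseteq> \<D>" "snd ` set ys \<subseteq> \<D>"
  shows "hardy_cinner (comb A xs) (comb B ys) = c * hardy_cinner (comb A' xs) (comb B' ys)"
  using assms(2)
proof (induction xs)
  case (Cons x xs)
  have "hardy_cinner (A (snd x)) (comb B ys) = c * hardy_cinner (A' (snd x)) (comb B' ys)"
    using assms(3)
  proof (induction ys)
    case (Cons y ys)
    then show ?case
      using assms(1)[of "snd x" "snd y"] \<open>snd ` set (x # xs) \<subseteq> \<D>\<close>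
      by (simp add: hardy_cinner_add_right algebra_simps)
  qed (simp add: hardy_cinner.zero_right)
  with Cons show ?case
    by (simp add: hardy_cinner_add_left algebra_simps)
qed (simp add: hardy_cinner.zero_left)

text \<open>Otherwise \<open>y k \<ge> (y 0)^(2^k)\<close> would be unbounded.\<close>

lemma le_1_if_squares_bounded:
  fixes y :: "nat \<Rightarrow> real"
  assumes "\<And>k. 0 \<le> y k" "\<And>k. (y k)\<^sup>2 \<le> y (Suc k)" "\<And>k. y k \<le> C"
  shows "y 0 \<le> 1"
proof (rule ccontr)
  assume "\<not> y 0 \<le> 1"
  then have gt: "1 < y 0" by simp
  have pow: "y 0 ^ (2 ^ k) \<le> y k" for k
  proof (induction k)
    case (Suc k)
    have "y 0 ^ (2 ^ Suc k) = (y 0 ^ (2 ^ k))\<^sup>2"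
      by (simp add: power_mult[symmetric] mult.commute)
    also have "\<dots> \<le> (y k)\<^sup>2"
      using Suc assms(1) by (intro power_mono) auto
    also have "\<dots> \<le> y (Suc k)"
      by (rule assms(2))
    finally show ?case .
  qed simp
  obtain n where "C < y 0 ^ n"
    using real_arch_pow[OF gt] by blast
  also have "y 0 ^ n \<le> y 0 ^ (2 ^ n)"
    using gt less_exp[of n] by (intro power_increasing) auto
  also have "\<dots> \<le> y n"
    by (rule pow)
  also have "\<dots> \<le> C"
    by (rule assms(3))
  finally show False by simp
qed

text \<open>Translations by \<open>b \<ge> 0\<close> are contractions on combinations of kernels. If \<open>G b\<close> is the
  translate of the combination \<open>g\<close>, then the Gram formula gives
  \<open>\<parallel>G b\<parallel>\<^sup>2 = \<langle>G (2 b), g\<rangle> \<le> \<parallel>G (2 b)\<parallel> \<parallel>g\<parallel>\<close>. Each kernel's translates are bounded uniformly in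
  \<open>b\<close>, hence so is \<open>G\<close>, and repeated doubling forces \<open>\<parallel>G b\<parallel> \<le> \<parallel>g\<parallel>\<close>.\<close>

lemma norm_comb_translation:
  assumes "cmod \<zeta> = 1" "0 \<le> b" "snd ` set xs \<subseteq> \<D>"
  shows "norm (comb (kernel_image \<zeta> 1 (of_real b)) xs) \<le> norm (comb hardy_kernel xs)"
proof (cases "comb hardy_kernel xs = 0")
  let ?G = "\<lambda>b. comb (kernel_image \<zeta> 1 (of_real b)) xs"
  let ?g = "comb hardy_kernel xs"
  have k: "kap 1 (of_real b) = 2 * b" for b
    by (simp add: kap_def)
  have sq: "(norm (?G b))\<^sup>2 \<le> norm (?G (2 * b)) * norm ?g" if "0 \<le> b" for b
  proof -
    have "hardy_cinner (?G b) (?G b) = 1 * hardy_cinner (?G (2 * b)) ?g"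
    proof (rule comb_cinner_cong)
      fix z u assume zu: "z \<in> \<D>" "u \<in> \<D>"
      show "hardy_cinner (kernel_image \<zeta> 1 (of_real b) z) (kernel_image \<zeta> 1 (of_real b) u)
        = 1 * hardy_cinner (kernel_image \<zeta> 1 (of_real (2 * b)) z) (hardy_kernel u)"
        using kernel_image_Gram[OF assms(1), of 1 "of_real b" z u] that zu
          hardy_fun_kernel_image[OF assms(1), of 1 "of_real (2 * b)" z u]
        by (simp add: k hardy_cinner_kernel kap_def)
    qed (use assms in auto)
    then have "of_real ((norm (?G b))\<^sup>2) = hardy_cinner (?G (2 * b)) ?g"
      by (simp only: hardy_cinner_self mult_1)
    then have "(norm (?G b))\<^sup>2 = cmod (hardy_cinner (?G (2 * b)) ?g)"
      by (metis abs_of_nonneg norm_of_real zero_le_power2)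
    then show ?thesis
      using hardy_cinner_Cauchy_Schwarz by simp
  qed
  show ?thesis if "?g = 0"
    using sq[OF assms(2)] that by simp
  assume g: "?g \<noteq> 0"
  have bound: "norm (?G b) \<le> (\<Sum>x\<leftarrow>xs. cmod (fst x) * norm (hardy_kernel (snd x)))" if "0 \<le> b" for b
    using assms(3)
  proof (induction xs)
    case (Cons x xs)
    have "norm (fst x *\<^sub>C kernel_image \<zeta> 1 (of_real b) (snd x)) \<le> cmod (fst x) * norm (hardy_kernel (snd x))"
      using norm_kernel_image_translation[OF assms(1) that, of "snd x"] Cons.prems
      by (auto intro: mult_left_mono)
    with Cons show ?case
      by (auto intro: norm_triangle_le)
  qed simp
  define y where "y k = norm (?G (2 ^ k * b)) / norm ?g" for k
  have "y 0 \<le> 1"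
  proof (rule le_1_if_squares_bounded)
    show "0 \<le> y k" for k
      by (simp add: y_def)
    show "(y k)\<^sup>2 \<le> y (Suc k)" for k
    proof -
      have "(norm (?G (2 ^ k * b)))\<^sup>2 \<le> norm (?G (2 ^ Suc k * b)) * norm ?g"
        using sq[of "2 ^ k * b"] assms(2) by (simp add: mult_ac)
      then show ?thesis
        using g by (simp add: y_def power_divide power2_eq_square field_simps)
    qed
    show "y k \<le> (\<Sum>x\<leftarrow>xs. cmod (fst x) * norm (hardy_kernel (snd x))) / norm ?g" for k
      unfolding y_def using bound[of "2 ^ k * b"] assms(2) by (intro divide_right_mono) auto
  qed
  then show ?thesis
    using g by (simp add: y_def)
qed

text \<open>The Gram formula expresses \<open>\<parallel>G\<parallel>\<^sup>2\<close> as \<open>1 / l\<close> times an inner product of \<open>g\<close> with its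
  translate by \<open>kap l b\<close>, and translations are contractions.\<close>

lemma norm_comb_kernel_image:
  assumes "cmod \<zeta> = 1" "0 < l" "0 \<le> kap l b" "snd ` set xs \<subseteq> \<D>"
  shows "norm (comb (kernel_image \<zeta> l b) xs) \<le> 1 / sqrt l * norm (comb hardy_kernel xs)"
proof -
  let ?G = "comb (kernel_image \<zeta> l b) xs" and ?g = "comb hardy_kernel xs"
  let ?E = "comb (kernel_image \<zeta> 1 (of_real (kap l b))) xs"
  have "hardy_cinner ?G ?G = 1 / of_real l * hardy_cinner ?E ?g"
  proof (rule comb_cinner_cong)
    fix z u assume zu: "z \<in> \<D>" "u \<in> \<D>"
    show "hardy_cinner (kernel_image \<zeta> l b z) (kernel_image \<zeta> l b u)
      = 1 / of_real l * hardy_cinner (kernel_image \<zeta> 1 (of_real (kap l b)) z) (hardy_kernel u)"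
      using kernel_image_Gram[OF assms(1-3) zu] zu assms(3)
        hardy_fun_kernel_image[OF assms(1), of 1 "of_real (kap l b)" z u]
      by (simp add: hardy_cinner_kernel kap_def[of 1])
  qed (use assms in auto)
  then have "of_real ((norm ?G)\<^sup>2) = 1 / of_real l * hardy_cinner ?E ?g"
    by (simp only: hardy_cinner_self)
  then have "cmod (of_real ((norm ?G)\<^sup>2)) = cmod (1 / of_real l * hardy_cinner ?E ?g)"
    by simp
  then have "(norm ?G)\<^sup>2 = 1 / l * cmod (hardy_cinner ?E ?g)"
    using assms(2) by (simp add: norm_mult norm_divide norm_power)
  also have "\<dots> \<le> 1 / l * (norm ?g * norm ?g)"
  proof (intro mult_left_mono)
    have "cmod (hardy_cinner ?E ?g) \<le> norm ?E * norm ?g"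
      by (rule hardy_cinner_Cauchy_Schwarz)
    also have "\<dots> \<le> norm ?g * norm ?g"
      by (intro mult_right_mono norm_comb_translation assms) auto
    finally show "cmod (hardy_cinner ?E ?g) \<le> norm ?g * norm ?g" .
  qed (use assms in auto)
  also have "\<dots> = (1 / sqrt l * norm ?g)\<^sup>2"
    using assms(2) by (simp add: power_mult_distrib power_divide power2_eq_square)
  finally show ?thesis
    using assms(2) by (simp add: power2_le_iff_abs_le)
qed

lemma hardy_combs_dense: "\<exists>xs. (\<forall>n. snd ` set (xs n) \<subseteq> \<D>) \<and> (\<lambda>n. comb hardy_kernel (xs n)) \<longlonglongrightarrow> f"
proof -
  define V where "V = comb hardy_kernel ` {xs. snd ` set xs \<subseteq> \<D>}"
  have V: "comb hardy_kernel xs \<in> V" if "snd ` set xs \<subseteq> \<D>" for xs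
    using that by (auto simp: V_def)
  have lim: "\<exists>X. (\<forall>n. X n \<in> V) \<and> X \<longlonglongrightarrow> f" if "f \<in> closure V" for f
    using that by (simp only: closure_sequential)
  have limI: "f \<in> closure V" if "\<And>n. X n \<in> V" "X \<longlonglongrightarrow> f" for f X
    using that unfolding closure_sequential by (intro exI[of _ X]) simp
  have "f \<in> closure V"
  proof (rule hardy_kernels_dense[where \<zeta> = 1])
    show "0 \<in> closure V"
      using V[of "[]"] closure_subset[of V] by auto
    show "hardy_kernel (1 * of_real r) \<in> closure V" if "0 < r" "r < 1" for r
      using V[of "[(1, of_real r)]"] that closure_subset[of V] by auto
    fix f assume "f \<in> closure V"
    then obtain X where X: "\<And>n. X n \<in> V" "X \<longlonglongrightarrow> f"
      using lim by metis
    show "c *\<^sub>C f \<in> closure V" for c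
    proof (rule limI)
      show "(\<lambda>n. c *\<^sub>C X n) \<longlonglongrightarrow> c *\<^sub>C f"
        by (intro hardy_scaleC.tendsto tendsto_const X)
      fix n
      obtain xs where "X n = comb hardy_kernel xs" "snd ` set xs \<subseteq> \<D>"
        using X(1)[of n] unfolding V_def by blast
      then show "c *\<^sub>C X n \<in> V"
        using V[of "map (\<lambda>x. (c * fst x, snd x)) xs"] by (simp add: comb_scale image_image)
    qed
    fix g assume "g \<in> closure V"
    then obtain Y where Y: "\<And>n. Y n \<in> V" "Y \<longlonglongrightarrow> g"
      using lim by metis
    show "f + g \<in> closure V"
    proof (rule limI)
      show "(\<lambda>n. X n + Y n) \<longlonglongrightarrow> f + g"
        by (intro tendsto_add X Y)
      fix n
      obtain xs ys where "X n = comb hardy_kernel xs" "snd ` set xs \<subseteq> \<D>"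
        "Y n = comb hardy_kernel ys" "snd ` set ys \<subseteq> \<D>"
        using X(1)[of n] Y(1)[of n] unfolding V_def by blast
      then show "X n + Y n \<in> V"
        using V[of "xs @ ys"] by auto
    qed
  qed auto
  then obtain X where X: "\<And>n. X n \<in> V" "X \<longlonglongrightarrow> f"
    using lim by metis
  then have "\<forall>n. \<exists>xs. X n = comb hardy_kernel xs \<and> snd ` set xs \<subseteq> \<D>"
    unfolding V_def by blast
  then obtain xs where xs: "\<And>n. X n = comb hardy_kernel (xs n)" "\<And>n. snd ` set (xs n) \<subseteq> \<D>"
    by metis
  have "X = (\<lambda>n. comb hardy_kernel (xs n))"
    using xs by auto
  with X xs show ?thesis by auto
qed

text \<open>Extension by continuity: a combination of kernels approximating \<open>f\<close> has images that form a
  Cauchy sequence, and point evaluations identify the limit.\<close>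

lemma lfw_wcomp_bounded:
  assumes "cmod \<zeta> = 1" "0 < l" "0 \<le> kap l b"
  shows "wcomp_bounded (1 / sqrt l) (lfw \<zeta> l b) (lft \<zeta> l b)"
  unfolding wcomp_bounded_def
proof
  fix f
  obtain xs where xs: "\<And>n. snd ` set (xs n) \<subseteq> \<D>" and lim: "(\<lambda>n. comb hardy_kernel (xs n)) \<longlonglongrightarrow> f"
    using hardy_combs_dense by blast
  let ?G = "\<lambda>n. comb (kernel_image \<zeta> l b) (xs n)" and ?g = "\<lambda>n. comb hardy_kernel (xs n)"
  have diff: "norm (?G n - ?G m) \<le> 1 / sqrt l * norm (?g n - ?g m)" for n m
  proof -
    have "comb K (xs n @ map (\<lambda>x. ((- 1) * fst x, snd x)) (xs m)) = comb K (xs n) - comb K (xs m)" for K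
      by (simp only: comb_simps comb_scale hardy_uminus_eq[symmetric] add_uminus_conv_diff)
    moreover have "snd ` set (xs n @ map (\<lambda>x. ((- 1) * fst x, snd x)) (xs m)) \<subseteq> \<D>"
      using xs[of n] xs[of m] by auto
    ultimately show ?thesis
      using norm_comb_kernel_image[OF assms] by metis
  qed
  have "Cauchy ?G"
  proof (rule CauchyI)
    fix e :: real assume "0 < e"
    then have "0 < e * sqrt l"
      using assms(2) by simp
    from CauchyD[OF LIMSEQ_imp_Cauchy[OF lim] this]
    obtain M where M: "\<And>m n. m \<ge> M \<Longrightarrow> n \<ge> M \<Longrightarrow> norm (?g m - ?g n) < e * sqrt l"
      by blast
    have "norm (?G m - ?G n) < e" if "m \<ge> M" "n \<ge> M" for m n
    proof -
      have "norm (?G m - ?G n) \<le> 1 / sqrt l * norm (?g m - ?g n)"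
        by (rule diff)
      also have "\<dots> < 1 / sqrt l * (e * sqrt l)"
        using assms(2) by (intro mult_strict_left_mono M that) auto
      finally show ?thesis
        using assms(2) by simp
    qed
    then show "\<exists>M. \<forall>m\<ge>M. \<forall>n\<ge>M. norm (?G m - ?G n) < e"
      by blast
  qed
  then obtain G where G: "?G \<longlonglongrightarrow> G"
    using Cauchy_convergent convergent_def by blast
  have comb_val: "hardy_fun (comb (kernel_image \<zeta> l b) ys) z
      = lfw \<zeta> l b z * hardy_fun (comb hardy_kernel ys) (lft \<zeta> l b z)"
    if "z \<in> \<D>" "snd ` set ys \<subseteq> \<D>" for z ys
    using that(2) by (induction ys) (auto simp: hardy_fun_kernel_image_weighted[OF assms _ that(1)] algebra_simps)
  show "\<exists>g. (\<forall>z\<in>\<D>. hardy_fun g z = lfw \<zeta> l b z * hardy_fun f (lft \<zeta> l b z)) \<and>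
      norm g \<le> 1 / sqrt l * norm f"
  proof (intro exI[of _ G] conjI ballI)
    fix z assume z: "z \<in> \<D>"
    have "(\<lambda>n. lfw \<zeta> l b z * hardy_fun (?g n) (lft \<zeta> l b z)) \<longlonglongrightarrow> lfw \<zeta> l b z * hardy_fun f (lft \<zeta> l b z)"
      by (intro tendsto_mult tendsto_const tendsto_hardy_fun lim lft_in_disk z assms)
    moreover have "(\<lambda>n. lfw \<zeta> l b z * hardy_fun (?g n) (lft \<zeta> l b z)) \<longlonglongrightarrow> hardy_fun G z"
      using tendsto_hardy_fun[OF G z] comb_val[OF z xs] by simp
    ultimately show "hardy_fun G z = lfw \<zeta> l b z * hardy_fun f (lft \<zeta> l b z)"
      using LIMSEQ_unique by blast
  next
    show "norm G \<le> 1 / sqrt l * norm f"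
    proof (rule LIMSEQ_le)
      show "(\<lambda>n. norm (?G n)) \<longlonglongrightarrow> norm G"
        by (intro tendsto_norm G)
      show "(\<lambda>n. 1 / sqrt l * norm (?g n)) \<longlonglongrightarrow> 1 / sqrt l * norm f"
        by (intro tendsto_mult tendsto_const tendsto_norm lim)
    qed (use norm_comb_kernel_image[OF assms xs] in blast)
  qed
qed

section \<open>Products and adjoints\<close>

definition Wop :: "complex \<Rightarrow> real \<Rightarrow> complex \<Rightarrow> (hardy \<Rightarrow>\<^sub>L hardy)"
  where "Wop \<zeta> l b = wcomp (lfw \<zeta> l b) (lft \<zeta> l b)"

lemma
  assumes "cmod \<zeta> = 1" "0 < l" "0 \<le> kap l b"
  shows hardy_fun_Wop: "z \<in> \<D> \<Longrightarrow> hardy_fun (Wop \<zeta> l b f) z = lfw \<zeta> l b z * hardy_fun f (lft \<zeta> l b z)"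
    and norm_Wop_apply: "norm (Wop \<zeta> l b f) \<le> 1 / sqrt l * norm f"
    and clinear_Wop: "clinear_op (Wop \<zeta> l b)"
  unfolding Wop_def
  using hardy_fun_wcomp[OF lfw_wcomp_bounded[OF assms]] norm_wcomp_apply[OF lfw_wcomp_bounded[OF assms]]
    clinear_wcomp[OF lfw_wcomp_bounded[OF assms]] by blast+

text \<open>In the half-plane, the weight is \<open>w\<close> divided by its image, so the weights form a cocycle and
  products of operators correspond to composition of affine maps.\<close>

lemma Wop_compose:
  assumes "cmod \<zeta> = 1" "0 < l" "0 \<le> kap l b" "0 < m" "0 \<le> kap m c"
  shows "Wop \<zeta> l b o\<^sub>L Wop \<zeta> m c = Wop \<zeta> (l * m) (of_real m * b + c)"
proof (rule blinfun_hardy_eqI)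
  fix f z assume z: "z \<in> \<D>"
  have k: "0 < l * m" "0 \<le> kap (l * m) (of_real m * b + c)"
    using assms by (simp_all add: kap_compose)
  note compose = lfw_compose[OF assms(1-3) z] lft_compose[OF assms(1-3) z]
  show "hardy_fun ((Wop \<zeta> l b o\<^sub>L Wop \<zeta> m c) f) z
      = hardy_fun (Wop \<zeta> (l * m) (of_real m * b + c) f) z"
    using z lft_in_disk[OF assms(1) z assms(2,3)] assms k
    by (simp add: hardy_fun_Wop compose mult.assoc[symmetric])
qed

lemma Wop_kernel:
  assumes "cmod \<zeta> = 1" "0 < l" "0 \<le> kap l b" "z \<in> \<D>"
  shows "Wop \<zeta> l b (hardy_kernel z) = kernel_image \<zeta> l b z"
  by (rule hardy_eqI) (simp only: hardy_fun_Wop[OF assms(1-3)] hardy_fun_kernel_image_weighted[OF assms])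

text \<open>By density it suffices to let \<open>g\<close> be a kernel. Its image under the operator on the right is
  a multiple of the kernel at \<open>lft \<zeta> l b\<close>, because passing to the adjoint parameters twice
  gives back \<open>l\<close> and \<open>b\<close>.\<close>

lemma Wop_adjoint:
  assumes "cmod \<zeta> = 1" "0 < l" "0 \<le> kap l b"
  shows "hardy_cinner (Wop \<zeta> l b f) g
    = hardy_cinner f ((1 / of_real l) *\<^sub>C Wop \<zeta> (1 / l) (1 + (cnj b - 1) / of_real l) g)"
proof -
  let ?b = "1 + (cnj b - 1) / of_real l"
  let ?T = "\<lambda>g. (1 / of_real l) *\<^sub>C Wop \<zeta> (1 / l) ?b g"
  have k: "0 < 1 / l" "0 \<le> kap (1 / l) ?b"
    using assms kap_adjoint[of l b] by auto
  have b: "1 + (cnj ?b - 1) / of_real (1 / l) = b"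
    using assms(2) by simp
  have "g \<in> {g. hardy_cinner (Wop \<zeta> l b f) g = hardy_cinner f (?T g)}"
  proof (rule hardy_kernels_dense[where \<zeta> = 1])
    have "continuous_on UNIV ?T"
      by (intro linear_continuous_on bounded_linear_compose[OF hardy_scaleC.bounded_linear_right]
          blinfun.bounded_linear_right)
    then show "closed {g. hardy_cinner (Wop \<zeta> l b f) g = hardy_cinner f (?T g)}"
      by (intro closed_Collect_eq hardy_cinner.continuous_on continuous_on_const continuous_on_id)
    show "hardy_kernel (1 * of_real r) \<in> {g. hardy_cinner (Wop \<zeta> l b f) g = hardy_cinner f (?T g)}"
      if "0 < r" "r < 1" for r
    proof -
      have r: "complex_of_real r \<in> \<D>"
        using that by simp
      have "hardy_cinner f (kernel_image \<zeta> (1 / l) ?b (of_real r))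
          = of_real l * (lfw \<zeta> l b (of_real r) * hardy_fun f (lft \<zeta> l b (of_real r)))"
        unfolding kernel_image_def b using lft_in_disk[OF assms(1) r assms(2,3)] assms(2)
        by (simp add: hardy_cinner_kernel)
      then show ?thesis
        using r assms(2)
        by (simp add: hardy_cinner_kernel hardy_fun_Wop[OF assms] Wop_kernel[OF assms(1) k])
    qed
    show "0 \<in> {g. hardy_cinner (Wop \<zeta> l b f) g = hardy_cinner f (?T g)}"
      by (simp add: hardy_cinner.zero_right blinfun.zero_right hardy_scaleC.zero_right)
  qed (auto simp: hardy_cinner_add_right blinfun.add_right hardy_scaleC.add_right
      add_divide_distrib clinear_hardyD[OF clinear_Wop[OF assms(1) k]])
  then show ?thesis by simp
qed

section \<open>Composition operators modulo the compact operators\<close>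

text \<open>Multiplication by \<open>gap \<zeta>\<close>, expressed by the shift to inherit its boundedness.\<close>

definition gap_op :: "complex \<Rightarrow> (hardy \<Rightarrow>\<^sub>L hardy)"
  where "gap_op \<zeta> = id_blinfun - (scaleC_op (cnj \<zeta>) o\<^sub>L hardy_shift)"

lemma hardy_fun_gap_op [simp]: "z \<in> \<D> \<Longrightarrow> hardy_fun (gap_op \<zeta> f) z = gap \<zeta> z * hardy_fun f z"
  by (simp add: gap_op_def gap_def blinfun.bilinear_simps algebra_simps)

lemma clinear_gap_op: "clinear_op (gap_op \<zeta>)"
  unfolding gap_op_def by (intro clinear_op_intros clinear_wcomp[OF shift_bounded])

lemma norm_gap_op_apply: "cmod \<zeta> = 1 \<Longrightarrow> norm (gap_op \<zeta> f) \<le> 2 * norm f"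
  using norm_triangle_ineq4[of f "cnj \<zeta> *\<^sub>C hardy_shift f"]
  by (simp add: gap_op_def blinfun.bilinear_simps)

lemma norm_diff_hardy_sq: "(norm (f - g))\<^sup>2 = (norm f)\<^sup>2 - 2 * Re (hardy_cinner f g) + (norm g)\<^sup>2"
  for f g :: hardy
  by (simp add: Re_hardy_cinner power2_norm_eq_inner inner_diff_left inner_diff_right inner_commute)

text \<open>With \<open>S\<close> the isometric shift, \<open>P = 1 - cnj \<zeta> S\<close> satisfies \<open>P\<^sup>* P = P + P\<^sup>*\<close>.\<close>

lemma norm_gap_op_sq:
  assumes "cmod \<zeta> = 1"
  shows "(norm (gap_op \<zeta> f))\<^sup>2 = 2 * Re (hardy_cinner (gap_op \<zeta> f) f)"
proof -
  let ?g = "cnj \<zeta> *\<^sub>C hardy_shift f"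
  have g: "gap_op \<zeta> f = f - ?g" "norm ?g = norm f"
    using assms by (simp_all add: gap_op_def blinfun.bilinear_simps)
  have "Re (hardy_cinner (f - ?g) f) = (norm f)\<^sup>2 - Re (hardy_cinner f ?g)"
    by (simp only: Re_hardy_cinner inner_diff_left power2_norm_eq_inner inner_commute[of ?g f])
  then show ?thesis
    unfolding g(1) norm_diff_hardy_sq by (simp add: assms)
qed

text \<open>The energy \<open>e\<close> pays \<open>k (a n)\<^sup>2\<close> at every step; as these amounts decrease, the last one is at
  most the mean of those paid.\<close>

lemma decreasing_energy_bound:
  fixes a e :: "nat \<Rightarrow> real"
  assumes "\<And>n. 0 \<le> a n" "\<And>n. a (Suc n) \<le> a n" "\<And>n. 0 \<le> e n"
    and "\<And>n. e (Suc n) \<le> e n - k * (a n)\<^sup>2" and "0 \<le> k"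
  shows "k * real (Suc n) * (a n)\<^sup>2 \<le> e 0"
proof -
  have "e (Suc n) + k * real (Suc n) * (a n)\<^sup>2 \<le> e 0"
  proof (induction n)
    case 0
    then show ?case using assms(4)[of 0] by simp
  next
    case (Suc n)
    have "(a (Suc n))\<^sup>2 \<le> (a n)\<^sup>2"
      using assms(1,2) by (intro power_mono) auto
    then have "k * real (Suc n) * (a (Suc n))\<^sup>2 \<le> k * real (Suc n) * (a n)\<^sup>2"
      using assms(5) by (intro mult_left_mono) auto
    then show ?case
      using Suc assms(4)[of "Suc n"] by (simp add: algebra_simps)
  qed
  then show ?thesis
    using assms(3)[of "Suc n"] by linarith
qed

lemma Wop_gap_op:
  assumes "cmod \<zeta> = 1" "0 < l" "0 \<le> kap l b"
  shows "gap_op \<zeta> (Wop \<zeta> l b f)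
    = of_real l *\<^sub>C Wop \<zeta> l b (gap_op \<zeta> f) + b *\<^sub>C gap_op \<zeta> (Wop \<zeta> l b (gap_op \<zeta> f))"
proof (rule hardy_eqI)
  fix z assume z: "z \<in> \<D>"
  have "of_real l + b * gap \<zeta> z \<noteq> 0"
    using z by (intro lfw_denominator_nonzero assms) auto
  then have "(of_real l + b * gap \<zeta> z) * lfw \<zeta> l b z = 1"
    by (simp add: lfw_def)
  moreover have "of_real l * (w * (p * w * F)) + b * (p * (w * (p * w * F)))
      = ((of_real l + b * p) * w) * (p * (w * F))" for p w F
    by (simp add: algebra_simps)
  ultimately show "hardy_fun (gap_op \<zeta> (Wop \<zeta> l b f)) z = hardy_fun
    (of_real l *\<^sub>C Wop \<zeta> l b (gap_op \<zeta> f) + b *\<^sub>C gap_op \<zeta> (Wop \<zeta> l b (gap_op \<zeta> f))) z"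
    using lft_in_disk[OF assms(1) z assms(2,3)] z
    by (simp add: hardy_fun_Wop[OF assms] gap_lft[OF assms(1)])
qed

text \<open>Put \<open>x = W P f\<close> and \<open>y = W f\<close>. Lemma \<open>Wop_gap_op\<close> gives \<open>P (y - b x) = l x\<close>, so the identity
  \<open>P\<^sup>* P = P + P\<^sup>*\<close> yields \<open>2 Re \<langle>x, y\<rangle> = (kap l b + 1) \<parallel>x\<parallel>\<^sup>2\<close>. Since \<open>S = \<zeta> (1 - P)\<close>, the
  left-hand side is \<open>\<parallel>y - x\<parallel>\<^sup>2\<close>.\<close>

lemma norm_Wop_shift:
  assumes "cmod \<zeta> = 1" "0 < l" "0 \<le> kap l b"
  shows "(norm (Wop \<zeta> l b (hardy_shift f)))\<^sup>2
    = (norm (Wop \<zeta> l b f))\<^sup>2 - kap l b * (norm (Wop \<zeta> l b (gap_op \<zeta> f)))\<^sup>2"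
proof -
  define x where "x = Wop \<zeta> l b (gap_op \<zeta> f)"
  define y where "y = Wop \<zeta> l b f"
  have "\<zeta> * cnj \<zeta> = 1"
    using assms(1) by (simp add: complex_norm_square [symmetric])
  then have z: "\<zeta> * (1 - gap \<zeta> z) = z" for z
    by (simp add: gap_def mult.assoc[symmetric])
  have shift_factor: "\<zeta> * (w * F - w * (gap \<zeta> z * F)) = w * (z * F)" for z w F
  proof -
    have "\<zeta> * (w * F - w * (gap \<zeta> z * F)) = (\<zeta> * (1 - gap \<zeta> z)) * (w * F)"
      by (simp add: algebra_simps)
    then show ?thesis
      by (simp only: z mult.left_commute)
  qed
  have shift: "Wop \<zeta> l b (hardy_shift f) = \<zeta> *\<^sub>C (y - x)"
    using lft_in_disk[OF assms(1) _ assms(2,3)]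
    by (intro hardy_eqI) (simp add: x_def y_def hardy_fun_Wop[OF assms] shift_factor)
  have gapy: "gap_op \<zeta> y = of_real l *\<^sub>C x + b *\<^sub>C gap_op \<zeta> x"
    unfolding x_def y_def by (rule Wop_gap_op[OF assms])
  have "gap_op \<zeta> (y - b *\<^sub>C x) = of_real l *\<^sub>C x"
    by (simp add: blinfun.diff_right gapy clinear_hardyD[OF clinear_gap_op])
  with norm_gap_op_sq[OF assms(1), of "y - b *\<^sub>C x"]
  have "(norm (of_real l *\<^sub>C x))\<^sup>2 = 2 * Re (hardy_cinner (of_real l *\<^sub>C x) (y - b *\<^sub>C x))"
    by simp
  then have "l * (l * (norm x)\<^sup>2) + l * (Re b * (2 * (norm x)\<^sup>2)) = l * (2 * Re (hardy_cinner x y))"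
    by (simp add: hardy_cinner.diff_right hardy_cinner_self power_mult_distrib power2_eq_square[of l]
        algebra_simps)
  then have "l * (norm x)\<^sup>2 + Re b * (2 * (norm x)\<^sup>2) = 2 * Re (hardy_cinner x y)"
    using assms(2) by (simp only: distrib_left[symmetric] mult_cancel_left) simp
  then have "2 * Re (hardy_cinner x y) = (kap l b + 1) * (norm x)\<^sup>2"
    using assms(2) by (simp add: kap_def algebra_simps)
  moreover have "Re (hardy_cinner x y) = Re (hardy_cinner y x)"
    by (simp add: Re_hardy_cinner inner_commute)
  ultimately show ?thesis
    unfolding shift x_def[symmetric] y_def[symmetric]
    by (simp add: assms(1) norm_diff_hardy_sq algebra_simps)
qed

text \<open>Along \<open>f, S f, S\<^sup>2 f, \<dots>\<close> the energy \<open>\<parallel>W S\<^sup>n f\<parallel>\<^sup>2\<close> decreases by \<open>kap l b \<parallel>W P S\<^sup>n f\<parallel>\<^sup>2\<close> at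
  each step, and these losses are decreasing in \<open>n\<close>. Hence \<open>\<parallel>W P S\<^sup>N f\<parallel>\<close> is of order
  \<open>1 / sqrt N\<close>, uniformly on the unit ball, and \<open>P W = (l + b P) W P\<close> carries this over to the
  operator in question.\<close>

lemma compact_gap_Wop:
  assumes "cmod \<zeta> = 1" "0 < l" "0 < kap l b"
  shows "gap_op \<zeta> o\<^sub>L Wop \<zeta> l b \<in> compact_ops"
proof -
  have k: "0 \<le> kap l b"
    using assms by simp
  note W = assms(1,2) k
  let ?W = "Wop \<zeta> l b"
  have comm: "gap_op \<zeta> (hardy_shift f) = hardy_shift (gap_op \<zeta> f)" for f
    by (rule hardy_eqI) simp
  define C where "C = (l + 2 * cmod b) / sqrt (l * kap l b)"
  show ?thesis
  proof (rule compact_op_if_small_on_shifts)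
    show "clinear_op (gap_op \<zeta> o\<^sub>L ?W)"
      by (intro clinear_op_intros clinear_gap_op clinear_Wop W)
    have "(\<lambda>n. C * sqrt (inverse (real (Suc n)))) \<longlonglongrightarrow> C * sqrt 0"
      by (intro tendsto_intros LIMSEQ_inverse_real_of_nat)
    then show "(\<lambda>n. C * sqrt (inverse (real (Suc n)))) \<longlonglongrightarrow> 0"
      by simp
    fix N f
    define g where "g n = (blinfun_apply hardy_shift ^^ n) f" for n
    define a where "a n = norm (?W (gap_op \<zeta> (g n)))" for n
    have step: "norm (?W (hardy_shift h)) \<le> norm (?W h)" for h
    proof -
      have "(norm (?W (hardy_shift h)))\<^sup>2 \<le> (norm (?W h))\<^sup>2"
        using norm_Wop_shift[OF W, of h] k by simp
      then show ?thesis
        by (rule power2_le_imp_le) simp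
    qed
    have "kap l b * real (Suc N) * (a N)\<^sup>2 \<le> (norm (?W (g 0)))\<^sup>2"
    proof (rule decreasing_energy_bound[where e = "\<lambda>n. (norm (?W (g n)))\<^sup>2"])
      show "a (Suc n) \<le> a n" for n
        by (simp add: a_def g_def comm step)
      show "(norm (?W (g (Suc n))))\<^sup>2 \<le> (norm (?W (g n)))\<^sup>2 - kap l b * (a n)\<^sup>2" for n
        using norm_Wop_shift[OF W, of "g n"] by (simp add: a_def g_def)
    qed (use k in \<open>auto simp: a_def\<close>)
    also have "(norm (?W (g 0)))\<^sup>2 \<le> (1 / sqrt l * norm f)\<^sup>2"
      using norm_Wop_apply[OF W, of f] by (intro power_mono) (auto simp: g_def)
    finally have "(a N)\<^sup>2 * (l * kap l b * real (Suc N)) \<le> (norm f)\<^sup>2"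
      using assms(2) by (simp add: power_mult_distrib power_divide field_simps del: of_nat_Suc)
    then have "(a N)\<^sup>2 \<le> (norm f)\<^sup>2 / (l * kap l b * real (Suc N))"
      using assms(2,3) by (subst pos_le_divide_eq) auto
    also have "\<dots> = (norm f / sqrt (l * kap l b) * sqrt (inverse (real (Suc N))))\<^sup>2"
      using assms(2,3) by (simp add: power_mult_distrib power_divide power_inverse divide_inverse del: of_nat_Suc)
    finally have "(a N)\<^sup>2 \<le> (norm f / sqrt (l * kap l b) * sqrt (inverse (real (Suc N))))\<^sup>2" .
    then have aN: "a N \<le> norm f / sqrt (l * kap l b) * sqrt (inverse (real (Suc N)))"
      by (rule power2_le_imp_le) (use assms(2,3) in simp)
    have "norm ((gap_op \<zeta> o\<^sub>L ?W) (g N))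
        = norm (of_real l *\<^sub>C ?W (gap_op \<zeta> (g N)) + b *\<^sub>C gap_op \<zeta> (?W (gap_op \<zeta> (g N))))"
      using Wop_gap_op[OF W, of "g N"] by simp
    also have "\<dots> \<le> l * a N + cmod b * (2 * a N)"
      using norm_gap_op_apply[OF assms(1), of "?W (gap_op \<zeta> (g N))"] assms(2)
      by (intro order_trans[OF norm_triangle_ineq] add_mono) (auto simp: a_def intro: mult_left_mono)
    also have "\<dots> = (l + 2 * cmod b) * a N"
      by (simp add: algebra_simps)
    also have "\<dots> \<le> (l + 2 * cmod b) * (norm f / sqrt (l * kap l b) * sqrt (inverse (real (Suc N))))"
      using assms(2) by (intro mult_left_mono aN) auto
    finally show "norm ((gap_op \<zeta> o\<^sub>L ?W) ((blinfun_apply hardy_shift ^^ N) f))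
        \<le> C * sqrt (inverse (real (Suc N))) * norm f"
      by (simp add: C_def g_def mult_ac)
  qed
qed

text \<open>The factor \<open>l + b p\<close> undoes the weight.\<close>

lemma composition_op_eq_Wop:
  assumes "cmod \<zeta> = 1" "0 < l" "0 \<le> kap l b" and \<phi>: "\<And>z. z \<in> \<D> \<Longrightarrow> \<phi> z = lft \<zeta> l b z"
  shows "composition_op \<phi> = (scaleC_op (of_real l) o\<^sub>L Wop \<zeta> l b)
    + (scaleC_op b o\<^sub>L (gap_op \<zeta> o\<^sub>L Wop \<zeta> l b))"
proof (rule composition_op_eqI)
  fix f z assume z: "z \<in> \<D>"
  have "of_real l + b * gap \<zeta> z \<noteq> 0"
    using z by (intro lfw_denominator_nonzero assms) auto
  then have "(of_real l + b * gap \<zeta> z) * lfw \<zeta> l b z = 1"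
    by (simp add: lfw_def)
  then have "hardy_fun f (lft \<zeta> l b z)
      = (of_real l + b * gap \<zeta> z) * lfw \<zeta> l b z * hardy_fun f (lft \<zeta> l b z)"
    by simp
  then show "hardy_fun (((scaleC_op (of_real l) o\<^sub>L Wop \<zeta> l b)
    + (scaleC_op b o\<^sub>L (gap_op \<zeta> o\<^sub>L Wop \<zeta> l b))) f) z = hardy_fun f (\<phi> z)"
    using z by (simp add: \<phi> hardy_fun_Wop[OF assms(1-3)] blinfun.add_left algebra_simps)
qed

section \<open>Self-adjoint translations\<close>

lemma kap_translation [simp]: "kap 1 (complex_of_real t) = 2 * t"
  by (simp add: kap_def)

text \<open>The translation \<open>E\<close> by \<open>t\<close> is the square of the self-adjoint contraction \<open>F\<close> translating by
  \<open>t / 2\<close>. So \<open>\<langle>f, E f\<rangle> = \<parallel>F f\<parallel>\<^sup>2 \<ge> \<parallel>E f\<parallel>\<^sup>2\<close>, which is the inequality \<open>E\<^sup>2 \<le> E\<close> behind all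
  estimates for powers of \<open>1 - E\<close>.\<close>

lemma translation_contraction:
  assumes "cmod \<zeta> = 1" "0 < t"
  shows "(norm (f - Wop \<zeta> 1 (of_real t) f))\<^sup>2 \<le> (norm f)\<^sup>2 - (norm (Wop \<zeta> 1 (of_real t) f))\<^sup>2"
proof -
  let ?E = "Wop \<zeta> 1 (of_real t)" and ?F = "Wop \<zeta> 1 (of_real (t / 2))"
  have "0 \<le> kap 1 (complex_of_real (t / 2))"
    using assms unfolding kap_translation by simp
  note W = assms(1) zero_less_one this
  have "?F o\<^sub>L ?F = ?E"
    using Wop_compose[OF W W(2,3)] by (simp flip: of_real_add)
  then have E: "?E g = ?F (?F g)" for g
    by (metis blinfun_apply_blinfun_compose)
  have F: "norm (?F g) \<le> norm g" for g
    using norm_Wop_apply[OF W, of g] by simp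
  have "hardy_cinner (?E f) f = hardy_cinner (?F f) (?F f)"
    unfolding E using Wop_adjoint[OF W, of "?F f" f] by simp
  then have "Re (hardy_cinner f (?E f)) = (norm (?F f))\<^sup>2"
    by (simp add: hardy_cinner_self Re_hardy_cinner inner_commute[of f])
      (simp add: Re_hardy_cinner[symmetric] hardy_cinner_self)
  moreover have "(norm (?E f))\<^sup>2 \<le> (norm (?F f))\<^sup>2"
    unfolding E by (intro power_mono F) auto
  ultimately show ?thesis
    unfolding norm_diff_hardy_sq by simp
qed

primrec co_power :: "(hardy \<Rightarrow>\<^sub>L hardy) \<Rightarrow> nat \<Rightarrow> (hardy \<Rightarrow>\<^sub>L hardy)"
  where "co_power E 0 = id_blinfun"
  | "co_power E (Suc n) = (id_blinfun - E) o\<^sub>L co_power E n"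

lemma norm_co_power_translation:
  assumes "cmod \<zeta> = 1" "0 < t"
  shows "norm (co_power (Wop \<zeta> 1 (of_real t)) n f) \<le> norm f"
proof (induction n)
  case (Suc n)
  let ?g = "co_power (Wop \<zeta> 1 (of_real t)) n f"
  have "(norm (?g - Wop \<zeta> 1 (of_real t) ?g))\<^sup>2 \<le> (norm ?g)\<^sup>2"
    by (rule order_trans[OF translation_contraction[OF assms]]) simp
  then have "norm (?g - Wop \<zeta> 1 (of_real t) ?g) \<le> norm ?g"
    by (rule power2_le_imp_le) simp
  with Suc show ?case
    by (simp add: blinfun.bilinear_simps)
qed simp

text \<open>The energies \<open>\<parallel>(1 - E)\<^sup>n f\<parallel>\<^sup>2\<close> decrease by at least \<open>\<parallel>E (1 - E)\<^sup>n f\<parallel>\<^sup>2\<close> at each step. This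
  replaces the spectral estimate \<open>x (1 - x)\<^sup>n \<le> 1 / (n + 1)\<close> on \<open>[0, 1]\<close>, with a weaker rate.\<close>

lemma norm_translation_co_power:
  assumes "cmod \<zeta> = 1" "0 < t"
  shows "norm (Wop \<zeta> 1 (of_real t) (co_power (Wop \<zeta> 1 (of_real t)) n f))
    \<le> sqrt (inverse (real (Suc n))) * norm f"
proof -
  let ?E = "Wop \<zeta> 1 (of_real t)"
  let ?X = "co_power ?E"
  have step: "norm (h - ?E h) \<le> norm h" for h
    using norm_co_power_translation[OF assms, of 1 h] by (simp add: blinfun.bilinear_simps)
  have "1 * real (Suc n) * (norm (?E (?X n f)))\<^sup>2 \<le> (norm (?X 0 f))\<^sup>2"
  proof (rule decreasing_energy_bound[where a = "\<lambda>n. norm (?E (?X n f))" and e = "\<lambda>n. (norm (?X n f))\<^sup>2"])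
    show "norm (?E (?X (Suc n) f)) \<le> norm (?E (?X n f))" for n
      using step[of "?E (?X n f)"] by (simp add: blinfun.bilinear_simps)
    show "(norm (?X (Suc n) f))\<^sup>2 \<le> (norm (?X n f))\<^sup>2 - 1 * (norm (?E (?X n f)))\<^sup>2" for n
      using translation_contraction[OF assms, of "?X n f"] by (simp add: blinfun.bilinear_simps)
  qed auto
  then have "(norm (?E (?X n f)))\<^sup>2 \<le> (norm f)\<^sup>2 / real (Suc n)"
    by (simp add: field_simps)
  also have "\<dots> = (sqrt (inverse (real (Suc n))) * norm f)\<^sup>2"
    by (simp add: power_mult_distrib divide_inverse del: of_nat_Suc)
  finally show ?thesis
    by (rule power2_le_imp_le) simp
qed

section \<open>Damping: lowering the translation parameter\<close>

lemma cstar_closed_ops: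
  assumes "unital_cstar_subalgebra A"
  shows "S \<in> A \<Longrightarrow> T \<in> A \<Longrightarrow> S + T \<in> A"
    and "T \<in> A \<Longrightarrow> scaleC_op c o\<^sub>L T \<in> A"
    and "S \<in> A \<Longrightarrow> T \<in> A \<Longrightarrow> S o\<^sub>L T \<in> A"
    and "T \<in> A \<Longrightarrow> is_adjoint_op T S \<Longrightarrow> S \<in> A"
    and "id_blinfun \<in> A" and "closed A" and "T \<in> A \<Longrightarrow> clinear_op T"
  using assms unfolding unital_cstar_subalgebra_def by blast+

lemma cstar_diff:
  assumes A: "unital_cstar_subalgebra A" and "S \<in> A" "T \<in> A"
  shows "S - T \<in> A"
proof -
  have "S - T = S + (scaleC_op (- 1) o\<^sub>L T)"
    by (rule blinfun_eqI) (simp add: blinfun.bilinear_simps hardy_uminus_eq[symmetric])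
  then show ?thesis
    using cstar_closed_ops(1)[OF A assms(2) cstar_closed_ops(2)[OF A assms(3)]] by (simp only:)
qed

lemma cstar_zero:
  assumes A: "unital_cstar_subalgebra A"
  shows "0 \<in> A"
  using cstar_diff[OF A cstar_closed_ops(5)[OF A] cstar_closed_ops(5)[OF A]] by simp

lemma cstar_sum:
  assumes "unital_cstar_subalgebra A" "\<And>i. i \<in> I \<Longrightarrow> F i \<in> A"
  shows "sum F I \<in> A"
  using assms(2)
  by (induction I rule: infinite_finite_induct)
    (simp_all add: cstar_zero[OF assms(1)] cstar_closed_ops(1)[OF assms(1)])

lemma Wop_translate:
  assumes "cmod \<zeta> = 1" "0 < m" "0 \<le> kap m c" "0 < t"
  shows "Wop \<zeta> m c o\<^sub>L Wop \<zeta> 1 (of_real t) = Wop \<zeta> m (c + of_real t)"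
  using Wop_compose[OF assms(1-3), of 1 "of_real t"] assms(4) by simp

lemma kap_translate: "kap m (c + of_real t) = kap m c + 2 * t"
  by (simp add: kap_def)

lemma Wop_co_power_Suc:
  assumes "cmod \<zeta> = 1" "0 < m" "0 \<le> kap m c" "0 < t"
  shows "Wop \<zeta> m c o\<^sub>L co_power (Wop \<zeta> 1 (of_real t)) (Suc n)
    = (Wop \<zeta> m c o\<^sub>L co_power (Wop \<zeta> 1 (of_real t)) n)
    - (Wop \<zeta> m (c + of_real t) o\<^sub>L co_power (Wop \<zeta> 1 (of_real t)) n)"
  unfolding Wop_translate[OF assms, symmetric]
  by (rule blinfun_eqI) (simp add: blinfun.bilinear_simps)

context
  fixes A :: "(hardy \<Rightarrow>\<^sub>L hardy) set" and \<zeta> :: complex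
  assumes A: "unital_cstar_subalgebra A" and \<zeta>: "cmod \<zeta> = 1"
begin

lemma Wop_co_power_mem:
  assumes "0 < m" "0 \<le> kap m c" "0 < t"
    and mem: "\<And>k::nat. Wop \<zeta> m (c + of_nat k * of_real t) \<in> A"
  shows "Wop \<zeta> m (c + of_nat k * of_real t) o\<^sub>L co_power (Wop \<zeta> 1 (of_real t)) n \<in> A"
proof (induction n arbitrary: k)
  case 0
  have "Wop \<zeta> m (c + of_nat k * of_real t) o\<^sub>L id_blinfun = Wop \<zeta> m (c + of_nat k * of_real t)"
    by (rule blinfun_eqI) simp
  then show ?case
    using mem by simp
next
  case (Suc n)
  have k: "0 \<le> kap m (c + of_nat k * of_real t)"
    using kap_translate[of m c "real k * t"] assms by simp
  show ?case
    unfolding Wop_co_power_Suc[OF \<zeta> assms(1) k assms(3)]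
    using Suc[of k] Suc[of "Suc k"] by (intro cstar_diff[OF A]) (simp_all add: algebra_simps)
qed

text \<open>With \<open>E\<close> the translation by \<open>t\<close>, \<open>W(m, c) - W(m, c) (1 - E)\<^sup>n = \<Sum>i<n. W(m, c + t) (1 - E)\<^sup>i\<close>
  is a combination of the operators \<open>W(m, c + k t)\<close> with \<open>k \<ge> 1\<close>. It converges to \<open>W(m, c)\<close> in
  norm because \<open>W(m, c) = W(m, c - t) E\<close> and \<open>E (1 - E)\<^sup>n \<rightarrow> 0\<close>. The room to the left of \<open>c\<close>,
  by \<open>t\<close>, is what makes the damping work.\<close>

lemma Wop_mem_from_right:
  assumes "0 < m" "0 \<le> kap m (c - of_real t)" "0 < t"
    and mem: "\<And>k::nat. 1 \<le> k \<Longrightarrow> Wop \<zeta> m (c + of_nat k * of_real t) \<in> A"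
  shows "Wop \<zeta> m c \<in> A"
proof -
  let ?X = "co_power (Wop \<zeta> 1 (of_real t))"
  have k: "0 \<le> kap m c" "0 \<le> kap m (c + of_real t)"
    using assms kap_translate[of m "c - of_real t" t] kap_translate[of m c t] by auto
  have mem': "Wop \<zeta> m (c + of_real t) o\<^sub>L ?X n \<in> A" for n
  proof -
    have "Wop \<zeta> m (c + of_real t + of_nat k * of_real t) \<in> A" for k :: nat
      using mem[of "Suc k"] by (simp add: algebra_simps)
    from Wop_co_power_mem[OF assms(1) k(2) assms(3) this, of 0 n] show ?thesis
      by simp
  qed
  have "Wop \<zeta> m c - (Wop \<zeta> m c o\<^sub>L ?X n) \<in> A" for n
  proof (induction n)
    case 0
    have "Wop \<zeta> m c - (Wop \<zeta> m c o\<^sub>L ?X 0) = 0"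
      by (rule blinfun_eqI) (simp add: blinfun.bilinear_simps)
    then show ?case
      using cstar_zero[OF A] by simp
  next
    case (Suc n)
    have "Wop \<zeta> m c - (Wop \<zeta> m c o\<^sub>L ?X (Suc n))
      = (Wop \<zeta> m c - (Wop \<zeta> m c o\<^sub>L ?X n)) + (Wop \<zeta> m (c + of_real t) o\<^sub>L ?X n)"
      unfolding Wop_co_power_Suc[OF \<zeta> assms(1) k(1) assms(3)] by simp
    then show ?case
      using cstar_closed_ops(1)[OF A Suc mem'] by (simp only:)
  qed
  moreover have "(\<lambda>n. Wop \<zeta> m c - (Wop \<zeta> m c o\<^sub>L ?X n)) \<longlonglongrightarrow> Wop \<zeta> m c - 0"
  proof (intro tendsto_diff tendsto_const)
    have bound: "norm (Wop \<zeta> m c o\<^sub>L ?X n) \<le> 1 / sqrt m * sqrt (inverse (real (Suc n)))" for n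
    proof (rule norm_blinfun_bound)
      fix f
      have "(Wop \<zeta> m c o\<^sub>L ?X n) f = Wop \<zeta> m (c - of_real t) (Wop \<zeta> 1 (of_real t) (?X n f))"
        using arg_cong[OF Wop_translate[OF \<zeta> assms(1,2,3)], of "\<lambda>T. T (?X n f)"] by simp
      then have "norm ((Wop \<zeta> m c o\<^sub>L ?X n) f)
          \<le> 1 / sqrt m * norm (Wop \<zeta> 1 (of_real t) (?X n f))"
        using norm_Wop_apply[OF \<zeta> assms(1,2)] by simp
      also have "\<dots> \<le> 1 / sqrt m * (sqrt (inverse (real (Suc n))) * norm f)"
        using assms(1) by (intro mult_left_mono norm_translation_co_power[OF \<zeta> assms(3)]) auto
      finally show "norm ((Wop \<zeta> m c o\<^sub>L ?X n) f) \<le> 1 / sqrt m * sqrt (inverse (real (Suc n))) * norm f"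
        by (simp add: mult.assoc)
    qed (use assms in auto)
    have "(\<lambda>n. 1 / sqrt m * sqrt (inverse (real (Suc n)))) \<longlonglongrightarrow> 1 / sqrt m * sqrt 0"
      by (intro tendsto_intros LIMSEQ_inverse_real_of_nat)
    then have "(\<lambda>n. 1 / sqrt m * sqrt (inverse (real (Suc n)))) \<longlonglongrightarrow> 0"
      by simp
    then show "(\<lambda>n. Wop \<zeta> m c o\<^sub>L ?X n) \<longlonglongrightarrow> 0"
      by (rule Lim_null_comparison[rotated]) (use bound in \<open>auto intro!: always_eventually\<close>)
  qed
  ultimately show ?thesis
    using closed_sequentially[OF cstar_closed_ops(6)[OF A]] by (metis diff_zero)
qed

text \<open>Taking \<open>t = kap m c / 2\<close> in the preceding lemma halves the threshold on \<open>kap\<close>.\<close>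

lemma Wop_mem_extend_left:
  assumes m: "0 < m" and mem: "\<And>c. kap m c > \<rho> \<Longrightarrow> Wop \<zeta> m c \<in> A" and c: "0 < kap m c"
  shows "Wop \<zeta> m c \<in> A"
proof -
  have "\<forall>c. kap m c > \<bar>\<rho>\<bar> / 2 ^ n \<longrightarrow> Wop \<zeta> m c \<in> A" for n
  proof (induction n)
    case 0
    then show ?case using mem by auto
  next
    case (Suc n)
    show ?case
    proof (intro allI impI)
      fix c assume c: "\<bar>\<rho>\<bar> / 2 ^ Suc n < kap m c"
      define t where "t = kap m c / 2"
      have t: "0 < t"
        using c le_less_trans[of 0 "\<bar>\<rho>\<bar> / 2 ^ Suc n" "kap m c"] by (simp add: t_def)
      show "Wop \<zeta> m c \<in> A"
      proof (rule Wop_mem_from_right[OF m _ t])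
        show "0 \<le> kap m (c - of_real t)"
          using kap_translate[of m "c - of_real t" t] by (simp add: t_def)
        fix k :: nat assume "1 \<le> k"
        then have "t \<le> real k * t"
          using t by simp
        have "kap m (c + of_nat k * of_real t) = kap m c + 2 * (real k * t)"
          using kap_translate[of m c "real k * t"] by simp
        also have "\<dots> \<ge> 2 * kap m c"
          using \<open>t \<le> real k * t\<close> by (simp add: t_def)
        finally have "kap m (c + of_nat k * of_real t) > \<bar>\<rho>\<bar> / 2 ^ n"
          using c by simp
        then show "Wop \<zeta> m (c + of_nat k * of_real t) \<in> A"
          using Suc by blast
      qed
    qed
  qed
  moreover obtain n where "\<bar>\<rho>\<bar> / 2 ^ n < kap m c"
  proof -
    obtain n where "\<bar>\<rho>\<bar> / kap m c < 2 ^ n"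
      using real_arch_pow[of 2] by auto
    then have "\<bar>\<rho>\<bar> / 2 ^ n < kap m c"
      using c by (simp add: field_simps)
    then show ?thesis using that by blast
  qed
  ultimately show ?thesis by blast
qed

end

section \<open>Newton series: raising the translation parameter\<close>

text \<open>Convergence of the Gauss product for the reciprocal Gamma function.\<close>

lemma pochhammer_bound:
  fixes a :: complex
  shows "\<exists>K. \<forall>n\<ge>1. cmod (pochhammer a (Suc n) / fact (Suc n)) \<le> K * real n powr (Re a - 1)"
proof -
  have "Bseq (rGamma_series a)"
    by (rule convergent_imp_Bseq) (use rGamma_series_LIMSEQ[of a] in \<open>auto simp: convergent_def\<close>)
  then obtain K where K: "0 < K" "\<And>n. cmod (rGamma_series a n) \<le> K"
    unfolding Bseq_def by auto
  have "cmod (pochhammer a (Suc n) / fact (Suc n)) \<le> K * real n powr (Re a - 1)" if "n \<ge> 1" for n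
  proof -
    have n: "0 < real n"
      using that by simp
    have e: "cmod (exp (a * of_real (ln (real n)))) = real n powr Re a"
      using n by (simp add: powr_def norm_exp_eq_Re mult.commute)
    have "cmod (pochhammer a (Suc n)) / (fact n * real n powr Re a) \<le> K"
      using K(2)[of n] e by (simp add: rGamma_series_def norm_divide norm_mult)
    then have "cmod (pochhammer a (Suc n)) / fact n \<le> K * real n powr Re a"
      using n by (simp add: field_simps)
    then have "cmod (pochhammer a (Suc n)) / fact n / real (Suc n) \<le> K * real n powr Re a / real (Suc n)"
      by (intro divide_right_mono) auto
    also have "\<dots> \<le> K * real n powr Re a / real n"
      using n K by (intro divide_left_mono) auto
    also have "\<dots> = K * real n powr (Re a - 1)"
      using n by (simp add: powr_diff)
    also have "cmod (pochhammer a (Suc n)) / fact n / real (Suc n) = cmod (pochhammer a (Suc n) / fact (Suc n))"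
      by (simp add: norm_divide norm_mult del: of_nat_Suc pochhammer_Suc)
    finally show ?thesis .
  qed
  then show ?thesis by blast
qed

lemma summable_pochhammer_powr:
  fixes a :: complex
  assumes "Re a < 1 - 1 / real j" "0 < j"
  shows "summable (\<lambda>n. (cmod (pochhammer a n / fact n)) ^ j)"
proof -
  obtain K where K: "\<And>n. n \<ge> 1 \<Longrightarrow> cmod (pochhammer a (Suc n) / fact (Suc n)) \<le> K * real n powr (Re a - 1)"
    using pochhammer_bound by blast
  have "summable (\<lambda>n. K ^ j * real n powr (real j * (Re a - 1)))"
    using assms by (intro summable_mult) (simp add: summable_real_powr_iff field_simps)
  then have "summable (\<lambda>n. (cmod (pochhammer a (Suc n) / fact (Suc n))) ^ j)"
  proof (rule summable_comparison_test'[where N = 1])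
    fix n :: nat assume n: "n \<ge> 1"
    have "(cmod (pochhammer a (Suc n) / fact (Suc n))) ^ j \<le> (K * real n powr (Re a - 1)) ^ j"
      by (intro power_mono K n) simp
    also have "\<dots> = K ^ j * real n powr (real j * (Re a - 1))"
      using n by (simp add: power_mult_distrib powr_realpow[symmetric] powr_powr mult.commute)
    finally show "norm ((cmod (pochhammer a (Suc n) / fact (Suc n))) ^ j) \<le> K ^ j * real n powr (real j * (Re a - 1))"
      by simp
  qed
  then show ?thesis
    by (rule summable_Suc_iff[THEN iffD1])
qed

lemma pochhammer_nonzero: "0 < Re x \<Longrightarrow> pochhammer x n \<noteq> 0"
  by (auto simp: pochhammer_eq_0_iff)

lemma fact_le_pochhammer:
  assumes "0 < Re x"
  shows "Re x * fact n \<le> cmod (pochhammer x (Suc n))"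
proof (induction n)
  case 0
  show ?case by (simp add: complex_Re_le_cmod)
next
  case (Suc n)
  have "real (Suc n) \<le> Re (x + of_nat (Suc n))"
    using assms by simp
  then have "real (Suc n) \<le> cmod (x + of_nat (Suc n))"
    using complex_Re_le_cmod order_trans by blast
  then have "Re x * fact n * real (Suc n) \<le> cmod (pochhammer x (Suc n)) * cmod (x + of_nat (Suc n))"
    using Suc assms by (intro mult_mono) auto
  also have "\<dots> = cmod (pochhammer x (Suc (Suc n)))"
    by (subst (2) pochhammer_Suc) (simp add: norm_mult)
  finally show ?case
    by (simp add: mult_ac)
qed

text \<open>The Newton interpolation series of \<open>s \<mapsto> 1 / (x + s)\<close> at the points \<open>0, 1, 2, \<dots>\<close>. The partial
  sums have a closed form in which the remainder is a quotient of Pochhammer symbols of order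
  at most \<open>n powr (- Re s)\<close>.\<close>

lemma Newton_series_reciprocal:
  fixes s x :: complex
  assumes "0 < Re s" "0 < Re x"
  shows "(\<lambda>j. pochhammer (- s) j / fact j * (fact j / pochhammer x (Suc j))) sums (1 / (x + s))"
proof -
  have xs: "x + s \<noteq> 0"
    using assms by (auto simp: complex_eq_iff)
  have partial: "(\<Sum>j<n. pochhammer (- s) j / pochhammer x (Suc j))
    = (1 - pochhammer (- s) n / pochhammer x n) / (x + s)" for n
  proof (induction n)
    case (Suc n)
    have nz: "pochhammer x n \<noteq> 0" "x + of_nat n \<noteq> 0"
      using pochhammer_nonzero[OF assms(2), of "Suc n"] by (auto simp: pochhammer_Suc)
    show ?case
      unfolding sum.lessThan_Suc Suc
      using nz xs by (simp add: pochhammer_Suc divide_simps) (simp add: algebra_simps)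
  qed simp
  obtain K where K: "\<And>n. n \<ge> 1 \<Longrightarrow> cmod (pochhammer (- s) (Suc n) / fact (Suc n)) \<le> K * real n powr (Re (- s) - 1)"
    using pochhammer_bound by blast
  have lim: "(\<lambda>n. pochhammer (- s) (Suc n) / pochhammer x (Suc n)) \<longlonglongrightarrow> 0"
  proof (rule Lim_null_comparison)
    show "\<forall>\<^sub>F n in sequentially. cmod (pochhammer (- s) (Suc n) / pochhammer x (Suc n))
      \<le> 2 * K / Re x * real n powr (- Re s)"
    proof (rule eventually_sequentiallyI[of 1])
      fix n :: nat assume n: "1 \<le> n"
      have K0: "0 \<le> K * real n powr (Re (- s) - 1)"
        using K[OF n] norm_ge_zero order_trans by blast
      have "cmod (pochhammer (- s) (Suc n) / pochhammer x (Suc n))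
        = cmod (pochhammer (- s) (Suc n) / fact (Suc n)) * (fact (Suc n) / cmod (pochhammer x (Suc n)))"
        by (simp add: norm_divide del: fact_Suc)
      also have "\<dots> \<le> (K * real n powr (Re (- s) - 1)) * (fact (Suc n) / (Re x * fact n))"
        using fact_le_pochhammer[OF assms(2), of n] assms(2) K0
          pochhammer_nonzero[OF assms(2), of "Suc n"]
        by (intro mult_mono K n divide_left_mono mult_pos_pos) (auto simp del: pochhammer_Suc)
      also have "fact (Suc n) / (Re x * fact n) = real (Suc n) / Re x"
        by simp
      also have "(K * real n powr (Re (- s) - 1)) * (real (Suc n) / Re x)
        \<le> (K * real n powr (Re (- s) - 1)) * (2 * real n / Re x)"
        using n assms(2) K0 by (intro mult_left_mono divide_right_mono) auto
      also have "\<dots> = 2 * K / Re x * (real n powr (Re (- s) - 1) * real n powr 1)"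
        using n by simp
      also have "\<dots> = 2 * K / Re x * real n powr (- Re s)"
        by (subst powr_add[symmetric]) simp
      finally show "cmod (pochhammer (- s) (Suc n) / pochhammer x (Suc n))
        \<le> 2 * K / Re x * real n powr (- Re s)" .
    qed
    have "((\<lambda>n. real n powr (- Re s)) \<longlongrightarrow> 0) sequentially"
      using assms(1) by (intro tendsto_neg_powr filterlim_real_sequentially) auto
    then show "(\<lambda>n. 2 * K / Re x * real n powr (- Re s)) \<longlonglongrightarrow> 0"
      by (rule tendsto_mult_right_zero)
  qed
  then have "(\<lambda>n. pochhammer (- s) n / pochhammer x n) \<longlonglongrightarrow> 0"
    by (rule LIMSEQ_imp_Suc)
  then have "(\<lambda>n. (1 - pochhammer (- s) n / pochhammer x n) / (x + s)) \<longlonglongrightarrow> (1 - 0) / (x + s)"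
    by (intro tendsto_intros xs)
  moreover have "pochhammer (- s) j / fact j * (fact j / pochhammer x (Suc j)) = pochhammer (- s) j / pochhammer x (Suc j)" for j
    by simp
  ultimately show ?thesis
    unfolding sums_def by (simp only: partial) simp
qed

lemma Wop_kernel_value:
  assumes "cmod \<zeta> = 1" "0 < m" "0 \<le> kap m c" "0 < r" "r < 1" "0 < r'" "r' < 1"
  shows "hardy_cinner (Wop \<zeta> m c (hardy_kernel (\<zeta> * of_real r))) (hardy_kernel (\<zeta> * of_real r'))
    = 1 / (of_real ((1 - r) * (1 - r')) * (of_real (m / (1 - r') + 1 / (1 - r) - 1) + c))"
proof -
  have D: "\<zeta> * of_real r \<in> \<D>" "\<zeta> * of_real r' \<in> \<D>"
    using assms by (simp_all add: norm_mult)
  have "hardy_cinner (Wop \<zeta> m c (hardy_kernel (\<zeta> * of_real r))) (hardy_kernel (\<zeta> * of_real r'))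
    = 1 / (of_real m * of_real (1 - r) + of_real (1 - r')
        + (c - 1) * of_real (1 - r') * of_real (1 - r))"
    using D by (simp add: hardy_cinner_kernel Wop_kernel[OF assms(1-3)]
        hardy_fun_kernel_image[OF assms(1-3)] gap_boundary_point[OF assms(1)] del: of_real_diff)
  also have "of_real m * of_real (1 - r) + of_real (1 - r') + (c - 1) * of_real (1 - r') * of_real (1 - r)
    = of_real ((1 - r) * (1 - r')) * (of_real (m / (1 - r') + 1 / (1 - r) - 1) + c)"
  proof -
    have "of_real ((1 - r) * (1 - r')) * complex_of_real (m / (1 - r') + 1 / (1 - r) - 1)
      = of_real ((1 - r) * (1 - r') * (m / (1 - r') + 1 / (1 - r) - 1))"
      by simp
    also have "(1 - r) * (1 - r') * (m / (1 - r') + 1 / (1 - r) - 1)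
      = m * (1 - r) + (1 - r') - (1 - r) * (1 - r')"
    proof -
      have "u * v * (m / v + 1 / u - 1) = m * u + v - u * v" if "u \<noteq> 0" "v \<noteq> 0" for u v :: real
        using that by (simp add: field_simps)
      from this[of "1 - r" "1 - r'"] assms show ?thesis
        by simp
    qed
    finally show ?thesis
      by (simp add: distrib_left) (simp add: algebra_simps)
  qed
  finally show ?thesis .
qed

text \<open>Multiplication by \<open>1 - E\<close> subtracts from a function of \<open>c\<close> its translate by \<open>t\<close>. Iterating
  this for \<open>1 / x\<close> with step one gives \<open>fact j / pochhammer x (Suc j)\<close>.\<close>

lemma co_power_kernel_value:
  assumes "cmod \<zeta> = 1" "0 < m" "0 \<le> kap m c" "0 < t" "0 < r" "r < 1" "0 < r'" "r' < 1"
  shows "hardy_cinner (Wop \<zeta> m c (co_power (Wop \<zeta> 1 (of_real t)) j (hardy_kernel (\<zeta> * of_real r))))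
      (hardy_kernel (\<zeta> * of_real r'))
    = 1 / of_real ((1 - r) * (1 - r') * t) *
      (fact j / pochhammer ((of_real (m / (1 - r') + 1 / (1 - r) - 1) + c) / of_real t) (Suc j))"
  using assms(3)
proof (induction j arbitrary: c)
  case 0
  show ?case
    using assms(4) by (simp add: Wop_kernel_value[OF assms(1,2) 0 assms(5-8)])
next
  case (Suc j)
  let ?X = "co_power (Wop \<zeta> 1 (of_real t))"
  let ?K = "hardy_kernel (\<zeta> * of_real r)" and ?L = "hardy_kernel (\<zeta> * of_real r')"
  define x where "x = (of_real (m / (1 - r') + 1 / (1 - r) - 1) + c) / of_real t"
  have k: "0 \<le> kap m (c + of_real t)"
    using Suc.prems assms(4) by (simp add: kap_translate)
  have "0 \<le> m + 2 * Re c - 1"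
    using Suc.prems by (simp add: kap_def)
  moreover have "m \<le> m / (1 - r')" "1 \<le> 1 / (1 - r)"
    using assms by (simp_all add: field_simps)
  ultimately have "0 < Re x"
    using assms(2,4) by (simp add: x_def Re_divide_of_real)
  have x1: "(of_real (m / (1 - r') + 1 / (1 - r) - 1) + (c + of_real t)) / of_real t = x + 1"
    using assms(4) by (simp add: x_def add_divide_distrib diff_divide_distrib)
  have nz: "pochhammer x (Suc (Suc j)) \<noteq> 0"
    by (rule pochhammer_nonzero) fact
  have "fact j / pochhammer x (Suc j) - fact j / pochhammer (x + 1) (Suc j)
    = fact (Suc j) / pochhammer x (Suc (Suc j))"
  proof -
    have a: "pochhammer x (Suc (Suc j)) = pochhammer x (Suc j) * (x + of_nat (Suc j))"
      by (rule pochhammer_Suc)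
    have b: "pochhammer x (Suc (Suc j)) = x * pochhammer (x + 1) (Suc j)"
      by (rule pochhammer_rec)
    have "fact j / pochhammer x (Suc j) = fact j * (x + of_nat (Suc j)) / pochhammer x (Suc (Suc j))"
      using nz unfolding a by simp
    moreover have "fact j / pochhammer (x + 1) (Suc j) = fact j * x / pochhammer x (Suc (Suc j))"
      using nz unfolding b by simp
    ultimately show ?thesis
      by (simp only: diff_divide_distrib[symmetric]) (simp add: algebra_simps)
  qed
  moreover have "Wop \<zeta> m c (?X (Suc j) ?K) = Wop \<zeta> m c (?X j ?K) - Wop \<zeta> m (c + of_real t) (?X j ?K)"
  proof -
    have "Wop \<zeta> m c (Wop \<zeta> 1 (of_real t) h) = Wop \<zeta> m (c + of_real t) h" for h
      using Wop_compose[OF assms(1,2) Suc.prems, of 1 "of_real t"] assms(4)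
      by (simp flip: blinfun_apply_blinfun_compose)
    then show ?thesis
      by (simp add: blinfun.bilinear_simps)
  qed
  ultimately show ?case
    unfolding x_def[symmetric]
    by (simp only: hardy_cinner.diff_left Suc.IH[OF Suc.prems] Suc.IH[OF k] x1 x_def[symmetric]
        right_diff_distrib[symmetric])
qed

text \<open>The series \<open>\<Sum>j. pochhammer (- s) j / fact j * W(m, c) (1 - E)\<^sup>j\<close> is the Newton series of
  \<open>W(m, c + s t)\<close> in \<open>s\<close>. It converges absolutely since \<open>1 - E\<close> is a contraction and the
  coefficients are summable for \<open>Re s > 0\<close>; its sum is identified on kernels by the scalar
  Newton series. The parameter \<open>s\<close> is complex, so that the imaginary part of \<open>c\<close> is moved as
  well.\<close>

lemma Wop_mem_extend_right:
  assumes A: "unital_cstar_subalgebra A" and \<zeta>: "cmod \<zeta> = 1"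
    and m: "0 < m" "0 \<le> kap m c" and t: "0 < t" and s: "0 < Re s"
    and mem: "\<And>k::nat. Wop \<zeta> m (c + of_nat k * of_real t) \<in> A"
  shows "Wop \<zeta> m (c + s * of_real t) \<in> A"
proof -
  let ?X = "co_power (Wop \<zeta> 1 (of_real t))"
  let ?a = "\<lambda>j. pochhammer (- s) j / fact j"
  define F where "F j = scaleC_op (?a j) o\<^sub>L (Wop \<zeta> m c o\<^sub>L ?X j)" for j
  have F_mem: "F j \<in> A" for j
    unfolding F_def using Wop_co_power_mem[OF A \<zeta> m t mem, of 0 j]
    by (intro cstar_closed_ops(2)[OF A]) simp
  have F_apply: "F j f = ?a j *\<^sub>C Wop \<zeta> m c (?X j f)" for j f
    by (simp add: F_def)
  have F_bound: "norm (F j) \<le> 1 / sqrt m * cmod (?a j)" for j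
  proof (rule norm_blinfun_bound)
    fix f
    have "norm (Wop \<zeta> m c (?X j f)) \<le> 1 / sqrt m * norm (?X j f)"
      by (rule norm_Wop_apply[OF \<zeta> m])
    also have "\<dots> \<le> 1 / sqrt m * norm f"
      using m by (intro mult_left_mono norm_co_power_translation[OF \<zeta> t]) auto
    finally have "cmod (?a j) * norm (Wop \<zeta> m c (?X j f)) \<le> cmod (?a j) * (1 / sqrt m * norm f)"
      by (rule mult_left_mono) simp
    then show "norm (F j f) \<le> 1 / sqrt m * cmod (?a j) * norm f"
      unfolding F_apply norm_hardy_scaleC by (simp only: mult_ac)
  qed (use m in auto)
  have "summable (\<lambda>j. 1 / sqrt m * cmod (?a j))"
    using summable_pochhammer_powr[of "- s" 1] s by (intro summable_mult) simp
  from summable_comparison_test'[OF this F_bound] have "summable F" .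
  define T where "T = suminf F"
  have T: "F sums T"
    unfolding T_def by (rule summable_sums) fact
  have T_mem: "T \<in> A"
  proof (rule closed_sequentially[OF cstar_closed_ops(6)[OF A]])
    show "(\<Sum>j<n. F j) \<in> A" for n
      by (intro cstar_sum[OF A] F_mem)
    show "(\<lambda>n. \<Sum>j<n. F j) \<longlonglongrightarrow> T"
      using T by (simp add: sums_def)
  qed
  have "kap m (c + s * of_real t) = kap m c + 2 * (Re s * t)"
    by (simp add: kap_def)
  then have k: "0 \<le> kap m (c + s * of_real t)"
    using m(2) mult_pos_pos[OF s t] by linarith
  note W = \<zeta> m(1) k
  have on_kernels: "T (hardy_kernel (\<zeta> * of_real r)) = Wop \<zeta> m (c + s * of_real t) (hardy_kernel (\<zeta> * of_real r))"
    if r: "0 < r" "r < 1" for r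
  proof -
    let ?K = "hardy_kernel (\<zeta> * of_real r)"
    have "hardy_cinner (T ?K - Wop \<zeta> m (c + s * of_real t) ?K) (hardy_kernel (\<zeta> * of_real r')) = 0"
      if r': "0 < r'" "r' < 1" for r'
    proof -
      let ?L = "hardy_kernel (\<zeta> * of_real r')"
      define y where "y = complex_of_real (m / (1 - r') + 1 / (1 - r) - 1)"
      define x where "x = (y + c) / of_real t"
      define C where "C = complex_of_real ((1 - r) * (1 - r') * t)"
      have "0 \<le> m + 2 * Re c - 1"
        using m(2) by (simp add: kap_def)
      moreover have "m \<le> m / (1 - r')" "1 \<le> 1 / (1 - r)"
        using r r' m by (simp_all add: field_simps)
      ultimately have x: "0 < Re x"
        using m t by (simp add: x_def y_def Re_divide_of_real)
      have "bounded_linear (\<lambda>S. hardy_cinner (blinfun_apply S ?K) ?L)"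
        by (intro bounded_linear_compose[OF hardy_cinner.bounded_linear_left] blinfun.bounded_linear_left)
      from bounded_linear.sums[OF this T]
      have "(\<lambda>j. ?a j * (1 / C * (fact j / pochhammer x (Suc j)))) sums hardy_cinner (T ?K) ?L"
        unfolding F_apply hardy_cinner_scaleC_left co_power_kernel_value[OF \<zeta> m t r r']
          y_def[symmetric] x_def[symmetric] C_def[symmetric] .
      moreover have "(\<lambda>j. 1 / C * (?a j * (fact j / pochhammer x (Suc j)))) sums (1 / C * (1 / (x + s)))"
        by (intro sums_mult Newton_series_reciprocal s x)
      ultimately have "hardy_cinner (T ?K) ?L = 1 / C * (1 / (x + s))"
        by (simp only: mult.left_commute[of "?a _"]) (rule sums_unique2)
      also have "\<dots> = 1 / (of_real ((1 - r) * (1 - r')) * (of_real t * (x + s)))"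
        by (simp add: C_def)
      also have "of_real t * (x + s) = y + (c + s * of_real t)"
        using t by (simp add: x_def field_simps)
      finally show ?thesis
        by (simp only: hardy_cinner.diff_left Wop_kernel_value[OF W r r'] y_def) simp
    qed
    from hardy_eq_0_if_orthogonal_kernels[OF this \<zeta>] show ?thesis
      by simp
  qed
  have "T f = Wop \<zeta> m (c + s * of_real t) f" for f
  proof -
    have "f \<in> {f. T f = Wop \<zeta> m (c + s * of_real t) f}"
    proof (rule hardy_kernels_dense[where \<zeta> = \<zeta>])
      show "closed {f. T f = Wop \<zeta> m (c + s * of_real t) f}"
        by (intro closed_Collect_eq linear_continuous_on blinfun.bounded_linear_right)
    qed (use on_kernels \<zeta> in \<open>auto simp: blinfun.bilinear_simps
        clinear_hardyD[OF clinear_Wop[OF W]] clinear_hardyD[OF cstar_closed_ops(7)[OF A T_mem]]\<close>)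
    then show ?thesis by simp
  qed
  then have "T = Wop \<zeta> m (c + s * of_real t)"
    by (rule blinfun_eqI)
  with T_mem show ?thesis by simp
qed

text \<open>A single operator with dilation factor \<open>m\<close>, together with one translation, yields all of
  them: the Newton series reaches every \<open>c\<close> with \<open>kap m c > kap m c\<^sub>0\<close>, and damping reaches
  the rest.\<close>

lemma Wop_mem_if_one:
  assumes A: "unital_cstar_subalgebra A" and \<zeta>: "cmod \<zeta> = 1"
    and m: "0 < m" "0 \<le> kap m c\<^sub>0" "Wop \<zeta> m c\<^sub>0 \<in> A"
    and t: "0 < t" "Wop \<zeta> 1 (of_real t) \<in> A" and c: "0 < kap m c"
  shows "Wop \<zeta> m c \<in> A"
proof -
  have mem: "Wop \<zeta> m (c\<^sub>0 + of_nat k * of_real t) \<in> A" for k :: nat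
  proof (induction k)
    case (Suc k)
    have "0 \<le> kap m (c\<^sub>0 + of_nat k * of_real t)"
      using kap_translate[of m c\<^sub>0 "real k * t"] m t by simp
    from Wop_translate[OF \<zeta> m(1) this t(1)]
    have "Wop \<zeta> m (c\<^sub>0 + of_nat (Suc k) * of_real t)
      = Wop \<zeta> m (c\<^sub>0 + of_nat k * of_real t) o\<^sub>L Wop \<zeta> 1 (of_real t)"
      by (simp add: algebra_simps)
    then show ?case
      using cstar_closed_ops(3)[OF A Suc t(2)] by (simp only:)
  qed (use m in simp)
  show ?thesis
  proof (rule Wop_mem_extend_left[OF A \<zeta> m(1) _ c])
    fix c' assume c': "kap m c\<^sub>0 < kap m c'"
    define s where "s = (c' - c\<^sub>0) / of_real t"
    have "0 < Re s"
      using c' t by (simp add: s_def kap_def Re_divide_of_real)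
    from Wop_mem_extend_right[OF A \<zeta> m(1,2) t(1) this mem] show "Wop \<zeta> m c' \<in> A"
      using t by (simp add: s_def)
  qed
qed

text \<open>The adjoint supplies the dilation factor \<open>1 / l\<close>, and \<open>W(l, b) W(l, b)\<^sup>*\<close> is a multiple of
  the translation by \<open>kap l b / l\<close>. Powers of \<open>W(l, b)\<close> and of its adjoint then provide one
  operator for every integer exponent.\<close>

lemma Wop_generated:
  assumes A: "unital_cstar_subalgebra A" and \<zeta>: "cmod \<zeta> = 1"
    and l: "0 < l" "0 < kap l b" "Wop \<zeta> l b \<in> A" and c: "0 < kap (l powi n) c"
  shows "Wop \<zeta> (l powi n) c \<in> A"
proof -
  define b' where "b' = 1 + (cnj b - 1) / complex_of_real l"
  define t where "t = kap l b / l"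
  have l': "0 < 1 / l" "0 < kap (1 / l) b'" "0 < t"
    using l by (simp_all add: kap_adjoint b'_def t_def)
  have k: "0 \<le> kap l b" "0 \<le> kap (1 / l) b'"
    using l l' by simp_all
  have adj: "Wop \<zeta> (1 / l) b' \<in> A"
  proof -
    have "is_adjoint_op (Wop \<zeta> l b) (scaleC_op (1 / of_real l) o\<^sub>L Wop \<zeta> (1 / l) b')"
      using Wop_adjoint[OF \<zeta> l(1) k(1)] by (simp add: is_adjoint_op_def b'_def)
    then have "scaleC_op (of_real l) o\<^sub>L (scaleC_op (1 / of_real l) o\<^sub>L Wop \<zeta> (1 / l) b') \<in> A"
      using cstar_closed_ops(2,4)[OF A] l(3) by blast
    moreover have "scaleC_op (of_real l) o\<^sub>L (scaleC_op (1 / of_real l) o\<^sub>L Wop \<zeta> (1 / l) b') = Wop \<zeta> (1 / l) b'"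
      using l(1) by (intro blinfun_eqI) simp
    ultimately show ?thesis by simp
  qed
  have E: "Wop \<zeta> 1 (of_real t) \<in> A"
  proof -
    have "of_real (1 / l) * b + b' = of_real t"
      using l(1) complex_add_cnj[of b] by (simp add: b'_def t_def kap_def field_simps)
    then have "Wop \<zeta> l b o\<^sub>L Wop \<zeta> (1 / l) b' = Wop \<zeta> 1 (of_real t)"
      using Wop_compose[OF \<zeta> l(1) k(1) l'(1) k(2)] l(1) by simp
    then show ?thesis
      using cstar_closed_ops(3)[OF A l(3) adj] by simp
  qed
  have pow: "\<exists>c. 0 < kap (q ^ n) c \<and> Wop \<zeta> (q ^ n) c \<in> A"
    if q: "0 < q" "0 < kap q d" "Wop \<zeta> q d \<in> A" for q d n
  proof (induction n)
    case 0
    show ?case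
      using E l'(3) by (intro exI[of _ "of_real t"]) simp
  next
    case (Suc n)
    then obtain c where c: "0 < kap (q ^ n) c" "Wop \<zeta> (q ^ n) c \<in> A"
      by blast
    have "Wop \<zeta> (q ^ n) c o\<^sub>L Wop \<zeta> q d = Wop \<zeta> (q ^ n * q) (of_real q * c + d)"
      using q c by (intro Wop_compose \<zeta>) auto
    moreover have "0 < kap (q ^ n * q) (of_real q * c + d)"
      unfolding kap_compose using q c by (intro add_pos_pos mult_pos_pos)
    ultimately show ?case
      using cstar_closed_ops(3)[OF A c(2) q(3)]
      by (intro exI[of _ "of_real q * c + d"]) (simp add: mult.commute)
  qed
  have "\<exists>c. 0 < kap (l powi n) c \<and> Wop \<zeta> (l powi n) c \<in> A"
    using pow[OF l, of "nat n"] pow[OF l'(1,2) adj, of "nat (- n)"]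
    by (simp add: power_int_def inverse_eq_divide split: if_splits)
  then obtain c\<^sub>0 where c0: "0 < kap (l powi n) c\<^sub>0" "Wop \<zeta> (l powi n) c\<^sub>0 \<in> A"
    by blast
  have "0 < l powi n"
    using l(1) by simp
  from Wop_mem_if_one[OF A \<zeta> this less_imp_le[OF c0(1)] c0(2) l'(3) E c] show ?thesis .
qed

lemma composition_op_mem_iff_Wop_mem:
  assumes A: "unital_cstar_subalgebra A" "compact_ops \<subseteq> A" and \<zeta>: "cmod \<zeta> = 1"
    and l: "0 < l" "0 < kap l b" and \<phi>: "\<And>z. z \<in> \<D> \<Longrightarrow> \<phi> z = lft \<zeta> l b z"
  shows "composition_op \<phi> \<in> A \<longleftrightarrow> Wop \<zeta> l b \<in> A"
proof -
  let ?W = "Wop \<zeta> l b" and ?K = "scaleC_op b o\<^sub>L (gap_op \<zeta> o\<^sub>L Wop \<zeta> l b)"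
  have C: "composition_op \<phi> = (scaleC_op (of_real l) o\<^sub>L ?W) + ?K"
    using composition_op_eq_Wop[OF \<zeta> l(1) _ \<phi>] l(2) by simp
  have K: "?K \<in> A"
    using compact_gap_Wop[OF \<zeta> l] A(2) by (intro cstar_closed_ops(2)[OF A(1)]) auto
  show ?thesis
  proof
    assume "composition_op \<phi> \<in> A"
    then have "scaleC_op (1 / of_real l) o\<^sub>L (composition_op \<phi> - ?K) \<in> A"
      by (intro cstar_closed_ops(2)[OF A(1)] cstar_diff[OF A(1)] K)
    moreover have "scaleC_op (1 / of_real l) o\<^sub>L (composition_op \<phi> - ?K) = ?W"
      using l(1) unfolding C by (intro blinfun_eqI) simp
    ultimately show "?W \<in> A" by simp
  next
    assume "?W \<in> A"
    then show "composition_op \<phi> \<in> A"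
      unfolding C by (intro cstar_closed_ops(1,2)[OF A(1)] K)
  qed
qed

section \<open>Normal form of linear-fractional self-maps\<close>

text \<open>The inverse coordinate change: \<open>1 - 1 / w\<close> is \<open>cnj \<zeta>\<close> times the point with half-plane
  coordinate \<open>w\<close>.\<close>

lemma norm_one_minus_inverse:
  assumes "w \<noteq> 0"
  shows "cmod (1 - 1 / w) < 1 \<longleftrightarrow> 1 / 2 < Re w"
proof -
  have "1 - 1 / w = (w - 1) / w"
    using assms by (simp add: diff_divide_distrib)
  then have "cmod (1 - 1 / w) < 1 \<longleftrightarrow> cmod (w - 1) < cmod w"
    using assms by (simp add: norm_divide)
  also have "\<dots> \<longleftrightarrow> (cmod (w - 1))\<^sup>2 < (cmod w)\<^sup>2"
    by (auto intro: power_strict_mono dest: power2_less_imp_less)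
  also have "\<dots> \<longleftrightarrow> 1 / 2 < Re w"
    unfolding cmod_power2 by (simp add: power2_eq_square algebra_simps)
  finally show ?thesis .
qed

text \<open>Each conclusion is forced by points of the half-plane on a vertical line, far to the right,
  and close to the boundary, respectively.\<close>

lemma half_plane_affine_self_map:
  fixes L b :: complex
  assumes "\<And>w. 1 / 2 < Re w \<Longrightarrow> 1 / 2 < Re (L * w + b)"
  shows "Im L = 0" "0 \<le> Re L" "0 \<le> Re L + 2 * Re b - 1"
proof -
  have *: "1 / 2 < Re L * x - Im L * y + Re b" if "1 / 2 < x" for x y
    using assms[of "Complex x y"] that by simp
  show Im: "Im L = 0"
  proof (rule ccontr)
    assume "Im L \<noteq> 0"
    then show False
      using *[of 1 "(Re L + Re b) / Im L"] by simp
  qed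
  have x: "1 / 2 < Re L * x + Re b" if "1 / 2 < x" for x
    using *[of x 0] that Im by simp
  show L: "0 \<le> Re L"
  proof (rule ccontr)
    assume neg: "\<not> 0 \<le> Re L"
    have "Re L * max 1 ((1 / 2 - Re b) / Re L) \<le> Re L * ((1 / 2 - Re b) / Re L)"
      using neg by (intro mult_left_mono_neg) auto
    moreover have "1 / 2 < max 1 ((1 / 2 - Re b) / Re L)"
      by (simp add: less_max_iff_disj)
    ultimately show False
      using x[of "max 1 ((1 / 2 - Re b) / Re L)"] neg by simp
  qed
  show "0 \<le> Re L + 2 * Re b - 1"
  proof (rule ccontr)
    assume neg: "\<not> 0 \<le> Re L + 2 * Re b - 1"
    \<comment> \<open>minus one half of the quantity in question; the point \<open>1 / 2 + d / (Re L + 1)\<close> is too close to the boundary line\<close>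
    define d where "d = (1 - Re L - 2 * Re b) / 2"
    have d: "0 < d"
      using neg by (simp add: d_def)
    have "Re L * (d / (Re L + 1)) \<le> d"
      using L d by (simp add: field_simps)
    moreover have "1 / 2 < Re L * (1 / 2 + d / (Re L + 1)) + Re b"
      using L d by (intro x) (simp add: add_nonneg_pos)
    ultimately show False
      by (simp add: d_def algebra_simps)
  qed
qed

text \<open>The rotated map \<open>cnj \<xi> \<phi>\<close> sends \<open>\<eta>\<close> to 1, so in the half-plane coordinates of \<open>\<eta>\<close> and \<open>1\<close> it
  fixes infinity. It is then an affine self-map of the half-plane, and the preceding lemma
  restricts its coefficients.\<close>

lemma linear_fractional_normal_form:
  assumes \<phi>: "linear_fractional_self_map \<phi>" and "cmod \<eta> = 1" "cmod \<xi> = 1" "\<phi> \<eta> = \<xi>"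
  shows "\<exists>l b. 0 < l \<and> 0 \<le> kap l b \<and>
    (\<forall>z. of_real l + b * gap \<eta> z \<noteq> 0 \<longrightarrow> \<phi> z = \<xi> * cnj \<eta> * lft \<eta> l b z)"
proof -
  obtain a b\<^sub>0 c d where form: "\<And>z. \<phi> z = (a * z + b\<^sub>0) / (c * z + d)"
    and nz: "\<And>z. z \<in> \<D> \<Longrightarrow> c * z + d \<noteq> 0"
    and self: "\<And>z. z \<in> \<D> \<Longrightarrow> cmod (\<phi> z) < 1"
    using \<phi> unfolding linear_fractional_self_map_def by (auto simp: image_subset_iff)
  have unit: "\<eta> * cnj \<eta> = 1" "cnj \<eta> * \<eta> = 1" "\<xi> * cnj \<xi> = 1" "cnj \<xi> * \<xi> = 1"
    using assms by (simp_all add: complex_norm_square [symmetric] mult.commute)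
  have nonzero: "\<eta> \<noteq> 0" "\<xi> \<noteq> 0"
    using assms by auto
  define D where "D = c * \<eta> + d"
  have quot: "\<xi> = (a * \<eta> + b\<^sub>0) / D"
    using form[of \<eta>] assms(4) by (simp add: D_def)
  then have D: "D \<noteq> 0"
    using nonzero by auto
  then have num: "a * \<eta> + b\<^sub>0 = \<xi> * D"
    using quot by simp
  \<comment> \<open>the numerator is \<open>\<xi>\<close> times the denominator minus \<open>e\<close> times the gap; \<open>e = 0\<close> would make the map constant\<close>
  define e where "e = a * \<eta> - c * \<eta> * \<xi>"
  have z: "z = \<eta> * (1 - gap \<eta> z)" for z
    using unit by (simp add: gap_def mult.assoc[symmetric])
  have den: "c * z + d = D - c * \<eta> * gap \<eta> z" for z
    by (subst z) (simp add: D_def algebra_simps)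
  have numz: "a * z + b\<^sub>0 = \<xi> * D - a * \<eta> * gap \<eta> z" for z
  proof -
    have "a * z = a * \<eta> - a * \<eta> * gap \<eta> z"
      using arg_cong[OF z[of z], of "\<lambda>x. a * x"] by (simp only: right_diff_distrib mult.assoc mult_1_right)
    then show ?thesis
      by (simp flip: num)
  qed
  have num': "a * z + b\<^sub>0 = \<xi> * (c * z + d) - e * gap \<eta> z" for z
    unfolding den numz by (simp add: e_def algebra_simps)
  have val: "\<phi> z = \<xi> - e * gap \<eta> z / (c * z + d)" if "c * z + d \<noteq> 0" for z
    unfolding form num' using that by (simp add: diff_divide_distrib)
  have e: "e \<noteq> 0"
  proof
    assume "e = 0"
    then have "\<phi> 0 = \<xi>"
      using val[of 0] nz[of 0] by simp
    then show False
      using self[of 0] assms(3) by simp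
  qed
  define L where "L = D * \<xi> / e"
  define b where "b = - (c * \<eta> * \<xi> / e)"
  have L0: "L \<noteq> 0"
    using D e nonzero by (simp add: L_def)
  have Lb: "L + b * gap \<eta> z = (c * z + d) * \<xi> / e" for z
    unfolding den L_def b_def by (simp add: algebra_simps diff_divide_distrib)
  have val': "\<phi> z = \<xi> * (1 - gap \<eta> z / (L + b * gap \<eta> z))" if "L + b * gap \<eta> z \<noteq> 0" for z
  proof -
    have "c * z + d \<noteq> 0"
      using that unfolding Lb by auto
    moreover have "\<xi> - e * p / N = \<xi> * (1 - p / (N * \<xi> / e))" if "N \<noteq> 0" for p N
      using that nonzero e by (simp add: right_diff_distrib)
    ultimately show ?thesis
      unfolding Lb val[OF \<open>c * z + d \<noteq> 0\<close>] by blast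
  qed
  have hp: "1 / 2 < Re (L * w + b)" if w: "1 / 2 < Re w" for w
  proof -
    have w0: "w \<noteq> 0"
      using w by auto
    define z where "z = \<eta> * (1 - 1 / w)"
    have zD: "z \<in> \<D>"
      using norm_one_minus_inverse[OF w0] w assms(2) by (simp add: z_def norm_mult)
    have p: "gap \<eta> z = 1 / w"
      unfolding z_def gap_def using unit by (simp add: mult.assoc[symmetric])
    have nz': "L + b * gap \<eta> z \<noteq> 0"
      unfolding Lb using nz[OF zD] e nonzero by simp
    have v: "L + b * gap \<eta> z = (L * w + b) / w"
      using w0 by (simp add: p add_divide_distrib)
    have v0: "L * w + b \<noteq> 0"
      using nz' unfolding v by auto
    have "\<phi> z = \<xi> * (1 - 1 / (L * w + b))"
      using val'[OF nz'] unfolding v by (simp add: p w0)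
    then have "cmod (1 - 1 / (L * w + b)) < 1"
      using self[OF zD] assms(3) by (simp add: norm_mult)
    then show ?thesis
      using norm_one_minus_inverse[OF v0] by simp
  qed
  note half_plane = half_plane_affine_self_map[OF hp]
  have L: "L = of_real (Re L)"
    using half_plane(1) by (simp add: complex_eq_iff)
  have "Re L \<noteq> 0"
    using L0 L by (metis of_real_0)
  then have "0 < Re L"
    using half_plane(2) by simp
  moreover have "0 \<le> kap (Re L) b"
    using half_plane(3) by (simp add: kap_def)
  moreover have "\<phi> z = \<xi> * cnj \<eta> * lft \<eta> (Re L) b z" if "of_real (Re L) + b * gap \<eta> z \<noteq> 0" for z
  proof -
    have "\<xi> * cnj \<eta> * lft \<eta> (Re L) b z = \<xi> * (cnj \<eta> * \<eta>) * (1 - gap \<eta> z / (of_real (Re L) + b * gap \<eta> z))"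
      by (simp add: lft_def lfw_def mult_ac)
    also have "\<dots> = \<phi> z"
      using val'[of z] that unfolding L[symmetric] unit by simp
    finally show ?thesis ..
  qed
  ultimately show ?thesis by blast
qed

text \<open>The supremum is attained on the closed disk once the map has no pole there. On the closed
  disk the numerator is bounded by the denominator, so at a pole both vanish and the map is
  constant on the disk, with modulus less than one, contrary to the supremum.\<close>

lemma boundary_contact:
  assumes \<psi>: "linear_fractional_self_map \<psi>" and sup: "disk_sup_norm \<psi> = 1"
  shows "\<exists>\<eta>. cmod \<eta> = 1 \<and> cmod (\<psi> \<eta>) = 1"
proof -
  obtain a b c d where form: "\<And>z. \<psi> z = (a * z + b) / (c * z + d)"
    and nz: "\<And>z. z \<in> \<D> \<Longrightarrow> c * z + d \<noteq> 0" and self: "\<And>z. z \<in> \<D> \<Longrightarrow> cmod (\<psi> z) < 1"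
    using \<psi> unfolding linear_fractional_self_map_def by (auto simp: image_subset_iff)
  have le: "cmod (a * z + b) \<le> cmod (c * z + d)" if "cmod z \<le> 1" for z
  proof -
    have "closed {z. cmod (a * z + b) \<le> cmod (c * z + d)}"
      by (intro closed_Collect_le continuous_intros)
    moreover have "\<D> \<subseteq> {z. cmod (a * z + b) \<le> cmod (c * z + d)}"
      using self nz by (fastforce simp: form norm_divide divide_less_eq_1)
    ultimately have "closure \<D> \<subseteq> {z. cmod (a * z + b) \<le> cmod (c * z + d)}"
      by (rule closure_minimal[rotated])
    then show ?thesis
      using that by (auto simp: subset_iff)
  qed
  have no_pole: "c * z + d \<noteq> 0" if z: "cmod z \<le> 1" for z
  proof
    assume pole: "c * z + d = 0"
    then have "a * z + b = 0"
      using le[OF z] by simp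
    with pole have ab: "b = - (a * z)" "d = - (c * z)"
      by (simp_all add: eq_neg_iff_add_eq_0 add.commute)
    have c: "c \<noteq> 0"
      using nz[of 0] ab by auto
    have const: "\<psi> u = a / c" if "u \<in> \<D>" for u
    proof -
      have "\<psi> u = (a * (u - z)) / (c * (u - z))"
        unfolding form ab by (simp add: algebra_simps)
      moreover have "u - z \<noteq> 0"
        using nz[OF that] pole by auto
      ultimately show ?thesis by simp
    qed
    have "(\<lambda>z. cmod (\<psi> z)) ` \<D> = {cmod (a / c)}"
      using const by (auto intro!: image_eqI[of _ _ 0])
    then have "disk_sup_norm \<psi> = cmod (a / c)"
      unfolding disk_sup_norm_def by simp
    then show False
      using self[of 0] const[of 0] sup by simp
  qed
  have cont: "continuous_on (cball 0 1) (\<lambda>z. cmod (\<psi> z))"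
    unfolding form by (intro continuous_intros) (use no_pole in auto)
  obtain \<eta> where \<eta>: "\<eta> \<in> cball 0 1" "\<And>z. z \<in> cball 0 1 \<Longrightarrow> cmod (\<psi> z) \<le> cmod (\<psi> \<eta>)"
    using continuous_attains_sup[OF _ _ cont] by (metis cball_eq_empty compact_cball not_one_less_zero)
  have "disk_sup_norm \<psi> \<le> cmod (\<psi> \<eta>)"
    unfolding disk_sup_norm_def by (rule cSUP_least) (use \<eta>(2) in auto)
  moreover have "cmod (\<psi> \<eta>) \<le> 1"
    using le[of \<eta>] no_pole[of \<eta>] \<eta>(1) by (simp add: form norm_divide divide_le_eq_1)
  ultimately have "cmod (\<psi> \<eta>) = 1"
    using sup by simp
  moreover have "cmod \<eta> = 1"
    using self[of \<eta>] \<eta>(1) calculation by (cases "cmod \<eta> < 1") auto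
  ultimately show ?thesis by blast
qed

lemma deriv_lft:
  assumes "cmod \<zeta> = 1" "0 < l"
    and \<phi>: "\<And>z. of_real l + b * gap \<zeta> z \<noteq> 0 \<Longrightarrow> \<phi> z = lft \<zeta> l b z"
  shows "deriv \<phi> \<zeta> = 1 / of_real l"
proof -
  have unit: "\<zeta> * cnj \<zeta> = 1"
    using assms by (simp add: complex_norm_square [symmetric])
  then have g: "gap \<zeta> \<zeta> = 0"
    by (simp add: gap_def mult.commute)
  have "isCont (\<lambda>z. of_real l + b * gap \<zeta> z) \<zeta>"
    unfolding gap_def by (intro continuous_intros)
  moreover have "of_real l + b * gap \<zeta> \<zeta> \<noteq> 0"
    using assms(2) by (simp add: g)
  ultimately have "\<forall>\<^sub>F z in nhds \<zeta>. of_real l + b * gap \<zeta> z \<noteq> 0"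
    by (simp add: isCont_def tendsto_imp_eventually_ne continuous_at_imp_continuous_at_within eventually_nhds_conv_at)
  then have ev: "\<forall>\<^sub>F z in nhds \<zeta>. \<phi> z = lft \<zeta> l b z"
    by eventually_elim (rule \<phi>)
  have dg: "(gap \<zeta> has_field_derivative - cnj \<zeta>) (at \<zeta>)"
    unfolding gap_def[abs_def] by (auto intro!: derivative_eq_intros)
  let ?d = "of_real l + b * gap \<zeta> \<zeta>"
  have "((\<lambda>z. \<zeta> * (1 - gap \<zeta> z / (of_real l + b * gap \<zeta> z))) has_field_derivative
    \<zeta> * (0 - (- cnj \<zeta> * ?d - gap \<zeta> \<zeta> * (0 + b * - cnj \<zeta>)) / (?d * ?d))) (at \<zeta>)"
    using \<open>?d \<noteq> 0\<close> by (intro DERIV_cmult DERIV_diff DERIV_const DERIV_divide DERIV_add dg)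
  moreover have "\<zeta> * (0 - (- cnj \<zeta> * ?d - gap \<zeta> \<zeta> * (0 + b * - cnj \<zeta>)) / (?d * ?d)) = 1 / of_real l"
    using unit assms(2) by (simp add: g)
  moreover have "lft \<zeta> l b = (\<lambda>z. \<zeta> * (1 - gap \<zeta> z / (of_real l + b * gap \<zeta> z)))"
    by (simp add: fun_eq_iff lft_def lfw_def)
  ultimately have "(lft \<zeta> l b has_field_derivative 1 / of_real l) (at \<zeta>)"
    by simp
  then show ?thesis
    using deriv_cong_ev[OF ev refl] DERIV_imp_deriv by simp
qed

lemma Re_inverse_gap:
  assumes "cmod \<zeta> = 1" "u \<in> \<D>"
  shows "1 / 2 < Re (1 / gap \<zeta> u)"
proof -
  have "gap \<zeta> u \<noteq> 0"
    using gap_zero_iff[OF assms(1)] assms by auto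
  moreover have "\<zeta> * (1 - gap \<zeta> u) = u"
    using lft_one_zero[OF assms(1), of u] by (simp add: lft_def lfw_def)
  then have "cmod (1 - gap \<zeta> u) < 1"
    using assms by (metis mem_ball_0 mult_1 norm_mult)
  ultimately show ?thesis
    using norm_one_minus_inverse[of "1 / gap \<zeta> u"] by simp
qed

text \<open>The image of the disk corresponds to the half-plane \<open>Re w > 1/2 + kap l b / 2\<close>. If \<open>kap l b\<close>
  vanishes, the inverse affine map is of the same form.\<close>

lemma disk_automorphism_iff_kap_zero:
  assumes \<psi>: "linear_fractional_self_map \<psi>" and "cmod \<eta> = 1" "cmod \<rho> = 1" "0 < l" "0 \<le> kap l b"
    and form: "\<And>z. z \<in> \<D> \<Longrightarrow> \<psi> z = \<rho> * lft \<eta> l b z"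
  shows "disk_automorphism \<psi> \<longleftrightarrow> kap l b = 0"
proof
  assume aut: "disk_automorphism \<psi>"
  show "kap l b = 0"
  proof (rule ccontr)
    assume "kap l b \<noteq> 0"
    then have k: "0 < kap l b"
      using assms by simp
    \<comment> \<open>a point of the half-plane outside the image\<close>
    define v where "v = complex_of_real (1 / 2 + kap l b / 4)"
    have v1: "Re v = 1 / 2 + kap l b / 4"
      by (simp only: v_def Re_complex_of_real)
    then have "v \<noteq> 0"
      using k by (auto simp del: div_add)
    note v = v1 this
    then have "cmod (1 - 1 / v) < 1"
      using norm_one_minus_inverse[of v] k by simp
    then have "\<rho> * (\<eta> * (1 - 1 / v)) \<in> \<D>"
      using assms by (simp add: norm_mult)
    then obtain u where u: "u \<in> \<D>" "\<psi> u = \<rho> * (\<eta> * (1 - 1 / v))"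
      using aut unfolding disk_automorphism_def bij_betw_def by (metis imageE)
    have "\<rho> \<noteq> 0" "\<eta> \<noteq> 0"
      using assms by auto
    then have "gap \<eta> u * lfw \<eta> l b u = 1 / v"
      using u(2) form[OF u(1)] by (simp add: lft_def)
    moreover have p: "gap \<eta> u \<noteq> 0"
      using gap_zero_iff[OF assms(2)] assms(2) u(1) by auto
    ultimately have "v = (of_real l + b * gap \<eta> u) / gap \<eta> u"
      using v(2) by (simp add: lfw_def field_simps)
    then have "v = of_real l * (1 / gap \<eta> u) + b"
      using p by (simp add: add_divide_distrib)
    moreover define w where "w = 1 / gap \<eta> u"
    ultimately have "v = of_real l * w + b"
      by simp
    then have "Re v = l * Re w + Re b"
      by simp
    moreover have "l * (1 / 2) < l * Re w"
      unfolding w_def by (intro mult_strict_left_mono Re_inverse_gap assms u)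
    ultimately have "l * (1 / 2) + Re b < Re v"
      by linarith
    moreover have "l * (1 / 2) + Re b = 1 / 2 + kap l b / 2"
      by (simp add: kap_def field_simps)
    ultimately show False
      using v(1) k by linarith
  qed
next
  assume k: "kap l b = 0"
  have k': "kap (1 / l) (- b / of_real l) = 0"
    using k assms(4) by (simp add: kap_def field_simps)
  have unit: "cnj \<rho> * \<rho> = 1" "\<rho> * cnj \<rho> = 1"
    using assms by (simp_all add: complex_norm_square [symmetric] mult.commute)
  have D: "lft \<eta> l b z \<in> \<D>" "lft \<eta> (1 / l) (- b / of_real l) z \<in> \<D>" if "z \<in> \<D>" for z
    using lft_in_disk[OF assms(2) that, of l b] lft_in_disk[OF assms(2) that, of "1 / l" "- b / of_real l"]
      assms(4,5) k' by (simp_all del: mem_ball)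
  have inv: "lft \<eta> (1 / l) (- b / of_real l) (lft \<eta> l b z) = z"
    "lft \<eta> l b (lft \<eta> (1 / l) (- b / of_real l) z) = z" if "z \<in> \<D>" for z
    using lft_compose[OF assms(2), of l b z "1 / l" "- b / of_real l"]
      lft_compose[OF assms(2), of "1 / l" "- b / of_real l" z l b] that assms(4) k k'
    by (simp_all add: lft_one_zero[OF assms(2)])
  have "bij_betw \<psi> \<D> \<D>"
  proof (rule bij_betw_byWitness[where f' = "\<lambda>y. lft \<eta> (1 / l) (- b / of_real l) (cnj \<rho> * y)"])
    show "\<forall>z\<in>\<D>. lft \<eta> (1 / l) (- b / of_real l) (cnj \<rho> * \<psi> z) = z"
      using inv(1) by (simp add: form mult.assoc[symmetric] unit)
    have rot: "cnj \<rho> * y \<in> \<D>" if "y \<in> \<D>" for y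
      using that assms(3) by (simp add: norm_mult)
    show "\<forall>y\<in>\<D>. \<psi> (lft \<eta> (1 / l) (- b / of_real l) (cnj \<rho> * y)) = y"
      using form[OF D(2)[OF rot]] inv(2)[OF rot] by (simp add: mult.assoc[symmetric] unit)
    show "\<psi> ` \<D> \<subseteq> \<D>"
      using \<psi> by (simp add: linear_fractional_self_map_def)
    show "(\<lambda>y. lft \<eta> (1 / l) (- b / of_real l) (cnj \<rho> * y)) ` \<D> \<subseteq> \<D>"
      using D(2)[OF rot] by auto
  qed
  then show "disk_automorphism \<psi>"
    using \<psi> by (simp add: disk_automorphism_def)
qed

section \<open>Asymptotic eigenvectors\<close>

lemma hardy_cinner_monomial: "hardy_cinner (hardy_monomial n) f = cnj (hardy_coeff f n)"
proof -
  have "hardy_cinner (hardy_monomial n) f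
      = (\<Sum>k\<in>{n}. hardy_coeff (hardy_monomial n) k * cnj (hardy_coeff f k))"
    unfolding hardy_cinner_def by (rule suminf_finite) auto
  then show ?thesis by simp
qed

text \<open>The coefficients of the representing vector are the conjugates of the values on monomials;
  testing the functional on the vector with the first \<open>N\<close> of them bounds their sum of squares.\<close>

lemma hardy_Riesz:
  fixes L :: "hardy \<Rightarrow> complex"
  assumes L: "bounded_linear L" and scale: "\<And>c f. L (c *\<^sub>C f) = c * L f"
  shows "\<exists>y. \<forall>f. L f = hardy_cinner f y"
proof -
  interpret L: bounded_linear L by (rule L)
  obtain K where K: "0 < K" "\<And>f. cmod (L f) \<le> norm f * K"
    using L.pos_bounded by blast
  let ?a = "\<lambda>n. cnj (L (hardy_monomial n))"
  have partial: "(\<Sum>n<N. (cmod (?a n))\<^sup>2) \<le> K\<^sup>2" for N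
  proof -
    define s where "s = (\<Sum>n<N. (cmod (?a n))\<^sup>2)"
    define v where "v = (\<Sum>n<N. ?a n *\<^sub>C hardy_monomial n)"
    have s0: "0 \<le> s"
      unfolding s_def by (intro sum_nonneg) auto
    have coeff: "hardy_coeff v k = (if k < N then ?a k else 0)" for k
      by (simp add: v_def if_distrib sum.delta' cong: if_cong)
    have "(norm v)\<^sup>2 = (\<Sum>k<N. (cmod (hardy_coeff v k))\<^sup>2)"
      unfolding norm_hardy_sq by (rule suminf_finite) (auto simp: coeff)
    then have v: "(norm v)\<^sup>2 = s"
      by (simp add: coeff s_def)
    have "L v = (\<Sum>n<N. ?a n * L (hardy_monomial n))"
      by (simp add: v_def L.sum scale)
    also have "\<dots> = of_real s"
      unfolding s_def of_real_sum
      by (intro sum.cong refl) (simp only: complex_norm_square complex_cnj_cnj)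
    finally have "s \<le> norm v * K"
      using K(2)[of v] s0 by simp
    then have "s\<^sup>2 \<le> s * K\<^sup>2"
      using power_mono[OF _ s0, of "norm v * K" 2] by (simp add: power_mult_distrib v)
    then show ?thesis
      unfolding s_def[symmetric] using s0 by (cases "s = 0") (simp_all add: power2_eq_square)
  qed
  have "summable (\<lambda>n. (cmod (?a n))\<^sup>2)"
    by (rule bounded_imp_summable[of _ "K\<^sup>2"]) (use partial[of "Suc _"] in \<open>auto simp: lessThan_Suc_atMost\<close>)
  from hardy_with_coeffs[OF this] obtain y where y: "\<And>n. hardy_coeff y n = ?a n"
    by blast
  have "f \<in> {f. L f = hardy_cinner f y}" for f
  proof (rule hardy_monomials_dense)
    show "closed {f. L f = hardy_cinner f y}"
      by (intro closed_Collect_eq linear_continuous_on L hardy_cinner.bounded_linear_left)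
  qed (auto simp: L.add L.zero scale hardy_cinner_add_left hardy_cinner.zero_left hardy_cinner_monomial y)
  then show ?thesis by blast
qed

definition weakly_null :: "(nat \<Rightarrow> hardy) \<Rightarrow> bool"
  where "weakly_null g \<longleftrightarrow> (\<forall>f. (\<lambda>n. hardy_cinner f (g n)) \<longlonglongrightarrow> 0)"

lemma weakly_null_if_coeffs:
  assumes unit: "\<And>n. norm (g n) = 1" and coeff: "\<And>k. (\<lambda>n. hardy_coeff (g n) k) \<longlonglongrightarrow> 0"
  shows "weakly_null g"
  unfolding weakly_null_def
proof
  let ?S = "{f. (\<lambda>n. hardy_cinner f (g n)) \<longlonglongrightarrow> 0}"
  fix f
  have "f \<in> ?S"
  proof (rule hardy_monomials_dense)
    show "closed ?S"
      unfolding closed_sequential_limits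
    proof (intro allI impI, elim conjE)
      fix X f assume X: "\<forall>n. X n \<in> ?S" "X \<longlonglongrightarrow> f"
      have "(\<lambda>n. hardy_cinner f (g n)) \<longlonglongrightarrow> 0"
      proof (rule LIMSEQ_I)
        fix e :: real assume e: "0 < e"
        obtain m where m: "norm (X m - f) < e / 2"
          using LIMSEQ_D[OF X(2), of "e / 2"] e by auto
        have "(\<lambda>n. hardy_cinner (X m) (g n)) \<longlonglongrightarrow> 0"
          using X(1) by simp
        from LIMSEQ_D[OF this, of "e / 2"] e obtain N
          where N: "\<And>n. n \<ge> N \<Longrightarrow> cmod (hardy_cinner (X m) (g n)) < e / 2"
          by auto
        have "cmod (hardy_cinner f (g n)) < e" if "n \<ge> N" for n
        proof -
          have "hardy_cinner f (g n) = hardy_cinner (X m) (g n) - hardy_cinner (X m - f) (g n)"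
            by (simp add: hardy_cinner.diff_left)
          then have "cmod (hardy_cinner f (g n))
              \<le> cmod (hardy_cinner (X m) (g n)) + cmod (hardy_cinner (X m - f) (g n))"
            by (simp add: norm_triangle_ineq4)
          moreover have "cmod (hardy_cinner (X m - f) (g n)) \<le> norm (X m - f)"
            using hardy_cinner_Cauchy_Schwarz[of "X m - f" "g n"] unit by simp
          ultimately show ?thesis
            using N[OF that] m by linarith
        qed
        then show "\<exists>N. \<forall>n\<ge>N. norm (hardy_cinner f (g n) - 0) < e"
          by auto
      qed
      then show "f \<in> ?S" by simp
    qed
    show "hardy_monomial k \<in> ?S" for k
      using tendsto_cnj[OF coeff[of k]] by (simp add: hardy_cinner_monomial)
  qed (auto simp: hardy_cinner.zero_left hardy_cinner_add_left intro!: tendsto_eq_intros)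
  then show "(\<lambda>n. hardy_cinner f (g n)) \<longlonglongrightarrow> 0"
    by simp
qed

text \<open>If \<open>T\<close> has an adjoint \<open>S\<close>, the second condition says \<open>norm (S (g n) - cnj c *\<^sub>C g n) \<le> e\<close>.
  Stated with the inner product it makes sense without an adjoint and passes to limits of
  operators. It makes the operators with an asymptotic eigenvalue closed under adjoints.\<close>

definition asymp_eigen :: "(nat \<Rightarrow> hardy) \<Rightarrow> (hardy \<Rightarrow>\<^sub>L hardy) \<Rightarrow> complex \<Rightarrow> bool"
  where "asymp_eigen g T c \<longleftrightarrow> (\<forall>e>0. \<forall>\<^sub>F n in sequentially.
    norm (T (g n) - c *\<^sub>C g n) \<le> e \<and> (\<forall>f. cmod (hardy_cinner (T f - c *\<^sub>C f) (g n)) \<le> e * norm f))"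

text \<open>The eigenvalue is the same for all sequences in \<open>J\<close>; it is a character of this algebra.\<close>

definition character_algebra :: "(nat \<Rightarrow> hardy) set \<Rightarrow> (hardy \<Rightarrow>\<^sub>L hardy) set"
  where "character_algebra J = {T. clinear_op T \<and> (\<exists>c. \<forall>g\<in>J. asymp_eigen g T c)}"

lemma asymp_eigenI:
  fixes T :: "hardy \<Rightarrow>\<^sub>L hardy"
  assumes "(\<lambda>n. norm (T (g n) - c *\<^sub>C g n)) \<longlonglongrightarrow> 0" "\<epsilon> \<longlonglongrightarrow> 0"
    and "\<And>n f. cmod (hardy_cinner (T f - c *\<^sub>C f) (g n)) \<le> \<epsilon> n * norm f"
  shows "asymp_eigen g T c"
  unfolding asymp_eigen_def
proof (intro allI impI)
  fix e :: real assume e: "0 < e"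
  have "\<forall>\<^sub>F n in sequentially. norm (T (g n) - c *\<^sub>C g n) < e" "\<forall>\<^sub>F n in sequentially. \<epsilon> n < e"
    using order_tendstoD(2)[OF assms(1) e] order_tendstoD(2)[OF assms(2) e] by auto
  then show "\<forall>\<^sub>F n in sequentially. norm (T (g n) - c *\<^sub>C g n) \<le> e \<and>
      (\<forall>f. cmod (hardy_cinner (T f - c *\<^sub>C f) (g n)) \<le> e * norm f)"
  proof eventually_elim
    case (elim n)
    have "cmod (hardy_cinner (T f - c *\<^sub>C f) (g n)) \<le> e * norm f" for f
      using assms(3)[of f n] mult_right_mono[of "\<epsilon> n" e "norm f"] elim by simp
    with elim show ?case by simp
  qed
qed

lemma asymp_eigen_norm:
  assumes "asymp_eigen g T c"
  shows "(\<lambda>n. norm (T (g n) - c *\<^sub>C g n)) \<longlonglongrightarrow> 0"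
proof (rule LIMSEQ_I)
  fix e :: real assume "0 < e"
  then have "0 < e / 2" by simp
  from assms[unfolded asymp_eigen_def, rule_format, OF this]
  have "\<forall>\<^sub>F n in sequentially. norm (T (g n) - c *\<^sub>C g n) \<le> e / 2"
    by eventually_elim blast
  then obtain N where "\<And>n. n \<ge> N \<Longrightarrow> norm (T (g n) - c *\<^sub>C g n) \<le> e / 2"
    by (auto simp: eventually_sequentially)
  then show "\<exists>N. \<forall>n\<ge>N. norm (norm (T (g n) - c *\<^sub>C g n) - 0) < e"
    using \<open>0 < e\<close> by (intro exI[of _ N]) force
qed

lemma asymp_eigen_cinner:
  assumes "asymp_eigen g T c" "\<And>n. norm (f n) \<le> 1"
  shows "(\<lambda>n. hardy_cinner (T (f n) - c *\<^sub>C f n) (g n)) \<longlonglongrightarrow> 0"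
proof (rule LIMSEQ_I)
  fix e :: real assume e: "0 < e"
  then have "0 < e / 2" by simp
  from assms(1)[unfolded asymp_eigen_def, rule_format, OF this]
  have "\<forall>\<^sub>F n in sequentially. \<forall>f. cmod (hardy_cinner (T f - c *\<^sub>C f) (g n)) \<le> e / 2 * norm f"
    by eventually_elim blast
  then obtain N where N: "\<And>n f. n \<ge> N \<Longrightarrow> cmod (hardy_cinner (T f - c *\<^sub>C f) (g n)) \<le> e / 2 * norm f"
    by (auto simp: eventually_sequentially)
  have "cmod (hardy_cinner (T (f n) - c *\<^sub>C f n) (g n)) < e" if "n \<ge> N" for n
  proof -
    have "cmod (hardy_cinner (T (f n) - c *\<^sub>C f n) (g n)) \<le> e / 2 * norm (f n)"
      by (rule N) fact
    also have "\<dots> \<le> e / 2 * 1"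
      using e assms(2) by (intro mult_left_mono) auto
    finally show ?thesis
      using e by simp
  qed
  then show "\<exists>N. \<forall>n\<ge>N. norm (hardy_cinner (T (f n) - c *\<^sub>C f n) (g n) - 0) < e"
    by auto
qed

lemma asymp_eigen_id: "asymp_eigen g id_blinfun 1"
  by (rule asymp_eigenI[where \<epsilon> = "\<lambda>_. 0"]) (auto simp: hardy_cinner.zero_left)

lemma asymp_eigen_add:
  assumes "asymp_eigen g S c" "asymp_eigen g T d"
  shows "asymp_eigen g (S + T) (c + d)"
  unfolding asymp_eigen_def
proof (intro allI impI)
  fix e :: real assume "0 < e"
  then have e: "0 < e / 2" by simp
  from assms[unfolded asymp_eigen_def, rule_format, OF e]
  show "\<forall>\<^sub>F n in sequentially. norm ((S + T) (g n) - (c + d) *\<^sub>C g n) \<le> e \<and>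
      (\<forall>f. cmod (hardy_cinner ((S + T) f - (c + d) *\<^sub>C f) (g n)) \<le> e * norm f)"
  proof eventually_elim
    case (elim n)
    have split: "(S + T) f - (c + d) *\<^sub>C f = (S f - c *\<^sub>C f) + (T f - d *\<^sub>C f)" for f
      by (simp add: blinfun.add_left hardy_scaleC.add_left)
    have "norm ((S + T) (g n) - (c + d) *\<^sub>C g n) \<le> e"
      unfolding split using elim norm_triangle_ineq[of "S (g n) - c *\<^sub>C g n" "T (g n) - d *\<^sub>C g n"]
      by linarith
    moreover have "cmod (hardy_cinner ((S + T) f - (c + d) *\<^sub>C f) (g n)) \<le> e * norm f" for f
    proof -
      have "cmod (hardy_cinner ((S + T) f - (c + d) *\<^sub>C f) (g n)) \<le> e / 2 * norm f + e / 2 * norm f"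
        unfolding split hardy_cinner_add_left using elim
        by (intro order_trans[OF norm_triangle_ineq] add_mono) auto
      then show ?thesis by simp
    qed
    ultimately show ?case by blast
  qed
qed

lemma asymp_eigen_compose:
  assumes S: "clinear_op S" and "asymp_eigen g S c" "asymp_eigen g T d"
  shows "asymp_eigen g (S o\<^sub>L T) (c * d)"
  unfolding asymp_eigen_def
proof (intro allI impI)
  fix e :: real assume e: "0 < e"
  \<comment> \<open>one constant that dominates the factors in both conditions\<close>
  define M where "M = norm S + norm T + cmod c + cmod d + 1"
  have M: "0 < M" "norm S + cmod d \<le> M" "norm T + cmod c \<le> M"
    by (auto simp: M_def intro: add_nonneg_pos)
  have e': "0 < e / M"
    using e M by simp
  from assms(2,3)[unfolded asymp_eigen_def, rule_format, OF e']
  show "\<forall>\<^sub>F n in sequentially. norm ((S o\<^sub>L T) (g n) - (c * d) *\<^sub>C g n) \<le> e \<and>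
      (\<forall>f. cmod (hardy_cinner ((S o\<^sub>L T) f - (c * d) *\<^sub>C f) (g n)) \<le> e * norm f)"
  proof eventually_elim
    case (elim n)
    have "(S o\<^sub>L T) (g n) - (c * d) *\<^sub>C g n = S (T (g n) - d *\<^sub>C g n) + d *\<^sub>C (S (g n) - c *\<^sub>C g n)"
      by (simp add: blinfun.diff_right clinear_hardyD[OF S] hardy_scaleC.diff_right mult.commute)
    then have "norm ((S o\<^sub>L T) (g n) - (c * d) *\<^sub>C g n)
      \<le> norm (S (T (g n) - d *\<^sub>C g n)) + norm (d *\<^sub>C (S (g n) - c *\<^sub>C g n))"
      by (simp only: norm_triangle_ineq)
    also have "\<dots> \<le> norm S * (e / M) + cmod d * (e / M)"
    proof (intro add_mono)
      show "norm (S (T (g n) - d *\<^sub>C g n)) \<le> norm S * (e / M)"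
        using elim by (intro order_trans[OF norm_blinfun] mult_left_mono) auto
      show "norm (d *\<^sub>C (S (g n) - c *\<^sub>C g n)) \<le> cmod d * (e / M)"
        unfolding norm_hardy_scaleC using elim by (intro mult_left_mono) auto
    qed
    also have "\<dots> = (norm S + cmod d) * (e / M)"
      by (simp only: distrib_right)
    also have "\<dots> \<le> M * (e / M)"
      using M e' by (intro mult_right_mono) auto
    finally have 1: "norm ((S o\<^sub>L T) (g n) - (c * d) *\<^sub>C g n) \<le> e"
      using M by simp
    have 2: "cmod (hardy_cinner ((S o\<^sub>L T) f - (c * d) *\<^sub>C f) (g n)) \<le> e * norm f" for f
    proof -
      have "(S o\<^sub>L T) f - (c * d) *\<^sub>C f = (S (T f) - c *\<^sub>C T f) + c *\<^sub>C (T f - d *\<^sub>C f)"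
        by (simp add: hardy_scaleC.diff_right)
      then have "cmod (hardy_cinner ((S o\<^sub>L T) f - (c * d) *\<^sub>C f) (g n))
        = cmod (hardy_cinner (S (T f) - c *\<^sub>C T f) (g n) + c * hardy_cinner (T f - d *\<^sub>C f) (g n))"
        by (simp only: hardy_cinner_add_left hardy_cinner_scaleC_left)
      also have "\<dots> \<le> cmod (hardy_cinner (S (T f) - c *\<^sub>C T f) (g n))
          + cmod c * cmod (hardy_cinner (T f - d *\<^sub>C f) (g n))"
        by (metis norm_triangle_ineq norm_mult)
      also have "\<dots> \<le> e / M * (norm T * norm f) + cmod c * (e / M * norm f)"
      proof (intro add_mono mult_left_mono)
        have "cmod (hardy_cinner (S (T f) - c *\<^sub>C T f) (g n)) \<le> e / M * norm (T f)"
          using elim by blast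
        also have "\<dots> \<le> e / M * (norm T * norm f)"
          using e' by (intro mult_left_mono norm_blinfun) auto
        finally show "cmod (hardy_cinner (S (T f) - c *\<^sub>C T f) (g n)) \<le> e / M * (norm T * norm f)" .
        show "cmod (hardy_cinner (T f - d *\<^sub>C f) (g n)) \<le> e / M * norm f"
          using elim by blast
      qed simp
      also have "\<dots> = (norm T + cmod c) * (e / M * norm f)"
        by (simp add: algebra_simps add_divide_distrib)
      also have "\<dots> \<le> M * (e / M * norm f)"
        using M less_imp_le[OF e'] by (intro mult_right_mono mult_nonneg_nonneg) auto
      finally show ?thesis
        using M by simp
    qed
    from 1 2 show ?case by blast
  qed
qed

lemma asymp_eigen_scaleC: "asymp_eigen g (scaleC_op c) c"
  by (rule asymp_eigenI[where \<epsilon> = "\<lambda>_. 0"]) (auto simp: hardy_cinner.zero_left)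

lemma clinear_adjoint:
  assumes "is_adjoint_op T S"
  shows "clinear_op S"
  unfolding clinear_op_def
proof (intro allI)
  fix c f
  have "hardy_cinner h (S (c *\<^sub>C f) - c *\<^sub>C S f) = 0" for h
  proof -
    have "hardy_cinner h (S (c *\<^sub>C f)) = hardy_cinner (T h) (c *\<^sub>C f)"
      using assms unfolding is_adjoint_op_def by (simp only:)
    also have "\<dots> = cnj c * hardy_cinner (T h) f"
      by simp
    also have "\<dots> = cnj c * hardy_cinner h (S f)"
      using assms unfolding is_adjoint_op_def by simp
    finally show ?thesis
      by (simp add: hardy_cinner.diff_right)
  qed
  from this[of "S (c *\<^sub>C f) - c *\<^sub>C S f"] show "S (c *\<^sub>C f) = c *\<^sub>C S f"
    by (simp add: hardy_cinner_self)
qed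

lemma asymp_eigen_adjoint:
  assumes adj: "is_adjoint_op T S" and T: "asymp_eigen g T c"
  shows "asymp_eigen g S (cnj c)"
  unfolding asymp_eigen_def
proof (intro allI impI)
  fix e :: real assume e: "0 < e"
  have *: "hardy_cinner h (S k - cnj c *\<^sub>C k) = hardy_cinner (T h - c *\<^sub>C h) k" for h k
    using adj by (simp add: is_adjoint_op_def hardy_cinner.diff_left hardy_cinner.diff_right)
  from T[unfolded asymp_eigen_def, rule_format, OF e]
  show "\<forall>\<^sub>F n in sequentially. norm (S (g n) - cnj c *\<^sub>C g n) \<le> e \<and>
      (\<forall>f. cmod (hardy_cinner (S f - cnj c *\<^sub>C f) (g n)) \<le> e * norm f)"
  proof eventually_elim
    case (elim n)
    let ?h = "S (g n) - cnj c *\<^sub>C g n"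
    have "(norm ?h)\<^sup>2 = cmod (hardy_cinner ?h ?h)"
      by (simp add: hardy_cinner_self norm_power)
    also have "\<dots> \<le> e * norm ?h"
      unfolding * using elim by blast
    finally have "norm ?h \<le> e"
      using e by (cases "norm ?h = 0") (simp_all add: power2_eq_square)
    moreover have "cmod (hardy_cinner (S f - cnj c *\<^sub>C f) (g n)) \<le> e * norm f" for f
    proof -
      have "cmod (hardy_cinner (S f - cnj c *\<^sub>C f) (g n)) = cmod (hardy_cinner (T (g n) - c *\<^sub>C g n) f)"
        unfolding *[symmetric] by (subst hardy_cinner_commute) simp
      also have "\<dots> \<le> norm (T (g n) - c *\<^sub>C g n) * norm f"
        by (rule hardy_cinner_Cauchy_Schwarz)
      also have "\<dots> \<le> e * norm f"
        using elim by (intro mult_right_mono) auto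
      finally show ?thesis .
    qed
    ultimately show ?case by blast
  qed
qed

lemma asymp_eigen_perturb:
  assumes T: "asymp_eigen g T c" and unit: "\<And>n. norm (g n) = 1"
    and d: "norm (S - T) \<le> d" "cmod (c' - c) \<le> d" "0 < e"
  shows "\<forall>\<^sub>F n in sequentially. norm (S (g n) - c' *\<^sub>C g n) \<le> e + 2 * d \<and>
      (\<forall>f. cmod (hardy_cinner (S f - c' *\<^sub>C f) (g n)) \<le> (e + 2 * d) * norm f)"
  using T[unfolded asymp_eigen_def, rule_format, OF d(3)]
proof eventually_elim
  case (elim n)
  have split: "S f - c' *\<^sub>C f = (T f - c *\<^sub>C f) + ((S - T) f - (c' - c) *\<^sub>C f)" for f
    by (simp add: blinfun.diff_left hardy_scaleC.diff_left)
  have small: "norm ((S - T) f - (c' - c) *\<^sub>C f) \<le> 2 * d * norm f" for f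
  proof -
    have "norm ((S - T) f - (c' - c) *\<^sub>C f) \<le> norm (S - T) * norm f + cmod (c' - c) * norm f"
      using norm_triangle_ineq4[of "(S - T) f" "(c' - c) *\<^sub>C f"] norm_blinfun[of "S - T" f] by simp
    also have "\<dots> \<le> d * norm f + d * norm f"
      using d by (intro add_mono mult_right_mono) auto
    finally show ?thesis by simp
  qed
  have "norm (S (g n) - c' *\<^sub>C g n) \<le> e + 2 * d"
    unfolding split using small[of "g n"] elim unit
    by (intro order_trans[OF norm_triangle_ineq] add_mono) auto
  moreover have "cmod (hardy_cinner (S f - c' *\<^sub>C f) (g n)) \<le> (e + 2 * d) * norm f" for f
  proof -
    have "cmod (hardy_cinner (S f - c' *\<^sub>C f) (g n))
      \<le> cmod (hardy_cinner (T f - c *\<^sub>C f) (g n)) + cmod (hardy_cinner ((S - T) f - (c' - c) *\<^sub>C f) (g n))"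
      unfolding split[of f] hardy_cinner_add_left by (rule norm_triangle_ineq)
    also have "\<dots> \<le> e * norm f + 2 * d * norm f"
    proof (intro add_mono)
      show "cmod (hardy_cinner (T f - c *\<^sub>C f) (g n)) \<le> e * norm f"
        using elim by blast
      show "cmod (hardy_cinner ((S - T) f - (c' - c) *\<^sub>C f) (g n)) \<le> 2 * d * norm f"
        using hardy_cinner_Cauchy_Schwarz[of "(S - T) f - (c' - c) *\<^sub>C f" "g n"] small[of f] unit
        by simp
    qed
    finally show ?thesis
      by (simp add: distrib_right)
  qed
  ultimately show ?case by blast
qed

text \<open>Eigenvalues depend continuously on the operator, and an operator has at most one of them.\<close>

lemma asymp_eigen_diff_le:
  assumes "asymp_eigen g S c" "asymp_eigen g T d" "\<And>n. norm (g n) = 1"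
  shows "cmod (c - d) \<le> norm (S - T)"
proof (rule field_le_epsilon)
  fix e :: real assume "0 < e"
  then have e: "0 < e / 2" by simp
  from assms(1,2)[unfolded asymp_eigen_def, rule_format, OF e]
  have "\<forall>\<^sub>F n in sequentially. norm (S (g n) - c *\<^sub>C g n) \<le> e / 2 \<and> norm (T (g n) - d *\<^sub>C g n) \<le> e / 2"
    by eventually_elim blast
  then obtain n where n: "norm (S (g n) - c *\<^sub>C g n) \<le> e / 2" "norm (T (g n) - d *\<^sub>C g n) \<le> e / 2"
    by (auto simp: eventually_sequentially)
  have "(c - d) *\<^sub>C g n = (S - T) (g n) - ((S (g n) - c *\<^sub>C g n) - (T (g n) - d *\<^sub>C g n))"
    by (simp add: blinfun.diff_left hardy_scaleC.diff_left)
  then have "cmod (c - d) = norm ((S - T) (g n) - ((S (g n) - c *\<^sub>C g n) - (T (g n) - d *\<^sub>C g n)))"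
    using norm_hardy_scaleC[of "c - d" "g n"] assms(3) by simp
  also have "\<dots> \<le> norm ((S - T) (g n)) + (norm (S (g n) - c *\<^sub>C g n) + norm (T (g n) - d *\<^sub>C g n))"
    by (intro order_trans[OF norm_triangle_ineq4] add_mono norm_triangle_ineq4 order_refl)
  also have "\<dots> \<le> norm (S - T) + e"
    using n norm_blinfun[of "S - T" "g n"] assms(3) by simp
  finally show "cmod (c - d) \<le> norm (S - T) + e" .
qed

lemma closed_clinear: "closed {T. clinear_op T}"
proof -
  have "closed {T :: hardy \<Rightarrow>\<^sub>L hardy. T (c *\<^sub>C f) = c *\<^sub>C T f}" for c f
    by (intro closed_Collect_eq linear_continuous_on blinfun.bounded_linear_left
        bounded_linear_compose[OF hardy_scaleC.bounded_linear_right])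
  then have "closed (\<Inter>c. \<Inter>f. {T :: hardy \<Rightarrow>\<^sub>L hardy. T (c *\<^sub>C f) = c *\<^sub>C T f})"
    by (intro closed_INT ballI)
  moreover have "{T. clinear_op T} = (\<Inter>c. \<Inter>f. {T :: hardy \<Rightarrow>\<^sub>L hardy. T (c *\<^sub>C f) = c *\<^sub>C T f})"
    by (auto simp: clinear_op_def)
  ultimately show ?thesis by simp
qed

text \<open>The eigenvalues of a convergent sequence of operators form a Cauchy sequence. A member of
  \<open>J\<close> is needed for this.\<close>

lemma closed_character_algebra:
  assumes unit: "\<And>g n. g \<in> J \<Longrightarrow> norm (g n) = 1" and ne: "J \<noteq> {}"
  shows "closed (character_algebra J)"
  unfolding closed_sequential_limits
proof (intro allI impI, elim conjE)
  fix X T assume X: "\<forall>n. X n \<in> character_algebra J" "X \<longlonglongrightarrow> T"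
  have "\<forall>n. \<exists>c. \<forall>g\<in>J. asymp_eigen g (X n) c"
    using X(1) by (simp add: character_algebra_def)
  then obtain c where c: "\<And>n g. g \<in> J \<Longrightarrow> asymp_eigen g (X n) (c n)"
    by metis
  obtain g\<^sub>0 where g0: "g\<^sub>0 \<in> J"
    using ne by blast
  have "Cauchy c"
  proof (rule metric_CauchyI)
    fix e :: real assume "0 < e"
    then obtain M where "\<And>m n. m \<ge> M \<Longrightarrow> n \<ge> M \<Longrightarrow> norm (X m - X n) < e"
      using CauchyD[OF LIMSEQ_imp_Cauchy[OF X(2)]] by blast
    then have "dist (c m) (c n) < e" if "m \<ge> M" "n \<ge> M" for m n
      using asymp_eigen_diff_le[OF c[OF g0, of m] c[OF g0, of n] unit[OF g0]] that
      by (force simp: dist_norm)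
    then show "\<exists>M. \<forall>m\<ge>M. \<forall>n\<ge>M. dist (c m) (c n) < e"
      by blast
  qed
  then obtain c' where c': "c \<longlonglongrightarrow> c'"
    by (auto simp: Cauchy_convergent_iff convergent_def)
  have "asymp_eigen g T c'" if g: "g \<in> J" for g
    unfolding asymp_eigen_def
  proof (intro allI impI)
    fix e :: real assume e: "0 < e"
    have "\<forall>\<^sub>F k in sequentially. norm (X k - T) < e / 4" "\<forall>\<^sub>F k in sequentially. norm (c k - c') < e / 4"
      using e tendstoD[OF X(2), of "e / 4"] tendstoD[OF c', of "e / 4"] by (simp_all add: dist_norm)
    then have "\<forall>\<^sub>F k in sequentially. norm (X k - T) < e / 4 \<and> norm (c k - c') < e / 4"
      by (rule eventually_conj)
    then obtain k where k: "norm (X k - T) < e / 4" "norm (c k - c') < e / 4"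
      by (auto simp: eventually_sequentially)
    have "norm (T - X k) \<le> e / 4" "cmod (c' - c k) \<le> e / 4" "0 < e / 2"
      using k e by (simp_all add: norm_minus_commute)
    from asymp_eigen_perturb[OF c[OF g] unit[OF g] this]
    show "\<forall>\<^sub>F n in sequentially. norm (T (g n) - c' *\<^sub>C g n) \<le> e \<and>
      (\<forall>f. cmod (hardy_cinner (T f - c' *\<^sub>C f) (g n)) \<le> e * norm f)"
      by simp
  qed
  moreover have "T \<in> {T. clinear_op T}"
    by (rule closed_sequentially[OF closed_clinear _ X(2)]) (use X(1) in \<open>simp add: character_algebra_def\<close>)
  ultimately show "T \<in> character_algebra J"
    by (auto simp: character_algebra_def)
qed

lemma character_algebra_cstar:
  assumes unit: "\<And>g n. g \<in> J \<Longrightarrow> norm (g n) = 1" and ne: "J \<noteq> {}"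
  shows "unital_cstar_subalgebra (character_algebra J)"
  unfolding unital_cstar_subalgebra_def
proof (intro conjI ballI allI impI)
  let ?A = "character_algebra J"
  show "clinear_op T" if "T \<in> ?A" for T
    using that by (simp add: character_algebra_def)
  show "id_blinfun \<in> ?A"
    using asymp_eigen_id clinear_op_intros(1) by (auto simp: character_algebra_def)
  show "closed ?A"
    by (rule closed_character_algebra) (fact unit, fact ne)
  fix T assume T: "T \<in> ?A"
  then obtain d where d: "clinear_op T" "\<And>g. g \<in> J \<Longrightarrow> asymp_eigen g T d"
    by (auto simp: character_algebra_def)
  show "scaleC_op c o\<^sub>L T \<in> ?A" for c
    using d asymp_eigen_compose[OF clinear_op_intros(2) asymp_eigen_scaleC] clinear_op_intros(2,5)
    unfolding character_algebra_def by blast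
  show "S \<in> ?A" if "is_adjoint_op T S" for S
    using d asymp_eigen_adjoint[OF that] clinear_adjoint[OF that] by (auto simp: character_algebra_def)
  fix S assume S: "S \<in> ?A"
  then obtain c where c: "clinear_op S" "\<And>g. g \<in> J \<Longrightarrow> asymp_eigen g S c"
    by (auto simp: character_algebra_def)
  show "T + S \<in> ?A"
    using c d asymp_eigen_add clinear_op_intros(3) unfolding character_algebra_def by blast
  show "T o\<^sub>L S \<in> ?A"
    using c d asymp_eigen_compose clinear_op_intros(5) unfolding character_algebra_def by blast
qed

text \<open>Up to \<open>e / 2\<close> the image of the unit ball is a finite set \<open>k\<close>, and weak convergence is
  uniform on finite sets. For \<open>T (g n)\<close> this is used through the functionals \<open>f \<mapsto> \<langle>T f, x\<rangle>\<close>
  with \<open>x\<close> in \<open>k\<close>, represented by vectors.\<close>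

lemma compact_asymp_eigen:
  assumes T: "T \<in> compact_ops" and unit: "\<And>n. norm (g n) = 1" and weak: "weakly_null g"
  shows "asymp_eigen g T 0"
  unfolding asymp_eigen_def
proof (intro allI impI)
  fix e :: real assume e: "0 < e"
  have lin: "clinear_op T" and cpt: "compact (closure (T ` cball 0 1))"
    using T by (auto simp: compact_ops_def)
  obtain k where k: "finite k" "closure (T ` cball 0 1) \<subseteq> (\<Union>x\<in>k. ball x (e / 2))"
    using cpt e unfolding compact_eq_totally_bounded by (meson half_gt_zero)
  have near: "\<exists>x\<in>k. norm (T f - x) \<le> e / 2" if "norm f \<le> 1" for f
  proof -
    have "T f \<in> closure (T ` cball 0 1)"
      using that closure_subset[of "T ` cball 0 1"] by auto
    then obtain x where "x \<in> k" "dist x (T f) < e / 2"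
      using k(2) by auto
    then show ?thesis
      by (auto simp: dist_norm norm_minus_commute intro!: bexI[of _ x])
  qed
  have "\<exists>y. \<forall>f. hardy_cinner (T f) x = hardy_cinner f y" for x
    by (rule hardy_Riesz)
      (auto simp: clinear_hardyD[OF lin] intro!: bounded_linear_compose[OF hardy_cinner.bounded_linear_left]
        blinfun.bounded_linear_right)
  then obtain y where y: "\<And>x f. hardy_cinner (T f) x = hardy_cinner f (y x)"
    by metis
  have small: "\<forall>\<^sub>F n in sequentially. cmod (hardy_cinner x (g n)) < d" if "0 < d" for x d
    using tendstoD[of _ 0, OF weak[unfolded weakly_null_def, rule_format] that] by (simp add: dist_norm)
  have ev1: "\<forall>\<^sub>F n in sequentially. \<forall>x\<in>k. cmod (hardy_cinner x (g n)) < e / 2"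
    using k(1) e by (intro eventually_ball_finite ballI small) auto
  have "\<forall>\<^sub>F n in sequentially. \<forall>x\<in>k. cmod (hardy_cinner (y x) (g n)) < e\<^sup>2 / 2"
    using k(1) e by (intro eventually_ball_finite ballI small) auto
  with ev1 show "\<forall>\<^sub>F n in sequentially. norm (T (g n) - 0 *\<^sub>C g n) \<le> e \<and>
      (\<forall>f. cmod (hardy_cinner (T f - 0 *\<^sub>C f) (g n)) \<le> e * norm f)"
  proof eventually_elim
    case (elim n)
    let ?t = "norm (T (g n))"
    obtain x where x: "x \<in> k" "norm (T (g n) - x) \<le> e / 2"
      using near[of "g n"] unit[of n] by auto
    have "cmod (hardy_cinner (T (g n)) x) = cmod (hardy_cinner (y x) (g n))"
      unfolding y by (subst hardy_cinner_commute) simp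
    then have xs: "cmod (hardy_cinner (T (g n)) x) < e\<^sup>2 / 2"
      using elim(2) x(1) by simp
    have "?t\<^sup>2 = cmod (hardy_cinner (T (g n)) (T (g n)))"
      by (simp add: hardy_cinner_self norm_power)
    also have "hardy_cinner (T (g n)) (T (g n)) = hardy_cinner (T (g n)) x + hardy_cinner (T (g n)) (T (g n) - x)"
      by (simp add: hardy_cinner.diff_right)
    also have "cmod \<dots> \<le> cmod (hardy_cinner (T (g n)) x) + cmod (hardy_cinner (T (g n)) (T (g n) - x))"
      by (rule norm_triangle_ineq)
    also have "cmod (hardy_cinner (T (g n)) (T (g n) - x)) \<le> ?t * (e / 2)"
      by (rule order_trans[OF hardy_cinner_Cauchy_Schwarz]) (intro mult_left_mono x(2) norm_ge_zero)
    finally have t: "?t\<^sup>2 \<le> e\<^sup>2 / 2 + ?t * (e / 2)"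
      using xs by linarith
    have "?t \<le> e"
    proof (rule ccontr)
      assume "\<not> ?t \<le> e"
      then have "e * e < ?t * ?t" "?t * e \<le> ?t * ?t"
        using e by (auto intro!: mult_strict_mono mult_left_mono)
      with t show False
        by (simp add: power2_eq_square)
    qed
    moreover have "cmod (hardy_cinner (T f) (g n)) \<le> e * norm f" for f
    proof (cases "f = 0")
      case False
      define h where "h = (1 / norm f) *\<^sub>R f"
      have h: "norm h = 1" "f = norm f *\<^sub>R h"
        using False by (simp_all add: h_def)
      obtain x where x: "x \<in> k" "norm (T h - x) \<le> e / 2"
        using near[of h] h by auto
      have "cmod (hardy_cinner (T h) (g n)) = cmod (hardy_cinner x (g n) + hardy_cinner (T h - x) (g n))"
        by (simp add: hardy_cinner.diff_left)
      also have "\<dots> \<le> cmod (hardy_cinner x (g n)) + cmod (hardy_cinner (T h - x) (g n))"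
        by (rule norm_triangle_ineq)
      also have "\<dots> \<le> e / 2 + e / 2"
      proof (intro add_mono)
        show "cmod (hardy_cinner x (g n)) \<le> e / 2"
          using elim(1) x(1) by (intro less_imp_le) simp
        show "cmod (hardy_cinner (T h - x) (g n)) \<le> e / 2"
          using hardy_cinner_Cauchy_Schwarz[of "T h - x" "g n"] x(2) unit by simp
      qed
      finally have "cmod (hardy_cinner (T h) (g n)) \<le> e"
        by simp
      then have "norm f * cmod (hardy_cinner (T h) (g n)) \<le> norm f * e"
        by (intro mult_left_mono) auto
      moreover have "hardy_cinner (T f) (g n) = norm f *\<^sub>R hardy_cinner (T h) (g n)"
        by (subst h(2)) (simp only: blinfun.scaleR_right hardy_cinner.scaleR_left)
      ultimately show ?thesis
        by (simp add: mult.commute)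
    qed (simp add: hardy_cinner.zero_left blinfun.zero_right)
    ultimately show ?case
      by (simp add: hardy_scaleC.zero_left)
  qed
qed

section \<open>Normalized kernels as asymptotic eigenvectors\<close>

lemma rotation_bounded:
  assumes "cmod \<rho> = 1"
  shows "wcomp_bounded 1 (\<lambda>_. 1) (\<lambda>z. \<rho> * z)"
  unfolding wcomp_bounded_def
proof
  fix f
  have s: "summable (\<lambda>n. (cmod (\<rho> ^ n * hardy_coeff f n))\<^sup>2)"
    using hardy_coeff_square_summable[of f] assms by (simp add: norm_mult norm_power)
  have "(\<lambda>n. (\<rho> ^ n * hardy_coeff f n) * z ^ n) sums hardy_fun f (\<rho> * z)" if "z \<in> \<D>" for z
    using hardy_sums[of "\<rho> * z" f] that assms by (simp add: norm_mult power_mult_distrib mult_ac)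
  from hardy_from_power_series[OF s this] obtain g where
    g: "\<And>n. hardy_coeff g n = \<rho> ^ n * hardy_coeff f n" "\<And>z. z \<in> \<D> \<Longrightarrow> hardy_fun g z = hardy_fun f (\<rho> * z)"
    by blast
  have "norm g = norm f"
    using assms by (simp add: norm_hardy_def g norm_mult norm_power)
  with g show "\<exists>g. (\<forall>z\<in>\<D>. hardy_fun g z = 1 * hardy_fun f (\<rho> * z)) \<and> norm g \<le> 1 * norm f"
    by (intro exI[of _ g]) simp
qed

text \<open>A general map with a boundary contact is a rotation after one that fixes the contact point,
  and both factors have bounded composition operators.\<close>

lemma hardy_fun_composition_op:
  assumes "cmod \<eta> = 1" "cmod \<rho> = 1" "0 < l" "0 \<le> kap l b"
    and \<psi>: "\<And>z. z \<in> \<D> \<Longrightarrow> \<psi> z = \<rho> * lft \<eta> l b z"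
  shows "z \<in> \<D> \<Longrightarrow> hardy_fun (composition_op \<psi> f) z = hardy_fun f (\<psi> z)"
proof -
  let ?C = "composition_op (lft \<eta> l b)"
  let ?R = "wcomp (\<lambda>_. 1) (\<lambda>z. \<rho> * z)"
  have C: "hardy_fun (?C f) z = hardy_fun f (lft \<eta> l b z)" if "z \<in> \<D>" for f z
  proof -
    have nz: "of_real l + b * gap \<eta> z \<noteq> 0"
      using that by (intro lfw_denominator_nonzero assms) auto
    have "hardy_fun (?C f) z = (of_real l + b * gap \<eta> z) * (lfw \<eta> l b z * hardy_fun f (lft \<eta> l b z))"
      using that unfolding composition_op_eq_Wop[OF assms(1,3,4) refl]
      by (simp add: hardy_fun_Wop[OF assms(1,3,4)] blinfun.add_left algebra_simps)
    then show ?thesis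
      using nz by (simp add: lfw_def)
  qed
  have "composition_op \<psi> = ?C o\<^sub>L ?R"
  proof (rule composition_op_eqI)
    fix f z assume z: "z \<in> \<D>"
    then show "hardy_fun ((?C o\<^sub>L ?R) f) z = hardy_fun f (\<psi> z)"
      using lft_in_disk[OF assms(1) z assms(3,4)]
      by (simp add: C \<psi> hardy_fun_wcomp[OF rotation_bounded[OF assms(2)]])
  qed
  then show "z \<in> \<D> \<Longrightarrow> hardy_fun (composition_op \<psi> f) z = hardy_fun f (\<psi> z)"
    using lft_in_disk[OF assms(1) _ assms(3,4)]
    by (simp add: C \<psi> hardy_fun_wcomp[OF rotation_bounded[OF assms(2)]])
qed

definition unit_kernel :: "complex \<Rightarrow> hardy"
  where "unit_kernel z = of_real (sqrt (1 - (cmod z)\<^sup>2)) *\<^sub>C hardy_kernel z"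

lemma disk_defect_pos: "z \<in> \<D> \<Longrightarrow> 0 < 1 - (cmod z)\<^sup>2"
  by (simp add: abs_square_less_1)

lemma norm_unit_kernel:
  assumes "z \<in> \<D>"
  shows "norm (unit_kernel z) = 1"
proof -
  have "(norm (unit_kernel z))\<^sup>2 = 1"
    using disk_defect_pos[OF assms] norm_hardy_kernel_sq[OF assms]
    by (simp add: unit_kernel_def power_mult_distrib)
  then show ?thesis
    using power2_eq_iff_nonneg[of "norm (unit_kernel z)" 1] by simp
qed

lemma hardy_cinner_unit_kernel:
  "z \<in> \<D> \<Longrightarrow> hardy_cinner f (unit_kernel z) = of_real (sqrt (1 - (cmod z)\<^sup>2)) * hardy_fun f z"
  by (simp add: unit_kernel_def hardy_cinner_kernel)

lemma hardy_fun_unit_kernel_self: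
  assumes "z \<in> \<D>"
  shows "hardy_fun (unit_kernel z) z = of_real (1 / sqrt (1 - (cmod z)\<^sup>2))"
proof -
  have "1 - cnj z * z = of_real (1 - (cmod z)\<^sup>2)"
    using complex_norm_square[of z] by (simp add: mult.commute)
  then have "hardy_fun (unit_kernel z) z = of_real (sqrt (1 - (cmod z)\<^sup>2) / (1 - (cmod z)\<^sup>2))"
    using assms by (simp add: unit_kernel_def hardy_fun_kernel del: of_real_diff)
  also have "sqrt (1 - (cmod z)\<^sup>2) / (1 - (cmod z)\<^sup>2) = 1 / sqrt (1 - (cmod z)\<^sup>2)"
    using disk_defect_pos[OF assms] by (simp add: real_div_sqrt field_simps)
  finally show ?thesis .
qed

definition kernel_sequences :: "complex \<Rightarrow> (nat \<Rightarrow> hardy) set"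
  where "kernel_sequences \<zeta> = {\<lambda>n. unit_kernel (z n) | z.
    (\<forall>n. z n \<in> \<D>) \<and> (\<exists>\<eta>. z \<longlonglongrightarrow> \<eta> \<and> cmod \<eta> = 1 \<and> \<eta> \<noteq> \<zeta>)}"

lemma kernel_sequencesI:
  "(\<And>n. z n \<in> \<D>) \<Longrightarrow> z \<longlonglongrightarrow> \<eta> \<Longrightarrow> cmod \<eta> = 1 \<Longrightarrow> \<eta> \<noteq> \<zeta> \<Longrightarrow> (\<lambda>n. unit_kernel (z n)) \<in> kernel_sequences \<zeta>"
  unfolding kernel_sequences_def by blast

lemma tendsto_boundary_defect:
  assumes "z \<longlonglongrightarrow> \<eta>" "cmod \<eta> = 1"
  shows "(\<lambda>n. 1 - (cmod (z n))\<^sup>2) \<longlonglongrightarrow> 0"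
proof -
  have "(\<lambda>n. 1 - (cmod (z n))\<^sup>2) \<longlonglongrightarrow> 1 - (cmod \<eta>)\<^sup>2"
    by (intro tendsto_intros assms)
  then show ?thesis
    using assms by simp
qed

lemma weakly_null_kernels:
  assumes z: "\<And>n. z n \<in> \<D>" "z \<longlonglongrightarrow> \<eta>" "cmod \<eta> = 1"
  shows "weakly_null (\<lambda>n. unit_kernel (z n))"
proof (rule weakly_null_if_coeffs)
  show "norm (unit_kernel (z n)) = 1" for n
    using z by (intro norm_unit_kernel)
  fix k
  have "(\<lambda>n. of_real (sqrt (1 - (cmod (z n))\<^sup>2)) * cnj (z n) ^ k) \<longlonglongrightarrow> of_real (sqrt 0) * cnj \<eta> ^ k"
    by (intro tendsto_intros tendsto_boundary_defect[OF z(2,3)] z(2))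
  then show "(\<lambda>n. hardy_coeff (unit_kernel (z n)) k) \<longlonglongrightarrow> 0"
    using z(1) by (simp add: unit_kernel_def)
qed

lemma radial_sequence:
  assumes "cmod \<eta> = 1"
  defines "r \<equiv> \<lambda>n. 1 - inverse (real (Suc (Suc n)))"
  shows "\<And>n. 0 < r n \<and> r n < 1" "r \<longlonglongrightarrow> 1" "\<And>n. \<eta> * of_real (r n) \<in> \<D>"
    "(\<lambda>n. \<eta> * of_real (r n)) \<longlonglongrightarrow> \<eta>"
proof -
  show r: "0 < r n \<and> r n < 1" for n
    by (simp add: r_def field_simps)
  have "(\<lambda>n. 1 - inverse (real (Suc (Suc n)))) \<longlonglongrightarrow> 1 - 0"
    by (intro tendsto_intros LIMSEQ_Suc[OF LIMSEQ_inverse_real_of_nat])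
  then show lim: "r \<longlonglongrightarrow> 1"
    by (simp add: r_def)
  show "\<eta> * of_real (r n) \<in> \<D>" for n
    using r[of n] assms(1) by (simp add: norm_mult)
  have "(\<lambda>n. \<eta> * of_real (r n)) \<longlonglongrightarrow> \<eta> * of_real 1"
    by (intro tendsto_intros lim)
  then show "(\<lambda>n. \<eta> * of_real (r n)) \<longlonglongrightarrow> \<eta>"
    by simp
qed

text \<open>Away from \<open>\<zeta>\<close>, the images \<open>\<phi> (z n)\<close> stay away from the circle, as the map has positive
  \<open>kap\<close>. With \<open>\<delta> n\<close> the root of the defect of \<open>z n\<close> divided by its gap, both parts of the
  definition are of order \<open>\<delta> n\<close>: the norm of the image by the explicit norm of kernel images,
  and the pairing with the kernel because it evaluates \<open>f\<close> at \<open>\<phi> (z n)\<close>.\<close>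

lemma composition_op_asymp_eigen_kernels:
  assumes "cmod \<zeta> = 1" "0 < l" "0 < kap l b" and \<phi>: "\<And>z. z \<in> \<D> \<Longrightarrow> \<phi> z = lft \<zeta> l b z"
    and g: "g \<in> kernel_sequences \<zeta>"
  shows "asymp_eigen g (composition_op \<phi>) 0"
proof -
  have k: "0 \<le> kap l b"
    using assms by simp
  note W = assms(1,2) k
  obtain z \<eta> where z: "\<And>n. z n \<in> \<D>" "z \<longlonglongrightarrow> \<eta>" "cmod \<eta> = 1" "\<eta> \<noteq> \<zeta>" and g: "g = (\<lambda>n. unit_kernel (z n))"
    using g unfolding kernel_sequences_def by blast
  define M where "M = l + 2 * cmod b"
  have M: "0 < M"
    using assms(2) by (simp add: M_def add_pos_nonneg)
  have p0: "gap \<zeta> (z n) \<noteq> 0" for n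
    using gap_zero_iff[OF assms(1)] z(1)[of n] assms(1) by auto
  define \<delta> where "\<delta> n = sqrt (1 - (cmod (z n))\<^sup>2) / cmod (gap \<zeta> (z n))" for n
  have "(\<lambda>n. sqrt (1 - (cmod (z n))\<^sup>2) / cmod (1 - cnj \<zeta> * z n)) \<longlonglongrightarrow> sqrt 0 / cmod (1 - cnj \<zeta> * \<eta>)"
    using gap_zero_iff[OF assms(1), of \<eta>] z(4)
    by (intro tendsto_intros tendsto_boundary_defect[OF z(2,3)] z(2)) (simp add: gap_def)
  then have \<delta>: "\<delta> \<longlonglongrightarrow> 0"
    unfolding \<delta>_def gap_def by simp
  have \<delta>0: "0 \<le> \<delta> n" for n
    using disk_defect_pos[OF z(1)[of n]] by (simp add: \<delta>_def)
  have val: "hardy_fun (composition_op \<phi> f) z = hardy_fun f (\<phi> z)" if "z \<in> \<D>" for f z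
    using hardy_fun_composition_op[OF assms(1) _ assms(2) k, of 1 \<phi> z f] \<phi> that by simp
  show ?thesis
  proof (rule asymp_eigenI)
    have bound: "norm (composition_op \<phi> (g n)) \<le> M * (\<delta> n / sqrt (l * kap l b))" for n
    proof -
      let ?w = "Wop \<zeta> l b (g n)" and ?d = "1 - (cmod (z n))\<^sup>2" and ?p = "cmod (gap \<zeta> (z n))"
      have d: "0 < ?d"
        by (rule disk_defect_pos[OF z(1)])
      have "?w = of_real (sqrt ?d) *\<^sub>C kernel_image \<zeta> l b (z n)"
        using z(1) by (simp add: g unit_kernel_def clinear_hardyD[OF clinear_Wop[OF W]] Wop_kernel[OF W])
      then have "(norm ?w)\<^sup>2 = ?d * (1 / (l * (?d + kap l b * ?p\<^sup>2)))"
        using d norm_kernel_image_sq[OF W z(1)[of n]] by (simp add: power_mult_distrib)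
      also have "\<dots> \<le> ?d * (1 / (l * (kap l b * ?p\<^sup>2)))"
        using d assms(2,3) p0[of n]
        by (intro mult_left_mono divide_left_mono mult_pos_pos add_nonneg_pos) auto
      also have "\<dots> = (\<delta> n / sqrt (l * kap l b))\<^sup>2"
        using d assms(2,3) by (simp add: \<delta>_def power_divide power_mult_distrib)
      finally have w: "norm ?w \<le> \<delta> n / sqrt (l * kap l b)"
        by (rule power2_le_imp_le) (use \<delta>0[of n] assms(2,3) in simp)
      have "norm (composition_op \<phi> (g n)) = norm (of_real l *\<^sub>C ?w + b *\<^sub>C gap_op \<zeta> ?w)"
        using composition_op_eq_Wop[OF W \<phi>] by (simp add: blinfun.add_left)
      also have "\<dots> \<le> l * norm ?w + cmod b * (2 * norm ?w)"
        using assms(2) norm_gap_op_apply[OF assms(1), of ?w]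
        by (intro order_trans[OF norm_triangle_ineq] add_mono) (auto intro: mult_left_mono)
      also have "\<dots> = M * norm ?w"
        by (simp add: M_def algebra_simps)
      also have "\<dots> \<le> M * (\<delta> n / sqrt (l * kap l b))"
        using M w by (intro mult_left_mono) auto
      finally show ?thesis .
    qed
    have "(\<lambda>n. M * (\<delta> n / sqrt (l * kap l b))) \<longlonglongrightarrow> M * (0 / sqrt (l * kap l b))"
      using assms by (intro tendsto_intros \<delta>) auto
    then have "(\<lambda>n. M * (\<delta> n / sqrt (l * kap l b))) \<longlonglongrightarrow> 0"
      by simp
    from tendsto_norm_zero[OF Lim_null_comparison[OF always_eventually[OF allI[OF bound]] this]]
    show "(\<lambda>n. norm (composition_op \<phi> (g n) - 0 *\<^sub>C g n)) \<longlonglongrightarrow> 0"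
      by (simp add: hardy_scaleC.zero_left)
    have "(\<lambda>n. M / sqrt (kap l b) * \<delta> n) \<longlonglongrightarrow> M / sqrt (kap l b) * 0"
      by (intro tendsto_intros \<delta>)
    then show "(\<lambda>n. M / sqrt (kap l b) * \<delta> n) \<longlonglongrightarrow> 0"
      by simp
    fix n and f :: hardy
    let ?d = "1 - (cmod (z n))\<^sup>2" and ?v = "\<phi> (z n)" and ?p = "cmod (gap \<zeta> (z n))"
    have v: "?v \<in> \<D>"
      using lft_in_disk[OF assms(1) z(1)[of n] assms(2) k] \<phi>[OF z(1)[of n]] by (simp del: mem_ball)
    have d: "0 < ?d"
      by (rule disk_defect_pos[OF z(1)])
    let ?q = "cmod (of_real l + b * gap \<zeta> (z n))"
    have q: "0 < ?q" "?q \<le> M"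
    proof -
      have zn: "cmod (z n) \<le> 1"
        using z(1)[of n] by simp
      show "0 < ?q"
        using lfw_denominator_nonzero[OF assms(1) zn assms(2) k] by simp
      have "?q \<le> cmod (of_real l) + cmod b * ?p"
        by (metis norm_triangle_ineq norm_mult)
      also have "\<dots> \<le> l + cmod b * 2"
        using assms(2) norm_gap_le[OF assms(1) zn] by (intro add_mono mult_left_mono) auto
      finally show "?q \<le> M"
        by (simp add: M_def mult.commute)
    qed
    have "norm (hardy_kernel ?v) \<le> M / (sqrt (kap l b) * ?p)"
    proof (rule power2_le_imp_le)
      have "1 - (cmod ?v)\<^sup>2 = (l * ?d + kap l b * ?p\<^sup>2) / ?q\<^sup>2"
        using one_minus_norm_lft[OF assms(1) _ assms(2) k, of "z n"] z(1)[of n] \<phi>[OF z(1)[of n]] by simp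
      then have "(norm (hardy_kernel ?v))\<^sup>2 = ?q\<^sup>2 / (l * ?d + kap l b * ?p\<^sup>2)"
        by (simp add: norm_hardy_kernel_sq[OF v])
      also have "\<dots> \<le> M\<^sup>2 / (kap l b * ?p\<^sup>2)"
        using d assms(2,3) p0[of n] q
        by (intro frac_le mult_pos_pos power_mono) auto
      also have "\<dots> = (M / (sqrt (kap l b) * ?p))\<^sup>2"
        using assms(3) by (simp add: power_divide power_mult_distrib)
      finally show "(norm (hardy_kernel ?v))\<^sup>2 \<le> (M / (sqrt (kap l b) * ?p))\<^sup>2" .
      show "0 \<le> M / (sqrt (kap l b) * ?p)"
        using M k by simp
    qed
    then have "norm f * norm (hardy_kernel ?v) \<le> norm f * (M / (sqrt (kap l b) * ?p))"
      by (intro mult_left_mono) auto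
    then have "cmod (hardy_fun f ?v) \<le> norm f * (M / (sqrt (kap l b) * ?p))"
      using hardy_fun_le[OF v, of f] by linarith
    then have "sqrt ?d * cmod (hardy_fun f ?v) \<le> sqrt ?d * (norm f * (M / (sqrt (kap l b) * ?p)))"
      using d by (intro mult_left_mono) auto
    also have "\<dots> = M / sqrt (kap l b) * \<delta> n * norm f"
      by (simp add: \<delta>_def)
    finally show "cmod (hardy_cinner (composition_op \<phi> f - 0 *\<^sub>C f) (g n)) \<le> M / sqrt (kap l b) * \<delta> n * norm f"
      using z(1)[of n] d
      by (simp add: g hardy_cinner_unit_kernel val hardy_scaleC.zero_left norm_mult)
  qed
qed

text \<open>Fixed points correspond to the roots of a quadratic polynomial in the gap.\<close>

lemma identity_if_infinitely_many_fixed_points: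
  assumes "cmod \<eta> = 1" "0 < l" "0 \<le> kap l b" "cmod \<rho> = 1"
    and "infinite {u. cmod u \<le> 1 \<and> \<rho> * lft \<eta> l b u = u}" and z: "cmod z \<le> 1"
  shows "\<rho> * lft \<eta> l b z = z"
proof -
  let ?F = "{u. cmod u \<le> 1 \<and> \<rho> * lft \<eta> l b u = u}"
  let ?P = "[:(\<rho> - 1) * of_real l, \<rho> * (b - 1) - b + of_real l, b:]"
  have gap_inv: "u = \<eta> * (1 - gap \<eta> u)" for u
    using lft_one_zero[OF assms(1), of u] by (simp add: lft_def lfw_def)
  have eta: "\<eta> \<noteq> 0"
    using assms by auto
  have iff: "\<rho> * lft \<eta> l b u = u \<longleftrightarrow> poly ?P (gap \<eta> u) = 0" if "cmod u \<le> 1" for u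
  proof -
    let ?p = "gap \<eta> u" and ?d = "of_real l + b * gap \<eta> u"
    have d: "?d \<noteq> 0"
      by (rule lfw_denominator_nonzero[OF assms(1) that assms(2,3)])
    have "\<rho> * lft \<eta> l b u = u \<longleftrightarrow> \<eta> * (\<rho> * (1 - ?p / ?d)) = \<eta> * (1 - ?p)"
      by (subst (3) gap_inv) (simp add: lft_def lfw_def mult_ac)
    also have "\<dots> \<longleftrightarrow> \<rho> * (1 - ?p / ?d) = 1 - ?p"
      using eta by simp
    also have "\<dots> \<longleftrightarrow> \<rho> * (?d - ?p) = (1 - ?p) * ?d"
      using d by (simp add: field_simps)
    also have "\<dots> \<longleftrightarrow> poly ?P ?p = 0"
      by (simp add: algebra_simps)
    finally show ?thesis .
  qed
  have "inj_on (gap \<eta>) ?F"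
    by (rule inj_onI) (metis gap_inv)
  then have "infinite (gap \<eta> ` ?F)"
    using assms(5) by (simp add: finite_image_iff)
  moreover have "gap \<eta> ` ?F \<subseteq> {x. poly ?P x = 0}"
    using iff by auto
  ultimately have "infinite {x. poly ?P x = 0}"
    using finite_subset by blast
  then have "?P = 0"
    using poly_roots_finite by blast
  then show ?thesis
    using iff[OF z] by (metis poly_0)
qed

lemma infinite_unit_circle: "infinite \<T>"
proof -
  have "inj_on cis {0..1}"
    by (rule inj_onI, rule cos_inj_pi) (use pi_ge_two in \<open>auto simp: complex_eq_iff\<close>)
  then have "infinite (cis ` {0..1})"
    by (simp add: finite_image_iff)
  moreover have "cis ` {0..1} \<subseteq> \<T>"
    by auto
  ultimately show ?thesis
    using finite_subset by blast
qed

text \<open>The radial case of the Julia-Caratheodory theorem: at \<open>\<zeta>\<close> the defects of a point and its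
  image have the ratio \<open>l\<close>, the reciprocal of the derivative.\<close>

lemma radial_ratio:
  assumes "cmod \<zeta> = 1" "0 < l" "0 \<le> kap l b" "\<And>n. 0 < r n \<and> r n < 1" "r \<longlonglongrightarrow> 1"
  shows "(\<lambda>n. (1 - (cmod (\<zeta> * of_real (r n)))\<^sup>2) / (1 - (cmod (lft \<zeta> l b (\<zeta> * of_real (r n))))\<^sup>2)) \<longlonglongrightarrow> l"
proof -
  have "(1 - (cmod (\<zeta> * of_real (r n)))\<^sup>2) / (1 - (cmod (lft \<zeta> l b (\<zeta> * of_real (r n))))\<^sup>2)
    = (cmod (of_real l + b * of_real (1 - r n)))\<^sup>2 * (1 + r n) / (l * (1 + r n) + kap l b * (1 - r n))" for n
  proof -
    have r: "0 < r n" "r n < 1"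
      using assms(4) by auto
    have c: "cmod (\<zeta> * of_real (r n)) = r n"
      using r assms(1) by (simp add: norm_mult)
    have f: "1 - (r n)\<^sup>2 = (1 - r n) * (1 + r n)"
      by (simp add: power2_eq_square algebra_simps)
    have g: "cmod (gap \<zeta> (\<zeta> * of_real (r n))) = 1 - r n"
      using r by (simp only: gap_boundary_point[OF assms(1)] norm_of_real)
    have "1 - (cmod (lft \<zeta> l b (\<zeta> * of_real (r n))))\<^sup>2
      = (l * ((1 - r n) * (1 + r n)) + kap l b * (1 - r n)\<^sup>2) / (cmod (of_real l + b * of_real (1 - r n)))\<^sup>2"
      using one_minus_norm_lft[OF assms(1) _ assms(2,3), of "\<zeta> * of_real (r n)"] r
      unfolding g c f by (simp only: gap_boundary_point[OF assms(1)])
    also have "l * ((1 - r n) * (1 + r n)) + kap l b * (1 - r n)\<^sup>2 = (1 - r n) * (l * (1 + r n) + kap l b * (1 - r n))"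
      by (simp add: power2_eq_square algebra_simps)
    finally show ?thesis
      unfolding c f using r by simp
  qed
  moreover have "(\<lambda>n. (cmod (of_real l + b * of_real (1 - r n)))\<^sup>2 * (1 + r n) / (l * (1 + r n) + kap l b * (1 - r n)))
    \<longlonglongrightarrow> (cmod (of_real l + b * of_real (1 - 1)))\<^sup>2 * (1 + 1) / (l * (1 + 1) + kap l b * (1 - 1))"
    using assms(2) by (intro tendsto_intros assms(5)) auto
  ultimately show ?thesis
    using assms(2) by (simp add: power2_eq_square)
qed

lemma tendsto_lft:
  assumes "cmod \<eta> = 1" "0 < l" "0 \<le> kap l b" "cmod u \<le> 1" "z \<longlonglongrightarrow> u"
  shows "(\<lambda>n. lft \<eta> l b (z n)) \<longlonglongrightarrow> lft \<eta> l b u"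
  unfolding lft_def lfw_def gap_def
  using lfw_denominator_nonzero[OF assms(1,4,2,3)] by (intro tendsto_intros assms(5)) (simp add: gap_def)

text \<open>The eigenvalue is zero: a boundary point \<open>u \<noteq> \<zeta>\<close> that is not fixed exists, and near \<open>u\<close> the
  diagonal matrix coefficients of the operator on normalized kernels tend to zero. Pairing the
  images of the kernels at \<open>\<psi> (z n)\<close> with the kernels at \<open>z n\<close> shows that the ratio of the
  defects of \<open>z n\<close> and \<open>\<psi> (z n)\<close> tends to zero whenever \<open>z n\<close> tends to a boundary point other
  than \<open>\<zeta>\<close>. For an automorphism the ratio has a positive limit at \<open>u\<close>, and at the contact
  point \<open>\<eta>\<close> it tends to \<open>l > 0\<close>, so \<open>\<eta> = \<zeta>\<close>. If the contact value were different from \<open>\<zeta>\<close>, the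
  kernels at \<open>\<psi> (z n)\<close> with \<open>z n \<rightarrow> \<zeta>\<close> would themselves be admissible, and the same pairing
  would contradict that their images tend to zero.\<close>

lemma composition_in_kernel_character_algebra:
  assumes "cmod \<zeta> = 1" "cmod \<eta> = 1" "cmod \<rho> = 1" "0 < l" "0 \<le> kap l b"
    and \<psi>: "\<And>z. z \<in> \<D> \<Longrightarrow> \<psi> z = \<rho> * lft \<eta> l b z"
    and mem: "composition_op \<psi> \<in> character_algebra (kernel_sequences \<zeta>)"
    and not_id: "composition_op \<psi> \<noteq> id_blinfun"
  shows "0 < kap l b \<and> \<eta> = \<zeta> \<and> \<rho> = 1"
proof -
  let ?T = "composition_op \<psi>"
  let ?\<psi> = "\<lambda>z. \<rho> * lft \<eta> l b z"
  have self: "?\<psi> z \<in> \<D>" if "z \<in> \<D>" for z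
    using lft_in_disk[OF assms(2) that assms(4,5)] assms(3) by (simp add: norm_mult)
  have val: "hardy_fun (?T f) z = hardy_fun f (?\<psi> z)" if "z \<in> \<D>" for f z
    using hardy_fun_composition_op[OF assms(2-5) \<psi> that] \<psi>[OF that] by simp
  obtain c where c: "\<And>g. g \<in> kernel_sequences \<zeta> \<Longrightarrow> asymp_eigen g ?T c"
    using mem by (auto simp: character_algebra_def)
  \<comment> \<open>all but one point of the circle being fixed would make \<open>\<psi>\<close> the identity\<close>
  have "\<exists>u\<in>\<T> - {\<zeta>}. ?\<psi> u \<noteq> u"
  proof (rule ccontr)
    assume "\<not> ?thesis"
    then have "\<T> - {\<zeta>} \<subseteq> {u. cmod u \<le> 1 \<and> ?\<psi> u = u}"
      by auto
    moreover have "infinite (\<T> - {\<zeta>})"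
      using infinite_unit_circle by simp
    ultimately have "infinite {u. cmod u \<le> 1 \<and> ?\<psi> u = u}"
      using finite_subset by blast
    from identity_if_infinitely_many_fixed_points[OF assms(2,4,5,3) this]
    have "?T = id_blinfun"
      by (intro blinfun_hardy_eqI) (simp add: val)
    then show False
      using not_id by blast
  qed
  then obtain u where "u \<in> \<T> - {\<zeta>}" "?\<psi> u \<noteq> u"
    by blast
  then have u: "cmod u = 1" "u \<noteq> \<zeta>" "?\<psi> u \<noteq> u"
    by simp_all
  define r where "r n = 1 - inverse (real (Suc (Suc n)))" for n
  have r: "0 < r n \<and> r n < 1" "r \<longlonglongrightarrow> 1" for n
    using radial_sequence(1,2)[of 1] by (auto simp: r_def[abs_def])
  have rad: "\<xi> * of_real (r n) \<in> \<D>" "(\<lambda>n. \<xi> * of_real (r n)) \<longlonglongrightarrow> \<xi>" if "cmod \<xi> = 1" for \<xi> n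
    using radial_sequence(3,4)[OF that] by (auto simp: r_def)
  have "c = 0"
  proof -
    let ?z = "\<lambda>n. u * of_real (r n)"
    note z = rad[OF u(1)]
    have "(\<lambda>n. of_real (1 - (cmod (?z n))\<^sup>2) / (1 - cnj (?z n) * ?\<psi> (?z n))) \<longlonglongrightarrow> of_real 0 / (1 - cnj u * ?\<psi> u)"
    proof (intro tendsto_intros tendsto_boundary_defect[OF z(2) u(1)] z(2) tendsto_lft assms)
      show "1 - cnj u * ?\<psi> u \<noteq> 0"
      proof
        assume "1 - cnj u * ?\<psi> u = 0"
        then have "u * (cnj u * ?\<psi> u) = u"
          by simp
        then show False
          using u(1,3) by (simp add: mult.assoc[symmetric] complex_norm_square[symmetric])
      qed
    qed (use u in auto)
    moreover have "hardy_cinner (?T (unit_kernel (?z n))) (unit_kernel (?z n))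
      = of_real (1 - (cmod (?z n))\<^sup>2) / (1 - cnj (?z n) * ?\<psi> (?z n))" for n
    proof -
      have "hardy_cinner (?T (unit_kernel (?z n))) (unit_kernel (?z n))
        = of_real (sqrt (1 - (cmod (?z n))\<^sup>2)) * (of_real (sqrt (1 - (cmod (?z n))\<^sup>2)) * (1 / (1 - cnj (?z n) * ?\<psi> (?z n))))"
        unfolding hardy_cinner_unit_kernel[OF z(1)] val[OF z(1)]
        by (simp only: unit_kernel_def hardy_fun_simps hardy_fun_kernel[OF z(1) self[OF z(1)]])
      also have "\<dots> = of_real (sqrt (1 - (cmod (?z n))\<^sup>2) * sqrt (1 - (cmod (?z n))\<^sup>2)) / (1 - cnj (?z n) * ?\<psi> (?z n))"
        by (simp del: real_sqrt_mult_self)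
      also have "sqrt (1 - (cmod (?z n))\<^sup>2) * sqrt (1 - (cmod (?z n))\<^sup>2) = 1 - (cmod (?z n))\<^sup>2"
        using disk_defect_pos[OF z(1)[of n]] by simp
      finally show ?thesis .
    qed
    ultimately have lim: "(\<lambda>n. hardy_cinner (?T (unit_kernel (?z n))) (unit_kernel (?z n))) \<longlonglongrightarrow> 0"
      by simp
    have "(\<lambda>n. hardy_cinner (?T (unit_kernel (?z n)) - c *\<^sub>C unit_kernel (?z n)) (unit_kernel (?z n))) \<longlonglongrightarrow> 0"
      using norm_unit_kernel[OF z(1)] by (intro asymp_eigen_cinner c kernel_sequencesI[OF z u(1,2)]) auto
    then have "(\<lambda>n. hardy_cinner (?T (unit_kernel (?z n))) (unit_kernel (?z n)) - c) \<longlonglongrightarrow> 0"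
      using norm_unit_kernel[OF z(1)] by (simp add: hardy_cinner.diff_left hardy_cinner_self)
    from tendsto_diff[OF lim this] show "c = 0"
      by (simp add: LIMSEQ_const_iff)
  qed
  \<comment> \<open>the pairing is bounded by the norm of the adjoint on kernels that approach a point other than \<open>\<zeta>\<close>\<close>
  have ratio: "(\<lambda>n. (1 - (cmod (z n))\<^sup>2) / (1 - (cmod (lft \<eta> l b (z n)))\<^sup>2)) \<longlonglongrightarrow> 0"
    if z: "\<And>n. z n \<in> \<D>" "z \<longlonglongrightarrow> \<xi>" "cmod \<xi> = 1" "\<xi> \<noteq> \<zeta>" for z \<xi>
  proof -
    have "(\<lambda>n. hardy_cinner (?T (unit_kernel (?\<psi> (z n))) - c *\<^sub>C unit_kernel (?\<psi> (z n))) (unit_kernel (z n))) \<longlonglongrightarrow> 0"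
      using norm_unit_kernel[OF self[OF z(1)]]
      by (intro asymp_eigen_cinner c kernel_sequencesI[OF z]) auto
    moreover have "hardy_cinner (?T (unit_kernel (?\<psi> (z n)))) (unit_kernel (z n))
      = of_real (sqrt ((1 - (cmod (z n))\<^sup>2) / (1 - (cmod (?\<psi> (z n)))\<^sup>2)))" for n
      unfolding hardy_cinner_unit_kernel[OF z(1)] val[OF z(1)] hardy_fun_unit_kernel_self[OF self[OF z(1)]]
      by (simp add: real_sqrt_divide)
    ultimately have "(\<lambda>n. complex_of_real (sqrt ((1 - (cmod (z n))\<^sup>2) / (1 - (cmod (?\<psi> (z n)))\<^sup>2)))) \<longlonglongrightarrow> of_real 0"
      by (simp add: \<open>c = 0\<close> hardy_scaleC.zero_left)
    then have "(\<lambda>n. sqrt ((1 - (cmod (z n))\<^sup>2) / (1 - (cmod (?\<psi> (z n)))\<^sup>2))) \<longlonglongrightarrow> 0"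
      by (simp only: tendsto_of_real_iff)
    from tendsto_power[OF this, of 2]
    have "(\<lambda>n. (sqrt ((1 - (cmod (z n))\<^sup>2) / (1 - (cmod (?\<psi> (z n)))\<^sup>2)))\<^sup>2) \<longlonglongrightarrow> 0"
      by simp
    moreover have "(sqrt ((1 - (cmod (z n))\<^sup>2) / (1 - (cmod (?\<psi> (z n)))\<^sup>2)))\<^sup>2
      = (1 - (cmod (z n))\<^sup>2) / (1 - (cmod (lft \<eta> l b (z n)))\<^sup>2)" for n
    proof -
      have "0 \<le> (1 - (cmod (z n))\<^sup>2) / (1 - (cmod (?\<psi> (z n)))\<^sup>2)"
        by (intro divide_nonneg_nonneg less_imp_le disk_defect_pos z self)
      then show ?thesis
        using assms(3) by (simp add: norm_mult)
    qed
    ultimately show ?thesis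
      by simp
  qed
  have "kap l b \<noteq> 0"
  proof
    assume k0: "kap l b = 0"
    let ?z = "\<lambda>n. u * of_real (r n)"
    note z = rad[OF u(1)]
    have "(\<lambda>n. (cmod (of_real l + b * gap \<eta> (?z n)))\<^sup>2 / l) \<longlonglongrightarrow> (cmod (of_real l + b * gap \<eta> u))\<^sup>2 / l"
      unfolding gap_def using assms(4) by (intro tendsto_intros z(2)) auto
    moreover have "(1 - (cmod (?z n))\<^sup>2) / (1 - (cmod (lft \<eta> l b (?z n)))\<^sup>2) = (cmod (of_real l + b * gap \<eta> (?z n)))\<^sup>2 / l" for n
      using one_minus_norm_lft[OF assms(2) _ assms(4,5), of "?z n"] z(1)[of n] disk_defect_pos[OF z(1)[of n]] k0
      by (simp add: less_imp_le)
    ultimately have "(\<lambda>n. (1 - (cmod (?z n))\<^sup>2) / (1 - (cmod (lft \<eta> l b (?z n)))\<^sup>2)) \<longlonglongrightarrow> (cmod (of_real l + b * gap \<eta> u))\<^sup>2 / l"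
      by simp
    from LIMSEQ_unique[OF this ratio[OF z u(1,2)]] show False
      using lfw_denominator_nonzero[OF assms(2) _ assms(4,5), of u] u(1) assms(4) by simp
  qed
  moreover have "\<eta> = \<zeta>"
  proof (rule ccontr)
    assume "\<eta> \<noteq> \<zeta>"
    from LIMSEQ_unique[OF radial_ratio[OF assms(2,4,5) r] ratio[OF rad[OF assms(2)] assms(2) this]]
    show False
      using assms(4) by simp
  qed
  moreover have "\<rho> = 1"
  proof (rule ccontr)
    assume "\<rho> \<noteq> 1"
    have \<eta>: "\<eta> = \<zeta>" "\<zeta> \<noteq> 0"
      using \<open>\<eta> = \<zeta>\<close> assms(1) by auto
    let ?w = "\<lambda>n. \<zeta> * of_real (r n)"
    note w = rad[OF assms(1)]
    have "(\<lambda>n. ?\<psi> (?w n)) \<longlonglongrightarrow> ?\<psi> \<zeta>"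
      by (intro tendsto_intros tendsto_lft w assms) (use assms in auto)
    also have "?\<psi> \<zeta> = \<rho> * \<zeta>"
      using gap_boundary_point[OF assms(1), of 1] by (simp add: lft_def \<eta>)
    finally have lim: "(\<lambda>n. ?\<psi> (?w n)) \<longlonglongrightarrow> \<rho> * \<zeta>" .
    have "\<rho> * \<zeta> \<noteq> \<zeta>" "cmod (\<rho> * \<zeta>) = 1"
      using \<open>\<rho> \<noteq> 1\<close> \<eta>(2) assms by (auto simp: norm_mult)
    then have "asymp_eigen (\<lambda>n. unit_kernel (?\<psi> (?w n))) ?T c"
      by (intro c kernel_sequencesI[OF self[OF w(1)] lim])
    from asymp_eigen_norm[OF this]
    have small: "(\<lambda>n. norm (?T (unit_kernel (?\<psi> (?w n))))) \<longlonglongrightarrow> 0"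
      by (simp add: \<open>c = 0\<close> hardy_scaleC.zero_left)
    have "sqrt ((1 - (cmod (?w n))\<^sup>2) / (1 - (cmod (lft \<zeta> l b (?w n)))\<^sup>2)) \<le> norm (?T (unit_kernel (?\<psi> (?w n))))" for n
    proof -
      have "hardy_cinner (?T (unit_kernel (?\<psi> (?w n)))) (unit_kernel (?w n))
        = of_real (sqrt ((1 - (cmod (?w n))\<^sup>2) / (1 - (cmod (?\<psi> (?w n)))\<^sup>2)))"
        unfolding hardy_cinner_unit_kernel[OF w(1)] val[OF w(1)] hardy_fun_unit_kernel_self[OF self[OF w(1)]]
        by (simp add: real_sqrt_divide)
      moreover have "0 \<le> (1 - (cmod (?w n))\<^sup>2) / (1 - (cmod (?\<psi> (?w n)))\<^sup>2)"
        by (intro divide_nonneg_nonneg less_imp_le disk_defect_pos w self)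
      ultimately have "sqrt ((1 - (cmod (?w n))\<^sup>2) / (1 - (cmod (?\<psi> (?w n)))\<^sup>2))
        = cmod (hardy_cinner (?T (unit_kernel (?\<psi> (?w n)))) (unit_kernel (?w n)))"
        by (simp only: norm_of_real abs_of_nonneg real_sqrt_ge_zero)
      also have "\<dots> \<le> norm (?T (unit_kernel (?\<psi> (?w n)))) * 1"
        using hardy_cinner_Cauchy_Schwarz norm_unit_kernel[OF w(1)] by metis
      finally show ?thesis
        using assms(3) by (simp add: norm_mult \<eta>)
    qed
    moreover have "(\<lambda>n. sqrt ((1 - (cmod (?w n))\<^sup>2) / (1 - (cmod (lft \<zeta> l b (?w n)))\<^sup>2))) \<longlonglongrightarrow> sqrt l"
      by (intro tendsto_real_sqrt radial_ratio assms r)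
    ultimately have "sqrt l \<le> 0"
      using small by (intro LIMSEQ_le[where X = "\<lambda>n. sqrt ((1 - (cmod (?w n))\<^sup>2) / (1 - (cmod (lft \<zeta> l b (?w n)))\<^sup>2))"]) auto
    then show False
      using assms(4) by simp
  qed
  ultimately show ?thesis
    using assms(5) by simp
qed

section \<open>Powers of the half-plane coordinate\<close>

text \<open>Orthogonality of the characters of the cyclic group of order \<open>m\<close>, the roots of unity being
  \<open>\<omega> k\<close>.\<close>

lemma discrete_Parseval:
  fixes b :: "nat \<Rightarrow> complex"
  assumes "0 < m"
  defines "\<omega> \<equiv> \<lambda>k. cis (2 * pi * real k / real m)"
  shows "(\<Sum>k<m. (cmod (\<Sum>n<m. b n * \<omega> k ^ n))\<^sup>2) = real m * (\<Sum>n<m. (cmod (b n))\<^sup>2)"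
proof -
  have orth: "(\<Sum>k<m. \<omega> k ^ i * cnj (\<omega> k ^ j)) = (if i = j then of_nat m else 0)"
    if "i < m" "j < m" for i j
  proof -
    define q where "q = \<omega> i * cnj (\<omega> j)"
    have swap: "\<omega> k ^ i * cnj (\<omega> k ^ j) = q ^ k" for k
    proof -
      have "\<omega> k ^ i * cnj (\<omega> k ^ j)
          = cis (real i * (2 * pi * real k / real m) + - (real j * (2 * pi * real k / real m)))"
        unfolding \<omega>_def Complex.DeMoivre cis_cnj cis_mult ..
      also have "real i * (2 * pi * real k / real m) + - (real j * (2 * pi * real k / real m))
          = real k * (2 * pi * real i / real m + - (2 * pi * real j / real m))"
        by (simp add: algebra_simps)
      also have "cis \<dots> = q ^ k"
        unfolding q_def \<omega>_def Complex.DeMoivre cis_cnj cis_mult ..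
      finally show ?thesis .
    qed
    show ?thesis
    proof (cases "i = j")
      case True
      have "q = 1"
        by (simp add: q_def True \<omega>_def cis_cnj cis_mult)
      then show ?thesis
        unfolding swap using True by simp
    next
      case False
      have "\<omega> i \<noteq> \<omega> j"
        using bij_betw_imp_inj_on[OF Complex.bij_betw_roots_unity[OF assms(1)]] False that
        unfolding \<omega>_def by (auto dest: inj_onD)
      moreover have "q * \<omega> j = \<omega> i"
        by (simp add: q_def \<omega>_def mult.assoc cis_cnj cis_mult)
      ultimately have "q \<noteq> 1"
        by auto
      moreover have "q ^ m = 1"
      proof -
        have "\<omega> k ^ m = 1" if "k < m" for k
          using bij_betw_apply[OF Complex.bij_betw_roots_unity[OF assms(1)], of k] that
          by (simp add: \<omega>_def)
        then show ?thesis
          using that by (simp add: q_def power_mult_distrib flip: complex_cnj_power)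
      qed
      ultimately show ?thesis
        unfolding swap using False by (simp add: sum_gp_strict)
    qed
  qed
  have "complex_of_real (\<Sum>k<m. (cmod (\<Sum>n<m. b n * \<omega> k ^ n))\<^sup>2)
    = (\<Sum>k<m. (\<Sum>i<m. b i * \<omega> k ^ i) * cnj (\<Sum>j<m. b j * \<omega> k ^ j))"
    unfolding of_real_sum by (intro sum.cong refl complex_norm_square)
  also have "\<dots> = (\<Sum>k<m. \<Sum>i<m. \<Sum>j<m. b i * cnj (b j) * (\<omega> k ^ i * cnj (\<omega> k ^ j)))"
    by (simp add: sum_product mult_ac)
  also have "\<dots> = (\<Sum>i<m. \<Sum>k<m. \<Sum>j<m. b i * cnj (b j) * (\<omega> k ^ i * cnj (\<omega> k ^ j)))"
    by (rule sum.swap)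
  also have "\<dots> = (\<Sum>i<m. \<Sum>j<m. \<Sum>k<m. b i * cnj (b j) * (\<omega> k ^ i * cnj (\<omega> k ^ j)))"
    by (intro sum.cong refl sum.swap)
  also have "\<dots> = (\<Sum>i<m. \<Sum>j<m. b i * cnj (b j) * (if i = j then of_nat m else 0))"
    by (intro sum.cong refl) (simp only: sum_distrib_left[symmetric] orth lessThan_iff)
  also have "\<dots> = (\<Sum>i<m. of_nat m * (b i * cnj (b i)))"
    by (intro sum.cong refl) (simp add: if_distrib cong: if_cong)
  also have "\<dots> = complex_of_real (real m * (\<Sum>n<m. (cmod (b n))\<^sup>2))"
    unfolding of_real_mult of_real_sum sum_distrib_left[symmetric] complex_norm_square by simp
  finally show ?thesis
    by (simp only: of_real_eq_iff)
qed

text \<open>On a circle of radius \<open>r < 1\<close> the power series is a polynomial of degree below \<open>m\<close> up to a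
  uniform error \<open>d\<close>, and the discrete Parseval identity bounds the coefficients of the
  polynomial by its values at \<open>m\<close> points of the circle. Then \<open>r\<close> tends to one.\<close>

lemma norm_hardy_le_sup:
  assumes bound: "\<And>z. z \<in> \<D> \<Longrightarrow> cmod (hardy_fun f z) \<le> M"
  shows "norm f \<le> M"
proof -
  let ?a = "hardy_coeff f"
  have M: "0 \<le> M"
    using bound[of 0] norm_ge_zero order_trans by (metis centre_in_ball zero_less_one)
  have on_circle: "(\<Sum>n<N. (cmod (?a n * of_real r ^ n))\<^sup>2) \<le> M\<^sup>2" if r: "0 < r" "r < 1" for N r
  proof -
    have rD: "complex_of_real r \<in> \<D>"
      using r by simp
    have abs_summable: "summable (\<lambda>n. cmod (?a n * of_real r ^ n))"
    proof -
      have "summable (\<lambda>n. (cmod (?a n))\<^sup>2 + (cmod (complex_of_real r ^ n))\<^sup>2)"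
        by (intro summable_add hardy_coeff_square_summable summable_powers_sq rD)
      then show ?thesis
      proof (rule summable_comparison_test'[where N = 0])
        fix n
        show "norm (cmod (?a n * of_real r ^ n)) \<le> (cmod (?a n))\<^sup>2 + (cmod (complex_of_real r ^ n))\<^sup>2"
          using sum_squares_bound[of "cmod (?a n)" "cmod (complex_of_real r ^ n)"]
            mult_nonneg_nonneg[OF norm_ge_zero norm_ge_zero, of "?a n" "complex_of_real r ^ n"]
          unfolding norm_mult real_norm_def abs_mult abs_norm_cancel by linarith
      qed
    qed
    show ?thesis
    proof (rule field_le_epsilon)
      fix e :: real assume e: "0 < e"
      \<comment> \<open>chosen such that \<open>(M + d)\<^sup>2 \<le> M\<^sup>2 + e\<close>\<close>
      define d where "d = min 1 (e / (2 * M + 1))"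
      have "d \<le> e / (2 * M + 1)"
        by (simp add: d_def)
      then have d: "0 < d" "d \<le> 1" "d * (2 * M + 1) \<le> e"
        using e M by (simp_all add: pos_le_divide_eq) (simp_all add: d_def add_nonneg_pos)
      obtain N' where N': "\<And>n. n \<ge> N' \<Longrightarrow> (\<Sum>k. cmod (?a (k + n) * of_real r ^ (k + n))) < d"
        using suminf_exist_split[OF d(1) abs_summable] by (auto simp: suminf_nonneg
            summable_ignore_initial_segment[OF abs_summable])
      define m where "m = max 1 (max N N')"
      have m: "0 < m" "N \<le> m" "N' \<le> m"
        by (auto simp: m_def)
      let ?b = "\<lambda>n. ?a n * of_real r ^ n"
      have poly: "cmod (\<Sum>n<m. ?b n * \<omega> ^ n) \<le> M + d" if \<omega>: "cmod \<omega> = 1" for \<omega>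
      proof -
        have z: "of_real r * \<omega> \<in> \<D>"
          using r \<omega> by (simp add: norm_mult)
        have "(\<lambda>n. ?b n * \<omega> ^ n) sums hardy_fun f (of_real r * \<omega>)"
          using hardy_sums[OF z, of f] by (simp add: power_mult_distrib mult.assoc)
        then have s: "summable (\<lambda>n. ?b n * \<omega> ^ n)" "hardy_fun f (of_real r * \<omega>) = (\<Sum>n. ?b n * \<omega> ^ n)"
          by (auto simp: sums_iff)
        have ns: "summable (\<lambda>n. cmod (?b (n + m) * \<omega> ^ (n + m)))"
          using summable_ignore_initial_segment[OF abs_summable, of m] \<omega> by (simp add: norm_mult norm_power)
        have "(\<Sum>n<m. ?b n * \<omega> ^ n) = hardy_fun f (of_real r * \<omega>) - (\<Sum>n. ?b (n + m) * \<omega> ^ (n + m))"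
          unfolding s(2) using suminf_split_initial_segment[OF s(1), of m] by simp
        then have "cmod (\<Sum>n<m. ?b n * \<omega> ^ n) \<le> cmod (hardy_fun f (of_real r * \<omega>)) + cmod (\<Sum>n. ?b (n + m) * \<omega> ^ (n + m))"
          by (simp only: norm_triangle_ineq4)
        also have "\<dots> \<le> M + (\<Sum>n. cmod (?b (n + m) * \<omega> ^ (n + m)))"
          by (intro add_mono bound z summable_norm ns)
        also have "(\<Sum>n. cmod (?b (n + m) * \<omega> ^ (n + m))) = (\<Sum>n. cmod (?b (n + m)))"
          using \<omega> by (simp add: norm_mult norm_power)
        also have "M + \<dots> \<le> M + d"
          using N'[OF m(3)] by simp
        finally show ?thesis .
      qed
      have "real m * (\<Sum>n<m. (cmod (?b n))\<^sup>2)
        = (\<Sum>k<m. (cmod (\<Sum>n<m. ?b n * cis (2 * pi * real k / real m) ^ n))\<^sup>2)"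
        by (rule discrete_Parseval[OF m(1), symmetric])
      also have "\<dots> \<le> (\<Sum>k<m. (M + d)\<^sup>2)"
        by (intro sum_mono power_mono poly) auto
      also have "\<dots> = real m * (M + d)\<^sup>2"
        by simp
      finally have "(\<Sum>n<m. (cmod (?b n))\<^sup>2) \<le> (M + d)\<^sup>2"
        using m(1) by simp
      moreover have "(\<Sum>n<N. (cmod (?b n))\<^sup>2) \<le> (\<Sum>n<m. (cmod (?b n))\<^sup>2)"
        using m(2) by (intro sum_mono2) auto
      moreover have "(M + d)\<^sup>2 = M\<^sup>2 + d * (2 * M + d)"
        by (simp add: power2_eq_square algebra_simps)
      moreover have "d * (2 * M + d) \<le> d * (2 * M + 1)"
        using d by (intro mult_left_mono) auto
      ultimately show "(\<Sum>n<N. (cmod (?b n))\<^sup>2) \<le> M\<^sup>2 + e"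
        using d(3) by linarith
    qed
  qed
  have "(\<Sum>n<N. (cmod (?a n))\<^sup>2) \<le> M\<^sup>2" for N
  proof -
    have "(\<lambda>k. \<Sum>n<N. (cmod (?a n * of_real (1 - inverse (real (Suc (Suc k)))) ^ n))\<^sup>2)
      \<longlonglongrightarrow> (\<Sum>n<N. (cmod (?a n * of_real 1 ^ n))\<^sup>2)"
      by (intro tendsto_intros radial_sequence(2)[of 1]) simp
    moreover have "(\<Sum>n<N. (cmod (?a n * of_real (1 - inverse (real (Suc (Suc k)))) ^ n))\<^sup>2) \<le> M\<^sup>2" for k
      by (rule on_circle) (use radial_sequence(1)[of 1 k] in auto)
    ultimately have "(\<Sum>n<N. (cmod (?a n * of_real 1 ^ n))\<^sup>2) \<le> M\<^sup>2"
      by (intro LIMSEQ_le_const2) blast+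
    then show ?thesis by simp
  qed
  then show ?thesis
    using norm_hardy_le_iff[OF M] by blast
qed

text \<open>The binomial series of \<open>(1 - cnj \<zeta> z) powr (- \<alpha>)\<close>; its coefficients are of order
  \<open>n powr (Re \<alpha> - 1)\<close> and so are square summable.\<close>

lemma half_plane_power_exists:
  assumes "cmod \<zeta> = 1" "Re \<alpha> < 1 / 2"
  shows "\<exists>g. (\<forall>z\<in>\<D>. hardy_fun g z = (1 / gap \<zeta> z) powr \<alpha>) \<and>
    (\<forall>n. hardy_coeff g n = pochhammer \<alpha> n / fact n * cnj \<zeta> ^ n)"
proof -
  have s: "summable (\<lambda>n. (cmod (pochhammer \<alpha> n / fact n * cnj \<zeta> ^ n))\<^sup>2)"
    using summable_pochhammer_powr[of \<alpha> 2] assms by (simp add: norm_mult norm_power norm_divide)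
  have "(\<lambda>n. (pochhammer \<alpha> n / fact n * cnj \<zeta> ^ n) * z ^ n) sums ((1 / gap \<zeta> z) powr \<alpha>)"
    if z: "z \<in> \<D>" for z
  proof -
    have "cmod (- (cnj \<zeta> * z)) < 1"
      using z assms(1) by (simp add: norm_mult)
    from gen_binomial_complex[OF this, of "- \<alpha>"]
    have "(\<lambda>n. (- \<alpha> gchoose n) * (- (cnj \<zeta> * z)) ^ n) sums gap \<zeta> z powr - \<alpha>"
      by (simp add: gap_def)
    moreover have "(- \<alpha> gchoose n) * (- (cnj \<zeta> * z)) ^ n = (pochhammer \<alpha> n / fact n * cnj \<zeta> ^ n) * z ^ n" for n
      by (simp add: gbinomial_pochhammer power_mult_distrib[symmetric] mult.assoc[symmetric])
    moreover have "gap \<zeta> z powr - \<alpha> = (1 / gap \<zeta> z) powr \<alpha>"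
    proof -
      have "gap \<zeta> z \<noteq> 0"
        using gap_zero_iff[OF assms(1)] z assms(1) by auto
      have "0 < Re (1 / gap \<zeta> z)"
        using Re_inverse_gap[OF assms(1) z] by simp
      then have "1 / gap \<zeta> z \<notin> \<real>\<^sub>\<le>\<^sub>0"
        by (auto simp: complex_nonpos_Reals_iff)
      from Ln_inverse[OF this] show ?thesis
        using \<open>gap \<zeta> z \<noteq> 0\<close> by (simp add: powr_def inverse_eq_divide)
    qed
    ultimately show ?thesis by simp
  qed
  from hardy_from_power_series[OF s this] show ?thesis by blast
qed

definition half_plane_power :: "complex \<Rightarrow> complex \<Rightarrow> hardy"
  where "half_plane_power \<zeta> \<alpha> = (SOME g. (\<forall>z\<in>\<D>. hardy_fun g z = (1 / gap \<zeta> z) powr \<alpha>) \<and>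
    (\<forall>n. hardy_coeff g n = pochhammer \<alpha> n / fact n * cnj \<zeta> ^ n))"

lemma
  assumes "cmod \<zeta> = 1" "Re \<alpha> < 1 / 2"
  shows hardy_fun_half_plane_power: "z \<in> \<D> \<Longrightarrow> hardy_fun (half_plane_power \<zeta> \<alpha>) z = (1 / gap \<zeta> z) powr \<alpha>"
    and hardy_coeff_half_plane_power: "hardy_coeff (half_plane_power \<zeta> \<alpha>) n = pochhammer \<alpha> n / fact n * cnj \<zeta> ^ n"
  using someI_ex[OF half_plane_power_exists[OF assms]] unfolding half_plane_power_def by blast+

lemma norm_powr_right_half_plane:
  assumes "0 < Re s"
  shows "cmod (s powr \<beta>) \<le> cmod s powr Re \<beta> * exp (\<bar>Im \<beta>\<bar> * (pi / 2))"
proof -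
  have s: "s \<noteq> 0"
    using assms by auto
  have "\<bar>Im (Ln s)\<bar> < pi / 2"
    using Re_Ln_pos_lt[OF s] assms by blast
  then have "\<bar>Im \<beta> * Im (Ln s)\<bar> \<le> \<bar>Im \<beta>\<bar> * (pi / 2)"
    unfolding abs_mult by (intro mult_left_mono) auto
  then have "- (Im \<beta> * Im (Ln s)) \<le> \<bar>Im \<beta>\<bar> * (pi / 2)"
    by linarith
  moreover have "cmod (s powr \<beta>) = exp (Re \<beta> * ln (cmod s)) * exp (- (Im \<beta> * Im (Ln s)))"
    using s by (simp add: powr_def norm_exp_eq_Re exp_diff exp_minus divide_inverse)
  moreover have "cmod s powr Re \<beta> = exp (Re \<beta> * ln (cmod s))"
    using s by (simp add: powr_def)
  ultimately show ?thesis
    by (simp add: mult_left_mono)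
qed

text \<open>By the mean value inequality on the segment from \<open>l w\<close> to \<open>l w + b\<close>. There the real parts
  are at least \<open>c\<close>, so the derivative of the power is of order \<open>1 / cmod s\<close>, and \<open>cmod s\<close> is
  comparable with \<open>cmod w\<close>: for large \<open>w\<close> because \<open>b\<close> is negligible, otherwise because
  \<open>cmod s \<ge> c\<close>. What matters is that the bound is uniform in \<open>w\<close>, and in \<open>\<alpha>\<close> as long as its
  imaginary part is fixed.\<close>

lemma powr_difference_bound:
  fixes w b \<alpha> :: complex and l :: real
  assumes w: "1 / 2 < Re w" and v: "1 / 2 < Re (of_real l * w + b)" and l: "0 < l"
    and \<alpha>: "0 \<le> Re \<alpha>" "Re \<alpha> < 1 / 2"
  defines "c \<equiv> min l 1 / 2"
  shows "cmod (w * ((of_real l * w + b) powr (\<alpha> - 1) - (of_real l * w) powr (\<alpha> - 1)))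
    \<le> (2 / l + 2 * cmod b / (l * c)) * ((1 + \<bar>Im \<alpha>\<bar>) * (1 / c) * exp (\<bar>Im \<alpha>\<bar> * (pi / 2)) * cmod b)"
proof -
  define K where "K = 2 / l + 2 * cmod b / (l * c)"
  define E where "E = (1 + \<bar>Im \<alpha>\<bar>) * (1 / c) * exp (\<bar>Im \<alpha>\<bar> * (pi / 2))"
  let ?S = "closed_segment (of_real l * w) (of_real l * w + b)"
  have c: "0 < c" "c < 1"
    using l by (auto simp: c_def min_def)
  have w0: "0 < cmod w"
    using w by auto
  have seg: "c \<le> Re s \<and> cmod w \<le> K * cmod s" if "s \<in> ?S" for s
  proof -
    from that obtain u where u: "0 \<le> u" "u \<le> 1"
      and s_eq: "s = (1 - u) *\<^sub>R (of_real l * w) + u *\<^sub>R (of_real l * w + b)"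
      unfolding in_segment by metis
    have "l * (1 / 2) \<le> l * Re w"
      using w l by (intro mult_left_mono) auto
    moreover have "c \<le> l * (1 / 2)" "c \<le> 1 / 2"
      by (auto simp: c_def)
    ultimately have "c \<le> l * Re w" "c \<le> Re (of_real l * w + b)"
      using v by linarith+
    then have "(1 - u) * c + u * c \<le> (1 - u) * (l * Re w) + u * Re (of_real l * w + b)"
      using u by (intro add_mono mult_left_mono) auto
    then have c_le: "c \<le> Re s"
      unfolding s_eq by (simp add: algebra_simps)
    then have c_norm: "c \<le> cmod s"
      using complex_Re_le_cmod order_trans by blast
    have "cmod w \<le> K * cmod s"
    proof (cases "2 * cmod b \<le> l * cmod w")
      case True
      have s: "s = of_real l * w - (- u *\<^sub>R b)"
        unfolding s_eq by (simp add: algebra_simps)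
      have "cmod (of_real l * w) - cmod (- u *\<^sub>R b) \<le> cmod s"
        unfolding s by (rule norm_triangle_ineq2)
      moreover have "cmod (- u *\<^sub>R b) \<le> 1 * cmod b"
        using u by (simp add: mult_left_le_one_le)
      ultimately have "l * cmod w / 2 \<le> cmod s"
        using True l by (simp add: norm_mult)
      then have "cmod w \<le> 2 / l * cmod s"
        using l by (simp add: field_simps)
      also have "\<dots> \<le> K * cmod s"
        using c l by (intro mult_right_mono) (auto simp: K_def)
      finally show ?thesis .
    next
      case False
      then have "cmod w \<le> 2 * cmod b / l"
        using l by (simp add: field_simps)
      also have "\<dots> = 2 * cmod b / (l * c) * c"
        using c by simp
      also have "\<dots> \<le> K * cmod s"
        using c l c_norm by (intro mult_mono) (auto simp: K_def)
      finally show ?thesis .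
    qed
    with c_le show ?thesis by blast
  qed
  have deriv_bound: "cmod ((\<alpha> - 1) * s powr (\<alpha> - 1 - 1)) \<le> E * K / cmod w" if s: "s \<in> ?S" for s
  proof -
    have Re: "c \<le> Re s" and sK: "cmod w \<le> K * cmod s"
      using seg[OF s] by auto
    then have s0: "0 < Re s" "c \<le> cmod s" "0 < cmod s"
      using c complex_Re_le_cmod[of s] by auto
    have "cmod s powr (Re \<alpha> - 1) \<le> c powr (Re \<alpha> - 1)"
      using s0 c \<alpha> by (intro powr_mono2') auto
    also have "\<dots> \<le> c powr (- 1)"
      using c \<alpha> by (intro powr_mono') auto
    also have "\<dots> = 1 / c"
      using c by (simp add: powr_minus divide_inverse)
    finally have p: "cmod s powr (Re \<alpha> - 1) \<le> 1 / c" .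
    have "cmod (s powr (\<alpha> - 1 - 1)) \<le> cmod s powr (Re \<alpha> - 1 - 1) * exp (\<bar>Im \<alpha>\<bar> * (pi / 2))"
      using norm_powr_right_half_plane[OF s0(1), of "\<alpha> - 1 - 1"] by simp
    also have "cmod s powr (Re \<alpha> - 1 - 1) = cmod s powr (Re \<alpha> - 1) / cmod s"
      using s0 by (subst powr_diff) simp
    also have "\<dots> \<le> 1 / c / cmod s"
      using s0 p by (intro divide_right_mono) auto
    also have "\<dots> \<le> 1 / c * (K / cmod w)"
    proof -
      have "1 / cmod s \<le> K / cmod w"
        using s0 w0 sK by (simp add: field_simps)
      then have "1 / c * (1 / cmod s) \<le> 1 / c * (K / cmod w)"
        using c by (intro mult_left_mono) auto
      then show ?thesis by simp
    qed
    finally have a: "cmod (s powr (\<alpha> - 1 - 1)) \<le> 1 / c * (K / cmod w) * exp (\<bar>Im \<alpha>\<bar> * (pi / 2))"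
      by (simp add: mult_right_mono)
    have "cmod (\<alpha> - 1) \<le> \<bar>Re (\<alpha> - 1)\<bar> + \<bar>Im (\<alpha> - 1)\<bar>"
      by (rule cmod_le)
    also have "\<dots> \<le> 1 + \<bar>Im \<alpha>\<bar>"
      using \<alpha> by simp
    finally have "cmod (\<alpha> - 1) \<le> 1 + \<bar>Im \<alpha>\<bar>" .
    then have "cmod (\<alpha> - 1) * cmod (s powr (\<alpha> - 1 - 1))
      \<le> (1 + \<bar>Im \<alpha>\<bar>) * (1 / c * (K / cmod w) * exp (\<bar>Im \<alpha>\<bar> * (pi / 2)))"
      by (intro mult_mono a) auto
    then show ?thesis
      by (simp add: norm_mult E_def mult_ac)
  qed
  have "cmod ((of_real l * w + b) powr (\<alpha> - 1) - (of_real l * w) powr (\<alpha> - 1))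
    \<le> E * K / cmod w * cmod ((of_real l * w + b) - of_real l * w)"
  proof (rule field_differentiable_bound[OF convex_closed_segment _ deriv_bound])
    fix s assume "s \<in> ?S"
    then have "s \<notin> \<real>\<^sub>\<le>\<^sub>0"
      using seg[of s] c by (auto simp: complex_nonpos_Reals_iff)
    then show "((\<lambda>s. s powr (\<alpha> - 1)) has_field_derivative (\<alpha> - 1) * s powr (\<alpha> - 1 - 1)) (at s within ?S)"
      by (rule has_field_derivative_at_within[OF has_field_derivative_powr])
  qed auto
  then have "cmod w * cmod ((of_real l * w + b) powr (\<alpha> - 1) - (of_real l * w) powr (\<alpha> - 1))
    \<le> cmod w * (E * K / cmod w * cmod b)"
    by (intro mult_left_mono) auto
  also have "\<dots> = K * (E * cmod b)"
    using w0 by simp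
  finally show ?thesis
    unfolding norm_mult K_def E_def .
qed

text \<open>With the constant \<open>b = 0\<close> the power would be an exact eigenvector. The error caused by \<open>b\<close>
  is a bounded function by the preceding estimate.\<close>

lemma Wop_half_plane_power:
  assumes \<zeta>: "cmod \<zeta> = 1" and l: "0 < l" "0 \<le> kap l b" and \<alpha>: "0 \<le> Re \<alpha>" "Re \<alpha> < 1 / 2"
  defines "c \<equiv> min l 1 / 2"
  shows "norm (Wop \<zeta> l b (half_plane_power \<zeta> \<alpha>) - exp ((\<alpha> - 1) * of_real (ln l)) *\<^sub>C half_plane_power \<zeta> \<alpha>)
    \<le> (2 / l + 2 * cmod b / (l * c)) * ((1 + \<bar>Im \<alpha>\<bar>) * (1 / c) * exp (\<bar>Im \<alpha>\<bar> * (pi / 2)) * cmod b)"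
proof (rule norm_hardy_le_sup)
  fix z assume z: "z \<in> \<D>"
  let ?p = "gap \<zeta> z"
  define w where "w = 1 / ?p"
  define v where "v = of_real l * w + b"
  have p: "?p \<noteq> 0"
    using gap_zero_iff[OF \<zeta>] z \<zeta> by auto
  have d: "of_real l + b * ?p \<noteq> 0"
    using z by (intro lfw_denominator_nonzero assms) auto
  have lz: "lft \<zeta> l b z \<in> \<D>"
    by (rule lft_in_disk[OF \<zeta> z l])
  have v_eq: "v = (of_real l + b * ?p) / ?p"
    using p by (simp add: v_def w_def add_divide_distrib)
  have gl: "1 / gap \<zeta> (lft \<zeta> l b z) = v"
    by (simp add: gap_lft[OF \<zeta>] lfw_def v_eq)
  have w: "1 / 2 < Re w"
    unfolding w_def by (rule Re_inverse_gap[OF \<zeta> z])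
  have v: "1 / 2 < Re v"
    using Re_inverse_gap[OF \<zeta> lz] by (simp only: gl)
  have nz: "w \<noteq> 0" "v \<noteq> 0"
    using w v by auto
  have "lfw \<zeta> l b z = w / v"
    using p d by (simp add: lfw_def w_def v_eq)
  then have "hardy_fun (Wop \<zeta> l b (half_plane_power \<zeta> \<alpha>)) z = w / v * v powr \<alpha>"
    using z lz by (simp add: hardy_fun_Wop[OF \<zeta> l] hardy_fun_half_plane_power[OF \<zeta> \<alpha>(2)] gl del: mem_ball)
  also have "\<dots> = w * v powr (\<alpha> - 1)"
    using nz by (simp add: powr_def left_diff_distrib exp_diff)
  finally have a: "hardy_fun (Wop \<zeta> l b (half_plane_power \<zeta> \<alpha>)) z = w * v powr (\<alpha> - 1)" .
  have "Ln (of_real l * w) = of_real (ln l) + Ln w"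
    using Ln_times_of_real[of l w] l(1) nz(1) by (simp add: Ln_of_real)
  then have "w * (of_real l * w) powr (\<alpha> - 1) = exp ((\<alpha> - 1) * of_real (ln l)) * (w * (exp (\<alpha> * Ln w) / exp (Ln w)))"
    using nz l by (simp add: powr_def distrib_left exp_add left_diff_distrib exp_diff)
  then have b: "w * (of_real l * w) powr (\<alpha> - 1) = exp ((\<alpha> - 1) * of_real (ln l)) * w powr \<alpha>"
    using nz by (simp add: powr_def)
  have "hardy_fun (Wop \<zeta> l b (half_plane_power \<zeta> \<alpha>) - exp ((\<alpha> - 1) * of_real (ln l)) *\<^sub>C half_plane_power \<zeta> \<alpha>) z
    = w * (v powr (\<alpha> - 1) - (of_real l * w) powr (\<alpha> - 1))"
    using z by (simp add: a b right_diff_distrib hardy_fun_half_plane_power[OF \<zeta> \<alpha>(2)] w_def[symmetric])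
  then show "cmod (hardy_fun (Wop \<zeta> l b (half_plane_power \<zeta> \<alpha>)
      - exp ((\<alpha> - 1) * of_real (ln l)) *\<^sub>C half_plane_power \<zeta> \<alpha>) z)
    \<le> (2 / l + 2 * cmod b / (l * c)) * ((1 + \<bar>Im \<alpha>\<bar>) * (1 / c) * exp (\<bar>Im \<alpha>\<bar> * (pi / 2)) * cmod b)"
    unfolding c_def using powr_difference_bound[OF w _ l(1) \<alpha>, of b] v by (simp only: v_def)
qed

section \<open>Critical powers as asymptotic eigenvectors\<close>

text \<open>The shift by two keeps the real part in \<open>[0, 1/2)\<close> from the first term on.\<close>

definition critical_exponent :: "real \<Rightarrow> nat \<Rightarrow> complex"
  where "critical_exponent \<xi> k = Complex (1 / 2 - inverse (real (Suc (Suc k)))) \<xi>"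

lemma critical_exponent_Re: "0 \<le> Re (critical_exponent \<xi> k)" "Re (critical_exponent \<xi> k) < 1 / 2"
  by (simp_all add: critical_exponent_def field_simps)

lemma critical_exponent_Im [simp]: "Im (critical_exponent \<xi> k) = \<xi>"
  by (simp add: critical_exponent_def)

lemma critical_exponent_tendsto: "critical_exponent \<xi> \<longlonglongrightarrow> Complex (1 / 2) \<xi>"
proof -
  have "(\<lambda>k. Complex (1 / 2 - inverse (real (Suc (Suc k)))) \<xi>) \<longlonglongrightarrow> Complex (1 / 2 - 0) \<xi>"
    by (intro tendsto_Complex tendsto_intros LIMSEQ_Suc[OF LIMSEQ_inverse_real_of_nat])
  then show ?thesis
    by (simp add: critical_exponent_def[abs_def])
qed

text \<open>Consecutive quotients are bounded below by \<open>(n + 3/2)\<^sup>2 / (n + 2)\<^sup>2 \<ge> (n + 1) / (n + 2)\<close>,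
  the quotients of the harmonic series.\<close>

lemma pochhammer_half_lower_bound:
  "1 / (4 * real (Suc n)) \<le> (cmod (pochhammer (Complex (1 / 2) \<xi>) (Suc n) / fact (Suc n)))\<^sup>2"
proof (induction n)
  case 0
  have "(1 / 2)\<^sup>2 \<le> (cmod (Complex (1 / 2) \<xi>))\<^sup>2"
    using complex_Re_le_cmod[of "Complex (1 / 2) \<xi>"] by (intro power_mono) auto
  then show ?case
    by (simp add: power2_eq_square)
next
  case (Suc n)
  let ?\<alpha> = "Complex (1 / 2) \<xi>"
  let ?N = "real (Suc (Suc n))"
  have "(real n + 3 / 2)\<^sup>2 \<le> (cmod (?\<alpha> + of_nat (Suc n)))\<^sup>2"
    using complex_Re_le_cmod[of "?\<alpha> + of_nat (Suc n)"] by (intro power_mono) auto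
  moreover have "real (Suc n) * ?N \<le> (real n + 3 / 2)\<^sup>2"
    by (simp add: power2_eq_square algebra_simps)
  ultimately have "real (Suc n) * ?N \<le> (cmod (?\<alpha> + of_nat (Suc n)))\<^sup>2"
    by (rule order_trans[rotated])
  then have "real (Suc n) * ?N / ?N\<^sup>2 \<le> (cmod (?\<alpha> + of_nat (Suc n)))\<^sup>2 / ?N\<^sup>2"
    by (intro divide_right_mono) auto
  then have "real (Suc n) / ?N \<le> (cmod (?\<alpha> + of_nat (Suc n)) / ?N)\<^sup>2"
    by (simp add: power2_eq_square power_divide)
  then have "1 / (4 * real (Suc n)) * (real (Suc n) / ?N)
    \<le> (cmod (pochhammer ?\<alpha> (Suc n) / fact (Suc n)))\<^sup>2 * (cmod (?\<alpha> + of_nat (Suc n)) / ?N)\<^sup>2"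
    by (intro mult_mono Suc) auto
  also have "\<dots> = (cmod (pochhammer ?\<alpha> (Suc (Suc n)) / fact (Suc (Suc n))))\<^sup>2"
  proof -
    have "pochhammer ?\<alpha> (Suc (Suc n)) / fact (Suc (Suc n))
      = pochhammer ?\<alpha> (Suc n) / fact (Suc n) * ((?\<alpha> + of_nat (Suc n)) / of_nat (Suc (Suc n)))"
      by (subst pochhammer_Suc, subst fact_Suc) simp
    then have "cmod (pochhammer ?\<alpha> (Suc (Suc n)) / fact (Suc (Suc n)))
      = cmod (pochhammer ?\<alpha> (Suc n) / fact (Suc n)) * (cmod (?\<alpha> + of_nat (Suc n)) / ?N)"
      by (simp only: norm_mult norm_divide norm_of_nat)
    then show ?thesis
      by (simp only: power_mult_distrib)
  qed
  also have "1 / (4 * real (Suc n)) * (real (Suc n) / ?N) = 1 / (4 * ?N)"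
    by (simp del: of_nat_Suc)
  finally show ?case .
qed

lemma tendsto_pochhammer:
  fixes a :: "nat \<Rightarrow> complex"
  assumes "a \<longlonglongrightarrow> \<alpha>"
  shows "(\<lambda>k. pochhammer (a k) n) \<longlonglongrightarrow> pochhammer \<alpha> n"
  unfolding pochhammer_prod by (intro tendsto_intros assms)

text \<open>At the limiting exponent the squares of the coefficients dominate a multiple of the harmonic
  series. A finite partial sum that exceeds a given bound does so for nearby exponents too.\<close>

lemma norm_critical_power_at_top:
  assumes "cmod \<zeta> = 1"
  shows "filterlim (\<lambda>k. norm (half_plane_power \<zeta> (critical_exponent \<xi> k))) at_top sequentially"
  unfolding filterlim_at_top
proof
  fix Z :: real
  define C where "C = max Z 0"
  let ?\<alpha> = "Complex (1 / 2) \<xi>"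
  let ?a = "\<lambda>\<alpha> n. (cmod (pochhammer \<alpha> n / fact n :: complex))\<^sup>2"
  have "\<exists>N. C\<^sup>2 < (\<Sum>n<N. ?a ?\<alpha> n)"
  proof (rule ccontr)
    assume "\<not> ?thesis"
    then have "(\<Sum>n<N. ?a ?\<alpha> n) \<le> C\<^sup>2" for N
      by (simp add: not_less)
    then have "summable (?a ?\<alpha>)"
      by (intro bounded_imp_summable[of _ "C\<^sup>2"]) (auto simp: lessThan_Suc_atMost[symmetric] simp del: sum.lessThan_Suc)
    then have "summable (\<lambda>n. ?a ?\<alpha> (Suc n))"
      by (rule summable_Suc_iff[THEN iffD2])
    then have "summable (\<lambda>n. 1 / (4 * real (Suc n)))"
      by (rule summable_comparison_test'[where N = 0]) (use pochhammer_half_lower_bound in simp)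
    then have "summable (\<lambda>n. 4 * (1 / (4 * real (Suc n))))"
      by (rule summable_mult)
    also have "(\<lambda>n. 4 * (1 / (4 * real (Suc n)))) = (\<lambda>n. inverse (real (Suc n)))"
      by (simp add: fun_eq_iff inverse_eq_divide del: of_nat_Suc)
    finally have "summable (\<lambda>n. inverse (real (Suc n)))" .
    then have "summable (\<lambda>n. inverse (real n))"
      by (subst (asm) summable_Suc_iff)
    then show False
      using not_summable_harmonic[where 'a = real] by simp
  qed
  then obtain N where N: "C\<^sup>2 < (\<Sum>n<N. ?a ?\<alpha> n)"
    by blast
  have "(\<lambda>k. \<Sum>n<N. ?a (critical_exponent \<xi> k) n) \<longlonglongrightarrow> (\<Sum>n<N. ?a ?\<alpha> n)"
    by (intro tendsto_intros tendsto_pochhammer critical_exponent_tendsto) auto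
  from order_tendstoD(1)[OF this N]
  show "\<forall>\<^sub>F k in sequentially. Z \<le> norm (half_plane_power \<zeta> (critical_exponent \<xi> k))"
  proof eventually_elim
    case (elim k)
    let ?g = "half_plane_power \<zeta> (critical_exponent \<xi> k)"
    have "(\<Sum>n<N. ?a (critical_exponent \<xi> k) n) = (\<Sum>n<N. (cmod (hardy_coeff ?g n))\<^sup>2)"
      using assms
      by (simp add: hardy_coeff_half_plane_power[OF assms critical_exponent_Re(2)] norm_mult norm_power norm_divide)
    also have "\<dots> \<le> (norm ?g)\<^sup>2"
      using norm_hardy_le_iff[of "norm ?g" ?g] by (meson norm_ge_zero order_refl)
    finally have "C\<^sup>2 < (norm ?g)\<^sup>2"
      using elim by simp
    then have "C < norm ?g"
      by (rule power2_less_imp_less) simp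
    then show ?case
      by (simp add: C_def)
  qed
qed

definition critical_sequence :: "complex \<Rightarrow> real \<Rightarrow> nat \<Rightarrow> hardy"
  where "critical_sequence \<zeta> \<xi> k = (1 / norm (half_plane_power \<zeta> (critical_exponent \<xi> k))) *\<^sub>R
    half_plane_power \<zeta> (critical_exponent \<xi> k)"

lemma norm_critical_sequence:
  assumes "cmod \<zeta> = 1"
  shows "norm (critical_sequence \<zeta> \<xi> k) = 1"
proof -
  have "hardy_coeff (half_plane_power \<zeta> (critical_exponent \<xi> k)) 0 = 1"
    by (simp add: hardy_coeff_half_plane_power[OF assms critical_exponent_Re(2)])
  then have "half_plane_power \<zeta> (critical_exponent \<xi> k) \<noteq> 0"
    by (metis hardy_coeff_simps(3) zero_neq_one)
  then show ?thesis
    by (simp add: critical_sequence_def)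
qed

lemma weakly_null_critical_sequence:
  assumes "cmod \<zeta> = 1"
  shows "weakly_null (critical_sequence \<zeta> \<xi>)"
proof (rule weakly_null_if_coeffs[OF norm_critical_sequence[OF assms]])
  fix n
  let ?N = "\<lambda>k. norm (half_plane_power \<zeta> (critical_exponent \<xi> k))"
  have inv: "(\<lambda>k. inverse (?N k)) \<longlonglongrightarrow> 0"
    by (rule tendsto_inverse_0_at_top[OF norm_critical_power_at_top[OF assms]])
  have "(\<lambda>k. of_real (inverse (?N k)) * (pochhammer (critical_exponent \<xi> k) n / fact n * cnj \<zeta> ^ n))
    \<longlonglongrightarrow> of_real 0 * (pochhammer (Complex (1 / 2) \<xi>) n / fact n * cnj \<zeta> ^ n)"
    by (intro tendsto_intros inv tendsto_pochhammer critical_exponent_tendsto) auto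
  moreover have "hardy_coeff (critical_sequence \<zeta> \<xi> k) n
    = of_real (inverse (?N k)) * (pochhammer (critical_exponent \<xi> k) n / fact n * cnj \<zeta> ^ n)" for k
    unfolding critical_sequence_def hardy_coeff_simps'
      hardy_coeff_half_plane_power[OF assms critical_exponent_Re(2)] inverse_eq_divide ..
  ultimately show "(\<lambda>k. hardy_coeff (critical_sequence \<zeta> \<xi> k) n) \<longlonglongrightarrow> 0"
    by (simp only: of_real_0 mult_zero_left)
qed

text \<open>If the eigenvalue has the largest modulus that the norm of the adjoint \<open>S\<close> permits, the
  adjoint condition is automatic: expanding \<open>\<parallel>S g - cnj c g\<parallel>\<^sup>2\<close> gives at most
  \<open>2 (cmod c)\<^sup>2 - 2 Re (c * cnj \<langle>T g, g\<rangle>)\<close>, where \<open>\<langle>T g, g\<rangle>\<close> is close to \<open>c\<close>.\<close>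

lemma asymp_eigen_extremal:
  fixes S T :: "hardy \<Rightarrow>\<^sub>L hardy"
  assumes adj: "\<And>f h. hardy_cinner (T f) h = hardy_cinner f (S h)"
    and S: "\<And>f. norm (S f) \<le> cmod c * norm f" and unit: "\<And>n. norm (g n) = 1"
    and lim: "(\<lambda>n. norm (T (g n) - c *\<^sub>C g n)) \<longlonglongrightarrow> 0"
  shows "asymp_eigen g T c"
proof (rule asymp_eigenI[OF lim])
  let ?d = "\<lambda>n. norm (T (g n) - c *\<^sub>C g n)"
  have "(\<lambda>n. sqrt (2 * cmod c * ?d n)) \<longlonglongrightarrow> sqrt (2 * cmod c * 0)"
    by (intro tendsto_intros lim)
  then show "(\<lambda>n. sqrt (2 * cmod c * ?d n)) \<longlonglongrightarrow> 0"
    by simp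
  fix n and f :: hardy
  let ?g = "g n"
  define E where "E = hardy_cinner (T ?g - c *\<^sub>C ?g) ?g"
  have E: "cmod E \<le> ?d n"
    unfolding E_def using hardy_cinner_Cauchy_Schwarz[of "T ?g - c *\<^sub>C ?g" ?g] unit by simp
  have "hardy_cinner (T ?g) ?g = c + E"
    by (simp add: E_def hardy_cinner.diff_left hardy_cinner_self unit)
  then have "hardy_cinner (S ?g) ?g = cnj (c + E)"
    unfolding adj by (subst hardy_cinner_commute) simp
  then have "hardy_cinner (S ?g) (cnj c *\<^sub>C ?g) = of_real ((cmod c)\<^sup>2) + c * cnj E"
    by (simp add: distrib_left complex_norm_square[symmetric])
  then have Re: "Re (hardy_cinner (S ?g) (cnj c *\<^sub>C ?g)) = (cmod c)\<^sup>2 + Re (c * cnj E)"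
    by simp
  have "\<bar>Re (c * cnj E)\<bar> \<le> cmod c * cmod E"
    by (metis abs_Re_le_cmod complex_mod_cnj norm_mult)
  also have "\<dots> \<le> cmod c * ?d n"
    by (intro mult_left_mono E) simp
  finally have ReE: "- (cmod c * ?d n) \<le> Re (c * cnj E)"
    by linarith
  have "(norm (S ?g))\<^sup>2 \<le> (cmod c)\<^sup>2"
    using S[of ?g] unit by (intro power_mono) auto
  moreover have "(norm (cnj c *\<^sub>C ?g))\<^sup>2 = (cmod c)\<^sup>2"
    by (simp add: unit)
  ultimately have "(norm (S ?g - cnj c *\<^sub>C ?g))\<^sup>2
      \<le> (cmod c)\<^sup>2 - 2 * ((cmod c)\<^sup>2 - cmod c * ?d n) + (cmod c)\<^sup>2"
    unfolding norm_diff_hardy_sq Re using ReE by (intro add_mono diff_mono mult_left_mono) auto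
  then have "(norm (S ?g - cnj c *\<^sub>C ?g))\<^sup>2 \<le> 2 * (cmod c * ?d n)"
    by (simp add: algebra_simps)
  then have small: "norm (S ?g - cnj c *\<^sub>C ?g) \<le> sqrt (2 * cmod c * ?d n)"
    by (intro real_le_rsqrt) (simp only: mult.assoc)
  have "hardy_cinner (T f - c *\<^sub>C f) ?g = hardy_cinner f (S ?g - cnj c *\<^sub>C ?g)"
    by (simp add: hardy_cinner.diff_left hardy_cinner.diff_right adj)
  then have "cmod (hardy_cinner (T f - c *\<^sub>C f) ?g) \<le> norm f * norm (S ?g - cnj c *\<^sub>C ?g)"
    by (simp only: hardy_cinner_Cauchy_Schwarz)
  also have "\<dots> \<le> norm f * sqrt (2 * cmod c * ?d n)"
    by (intro mult_left_mono small) simp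
  finally show "cmod (hardy_cinner (T f - c *\<^sub>C f) ?g) \<le> sqrt (2 * cmod c * ?d n) * norm f"
    by (simp only: mult.commute)
qed

text \<open>The error of lemma \<open>Wop_half_plane_power\<close> is bounded while the norms of the powers tend to
  infinity. The modulus of the eigenvalue is \<open>1 / sqrt l\<close>, the bound for the norm of the
  operator, so the extremal case above applies.\<close>

lemma Wop_asymp_eigen_critical:
  assumes \<zeta>: "cmod \<zeta> = 1" and l: "0 < l" "0 \<le> kap l b"
  shows "asymp_eigen (critical_sequence \<zeta> \<xi>) (Wop \<zeta> l b) (exp ((Complex (1 / 2) \<xi> - 1) * of_real (ln l)))"
proof -
  let ?b = "1 + (cnj b - 1) / of_real l"
  let ?S = "scaleC_op (1 / of_real l) o\<^sub>L Wop \<zeta> (1 / l) ?b"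
  let ?g = "\<lambda>k. half_plane_power \<zeta> (critical_exponent \<xi> k)"
  define c where "c = exp ((Complex (1 / 2) \<xi> - 1) * of_real (ln l))"
  define c' where "c' k = exp ((critical_exponent \<xi> k - 1) * of_real (ln l))" for k
  have c_lim: "c' \<longlonglongrightarrow> c"
    unfolding c_def c'_def by (intro tendsto_intros critical_exponent_tendsto)
  have c_norm: "cmod c = 1 / sqrt l"
  proof -
    have "cmod c = exp (- (ln l / 2))"
      by (simp add: c_def norm_exp_eq_Re)
    also have "\<dots> = inverse (sqrt l)"
      using l(1) ln_sqrt[of l] by (simp add: exp_minus flip: ln_sqrt)
    finally show ?thesis
      by (simp add: inverse_eq_divide)
  qed
  obtain C where C: "\<And>k. norm (Wop \<zeta> l b (?g k) - c' k *\<^sub>C ?g k) \<le> C"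
    using Wop_half_plane_power[OF \<zeta> l critical_exponent_Re, of \<xi>] unfolding c'_def critical_exponent_Im by blast
  have "asymp_eigen (critical_sequence \<zeta> \<xi>) (Wop \<zeta> l b) c"
  proof (rule asymp_eigen_extremal[where S = ?S])
    show "hardy_cinner (Wop \<zeta> l b f) h = hardy_cinner f (?S h)" for f h
      using Wop_adjoint[OF \<zeta> l] by simp
    show "norm (?S f) \<le> cmod c * norm f" for f
    proof -
      have k: "0 < 1 / l" "0 \<le> kap (1 / l) ?b"
        using l kap_adjoint[of l b] by auto
      have "norm (?S f) = 1 / l * norm (Wop \<zeta> (1 / l) ?b f)"
        using l(1) by (simp add: norm_divide)
      also have "\<dots> \<le> 1 / l * (1 / sqrt (1 / l) * norm f)"
        using l(1) by (intro mult_left_mono norm_Wop_apply[OF \<zeta> k]) auto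
      also have "1 / l * (1 / sqrt (1 / l) * norm f) = 1 / sqrt l * norm f"
        using l(1) by (simp add: real_sqrt_divide real_div_sqrt field_simps)
      finally show ?thesis
        by (simp only: c_norm)
    qed
    show unit: "norm (critical_sequence \<zeta> \<xi> k) = 1" for k
      by (rule norm_critical_sequence[OF \<zeta>])
    have bound: "norm (Wop \<zeta> l b (critical_sequence \<zeta> \<xi> k) - c *\<^sub>C critical_sequence \<zeta> \<xi> k)
        \<le> C * inverse (norm (?g k)) + cmod (c' k - c)" for k
    proof -
      let ?s = "critical_sequence \<zeta> \<xi> k"
      have "Wop \<zeta> l b ?s - c *\<^sub>C ?s = (Wop \<zeta> l b ?s - c' k *\<^sub>C ?s) + (c' k - c) *\<^sub>C ?s"
        by (simp add: hardy_scaleC.diff_left)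
      then have "norm (Wop \<zeta> l b ?s - c *\<^sub>C ?s) \<le> norm (Wop \<zeta> l b ?s - c' k *\<^sub>C ?s) + norm ((c' k - c) *\<^sub>C ?s)"
        by (simp only: norm_triangle_ineq)
      also have "norm ((c' k - c) *\<^sub>C ?s) = cmod (c' k - c)"
        by (simp add: unit)
      also have "Wop \<zeta> l b ?s - c' k *\<^sub>C ?s = (1 / norm (?g k)) *\<^sub>R (Wop \<zeta> l b (?g k) - c' k *\<^sub>C ?g k)"
        by (simp add: critical_sequence_def blinfun.scaleR_right hardy_scaleC.scaleR_right scaleR_diff_right)
      also have "norm \<dots> \<le> C * inverse (norm (?g k))"
        using C[of k] by (simp add: divide_inverse mult.commute[of C] mult_left_mono)
      finally show ?thesis by simp
    qed
    have "(\<lambda>k. C * inverse (norm (?g k)) + cmod (c' k - c)) \<longlonglongrightarrow> C * 0 + cmod (c - c)"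
      by (intro tendsto_intros c_lim tendsto_inverse_0_at_top norm_critical_power_at_top \<zeta>)
    then have "(\<lambda>k. C * inverse (norm (?g k)) + cmod (c' k - c)) \<longlonglongrightarrow> 0"
      by simp
    from tendsto_norm_zero[OF Lim_null_comparison[OF always_eventually[OF allI[OF bound]] this]]
    show "(\<lambda>k. norm (Wop \<zeta> l b (critical_sequence \<zeta> \<xi> k) - c *\<^sub>C critical_sequence \<zeta> \<xi> k)) \<longlonglongrightarrow> 0" .
  qed
  then show ?thesis
    unfolding c_def .
qed

text \<open>If \<open>l \<noteq> 1\<close>, the smallest frequency \<open>2 pi / ln l\<close> suffices, as its trivial phase at \<open>m\<close> means
  that \<open>ln m / ln l\<close> is an integer.\<close>

lemma exists_separating_frequency:
  assumes "0 < l" "0 < m" and sep: "\<And>n::int. m \<noteq> l powi n"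
  shows "\<exists>\<xi>. exp (\<i> * of_real (\<xi> * ln l)) = 1 \<and> exp (\<i> * of_real (\<xi> * ln m)) \<noteq> 1"
proof (cases "l = 1")
  case True
  then have "ln m \<noteq> 0"
    using sep[of 0] assms(2) by simp
  then have "exp (\<i> * of_real (pi / ln m * ln m)) \<noteq> 1"
    by simp
  then show ?thesis
    using True by (intro exI[of _ "pi / ln m"]) simp
next
  case False
  then have ln: "ln l \<noteq> 0"
    using assms(1) by simp
  let ?\<xi> = "2 * pi / ln l"
  have "exp (\<i> * of_real (?\<xi> * ln l)) = 1"
    using ln by (simp add: exp_eq_1)
  moreover have "exp (\<i> * of_real (?\<xi> * ln m)) \<noteq> 1"
  proof
    assume "exp (\<i> * of_real (?\<xi> * ln m)) = 1"
    then obtain n :: int where "?\<xi> * ln m = of_int (2 * n) * pi"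
      by (auto simp: exp_eq_1)
    then have "ln m = of_int n * ln l"
      using ln by (simp add: field_simps)
    then have "m = l powr (of_int n)"
      using assms(1,2) by (simp add: powr_def) (metis exp_ln)
    then show False
      using sep[of n] assms(1) by (simp add: powr_real_of_int')
  qed
  ultimately show ?thesis by blast
qed

lemma compact_in_character_algebra:
  assumes "\<And>g n. g \<in> J \<Longrightarrow> norm (g n) = 1" "\<And>g. g \<in> J \<Longrightarrow> weakly_null g"
  shows "compact_ops \<subseteq> character_algebra J"
proof
  fix T assume T: "T \<in> compact_ops"
  then have "asymp_eigen g T 0" if "g \<in> J" for g
    using compact_asymp_eigen assms that by blast
  moreover have "clinear_op T"
    using T by (simp add: compact_ops_def)
  ultimately show "T \<in> character_algebra J"
    by (auto simp: character_algebra_def)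
qed

text \<open>The zero frequency and a separating frequency give the same eigenvalue for \<open>W(l, b)\<close>, so
  \<open>W(l, b)\<close> and with it everything generated lies in the algebra for the two sequences;
  \<open>W(m, c)\<close> does not.\<close>

lemma dilation_factor_is_power:
  assumes \<zeta>: "cmod \<zeta> = 1" and l: "0 < l" "0 < kap l b" and m: "0 < m" "0 < kap m c"
    and \<phi>: "\<And>z. z \<in> \<D> \<Longrightarrow> \<phi> z = lft \<zeta> l b z" and \<psi>: "\<And>z. z \<in> \<D> \<Longrightarrow> \<psi> z = lft \<zeta> m c z"
    and mem: "composition_op \<psi> \<in> cstar_generated (insert (composition_op \<phi>) compact_ops)"
  shows "\<exists>n::int. m = l powi n"
proof (rule ccontr)
  assume "\<not> ?thesis"
  then obtain \<xi> where \<xi>: "exp (\<i> * of_real (\<xi> * ln l)) = 1" "exp (\<i> * of_real (\<xi> * ln m)) \<noteq> 1"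
    using exists_separating_frequency[OF l(1) m(1)] by blast
  define J where "J = {critical_sequence \<zeta> 0, critical_sequence \<zeta> \<xi>}"
  let ?A = "character_algebra J"
  have J: "\<And>g n. g \<in> J \<Longrightarrow> norm (g n) = 1" "\<And>g. g \<in> J \<Longrightarrow> weakly_null g" "J \<noteq> {}"
    by (auto simp: J_def norm_critical_sequence[OF \<zeta>] weakly_null_critical_sequence[OF \<zeta>])
  have A: "unital_cstar_subalgebra ?A" "compact_ops \<subseteq> ?A"
    by (rule character_algebra_cstar; fact J) (rule compact_in_character_algebra; fact J)
  have phase: "exp ((Complex (1 / 2) x - 1) * of_real (ln q))
    = exp ((Complex (1 / 2) 0 - 1) * of_real (ln q)) * exp (\<i> * of_real (x * ln q))" for x q :: real
    unfolding exp_add[symmetric] by (simp add: complex_eq_iff Complex_eq algebra_simps)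
  have "Wop \<zeta> l b \<in> ?A"
  proof -
    have "asymp_eigen g (Wop \<zeta> l b) (exp ((Complex (1 / 2) 0 - 1) * of_real (ln l)))" if "g \<in> J" for g
      using that Wop_asymp_eigen_critical[OF \<zeta> l(1) less_imp_le[OF l(2)]] phase[of \<xi> l] \<xi>(1)
      unfolding J_def by (metis insertE mult_1_right singletonD)
    then show ?thesis
      using clinear_Wop[OF \<zeta> l(1) less_imp_le[OF l(2)]] by (auto simp: character_algebra_def)
  qed
  then have "composition_op \<phi> \<in> ?A"
    using composition_op_mem_iff_Wop_mem[OF A \<zeta> l \<phi>] by blast
  then have "composition_op \<psi> \<in> ?A"
    using mem A unfolding cstar_generated_def by blast
  then have "Wop \<zeta> m c \<in> ?A"
    using composition_op_mem_iff_Wop_mem[OF A \<zeta> m \<psi>] by blast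
  then obtain d where d: "\<And>g. g \<in> J \<Longrightarrow> asymp_eigen g (Wop \<zeta> m c) d"
    by (auto simp: character_algebra_def)
  have "exp ((Complex (1 / 2) x - 1) * of_real (ln m)) = d" if "critical_sequence \<zeta> x \<in> J" for x
    using asymp_eigen_diff_le[OF Wop_asymp_eigen_critical[OF \<zeta> m(1) less_imp_le[OF m(2)]] d[OF that]
        norm_critical_sequence[OF \<zeta>]] by simp
  then have "exp ((Complex (1 / 2) 0 - 1) * of_real (ln m)) = d" "exp ((Complex (1 / 2) \<xi> - 1) * of_real (ln m)) = d"
    by (auto simp: J_def)
  then show False
    using phase[of \<xi> m] \<xi>(2) by (metis exp_not_eq_zero mult_cancel_left1)
qed

section \<open>Membership in the generated C*-algebra\<close>

theorem theorem3p4: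
  fixes \<phi> \<psi> :: "complex \<Rightarrow> complex" and \<zeta> :: complex
  assumes "linear_fractional_self_map \<phi>" and "\<not> disk_automorphism \<phi>"
    and "\<zeta> \<in> \<T>" and "\<phi> \<zeta> = \<zeta>"
    and "linear_fractional_self_map \<psi>" and "disk_sup_norm \<psi> = 1"
    and "composition_op \<psi> \<noteq> id_blinfun"
  shows "composition_op \<psi> \<in> cstar_generated (insert (composition_op \<phi>) compact_ops) \<longleftrightarrow>
    \<psi> \<zeta> = \<zeta> \<and> (\<exists>n::int. deriv \<psi> \<zeta> = deriv \<phi> \<zeta> powi n) \<and> \<not> disk_automorphism \<psi>"
proof -
  have \<zeta>: "cmod \<zeta> = 1"
    using assms(3) by simp
  have unit: "\<zeta> * cnj \<zeta> = 1"
    using \<zeta> by (simp add: complex_norm_square [symmetric])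
  obtain l b where l: "0 < l" "0 \<le> kap l b"
    and \<phi>_form: "\<And>z. of_real l + b * gap \<zeta> z \<noteq> 0 \<Longrightarrow> \<phi> z = lft \<zeta> l b z"
    using linear_fractional_normal_form[OF assms(1) \<zeta> \<zeta> assms(4)] by (auto simp: unit)
  have \<phi>: "\<phi> z = lft \<zeta> l b z" if "z \<in> \<D>" for z
    using that by (intro \<phi>_form lfw_denominator_nonzero \<zeta> l) auto
  have kap_\<phi>: "0 < kap l b"
    using disk_automorphism_iff_kap_zero[OF assms(1) \<zeta> _ l, of 1] \<phi> assms(2) l(2) by force
  have deriv_\<phi>: "deriv \<phi> \<zeta> = 1 / of_real l"
    by (rule deriv_lft[OF \<zeta> l(1) \<phi>_form])
  show ?thesis
  proof
    assume mem: "composition_op \<psi> \<in> cstar_generated (insert (composition_op \<phi>) compact_ops)"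
    obtain \<eta> where \<eta>: "cmod \<eta> = 1" "cmod (\<psi> \<eta>) = 1"
      using boundary_contact[OF assms(5,6)] by blast
    define \<rho> where "\<rho> = \<psi> \<eta> * cnj \<eta>"
    have \<rho>: "cmod \<rho> = 1"
      by (simp add: \<rho>_def norm_mult \<eta>)
    obtain m c where m: "0 < m" "0 \<le> kap m c"
      and \<psi>_form: "\<And>z. of_real m + c * gap \<eta> z \<noteq> 0 \<Longrightarrow> \<psi> z = \<rho> * lft \<eta> m c z"
      using linear_fractional_normal_form[OF assms(5) \<eta> refl] unfolding \<rho>_def by blast
    have \<psi>: "\<psi> z = \<rho> * lft \<eta> m c z" if "z \<in> \<D>" for z
      using that by (intro \<psi>_form lfw_denominator_nonzero \<eta> m) auto
    have J: "norm (g n) = 1" "weakly_null g" if "g \<in> kernel_sequences \<zeta>" for g n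
      using that weakly_null_kernels norm_unit_kernel unfolding kernel_sequences_def by blast+
    have ne: "kernel_sequences \<zeta> \<noteq> {}"
    proof -
      have "cmod (- \<zeta>) = 1" "- \<zeta> \<noteq> \<zeta>"
        using \<zeta> by auto
      then show ?thesis
        using kernel_sequencesI[OF radial_sequence(3,4), of "- \<zeta>" \<zeta>] by blast
    qed
    let ?A = "character_algebra (kernel_sequences \<zeta>)"
    have "unital_cstar_subalgebra ?A" "compact_ops \<subseteq> ?A"
      by (rule character_algebra_cstar; fact J ne) (rule compact_in_character_algebra; fact J)
    moreover have "composition_op \<phi> \<in> ?A"
    proof -
      have "clinear_op (composition_op \<phi>)"
        by (subst composition_op_eq_Wop[OF \<zeta> l \<phi>], assumption)
          (intro clinear_op_intros clinear_gap_op clinear_Wop \<zeta> l)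
      then show ?thesis
        using composition_op_asymp_eigen_kernels[OF \<zeta> l(1) kap_\<phi> \<phi>] by (auto simp: character_algebra_def)
    qed
    ultimately have "composition_op \<psi> \<in> ?A"
      using mem unfolding cstar_generated_def by blast
    from composition_in_kernel_character_algebra[OF \<zeta> \<eta>(1) \<rho> m \<psi> this assms(7)]
    have kap_\<psi>: "0 < kap m c" and eqs: "\<eta> = \<zeta>" "\<rho> = 1"
      by auto
    have "\<psi> \<zeta> = \<zeta>"
      using eqs unit by (metis \<rho>_def mult.assoc mult.commute mult.right_neutral)
    moreover have "\<not> disk_automorphism \<psi>"
      using disk_automorphism_iff_kap_zero[OF assms(5) \<eta>(1) \<rho> m \<psi>] kap_\<psi> by simp
    moreover have "deriv \<psi> \<zeta> = 1 / of_real m"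
      using \<psi>_form eqs by (intro deriv_lft[OF \<zeta> m(1)]) auto
    moreover obtain n :: int where "m = l powi n"
      using dilation_factor_is_power[OF \<zeta> l(1) kap_\<phi> m(1) kap_\<psi> \<phi> _ mem] \<psi> eqs by auto
    ultimately show "\<psi> \<zeta> = \<zeta> \<and> (\<exists>n::int. deriv \<psi> \<zeta> = deriv \<phi> \<zeta> powi n) \<and> \<not> disk_automorphism \<psi>"
      unfolding deriv_\<phi> by (auto simp: power_int_divide_distrib intro!: exI[of _ n])
  next
    assume rhs: "\<psi> \<zeta> = \<zeta> \<and> (\<exists>n::int. deriv \<psi> \<zeta> = deriv \<phi> \<zeta> powi n) \<and> \<not> disk_automorphism \<psi>"
    then obtain n :: int where n: "deriv \<psi> \<zeta> = deriv \<phi> \<zeta> powi n"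
      by blast
    obtain m c where m: "0 < m" "0 \<le> kap m c"
      and \<psi>_form: "\<And>z. of_real m + c * gap \<zeta> z \<noteq> 0 \<Longrightarrow> \<psi> z = lft \<zeta> m c z"
      using linear_fractional_normal_form[OF assms(5) \<zeta> \<zeta>] rhs by (auto simp: unit)
    have \<psi>: "\<psi> z = lft \<zeta> m c z" if "z \<in> \<D>" for z
      using that by (intro \<psi>_form lfw_denominator_nonzero \<zeta> m) auto
    have kap_\<psi>: "0 < kap m c"
      using disk_automorphism_iff_kap_zero[OF assms(5) \<zeta> _ m, of 1] \<psi> rhs m(2) by force
    have "1 / complex_of_real m = of_real (1 / (l powi n))"
      using n deriv_lft[OF \<zeta> m(1) \<psi>_form] unfolding deriv_\<phi> by (simp add: power_int_divide_distrib)
    then have "complex_of_real (1 / m) = of_real (1 / (l powi n))"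
      by simp
    then have "1 / m = 1 / (l powi n)"
      by (simp only: of_real_eq_iff)
    then have "m = l powi n"
      by simp
    then have "composition_op \<psi> \<in> A"
      if A: "unital_cstar_subalgebra A" "insert (composition_op \<phi>) compact_ops \<subseteq> A" for A
    proof -
      have K: "compact_ops \<subseteq> A" "composition_op \<phi> \<in> A"
        using A(2) by auto
      have "Wop \<zeta> l b \<in> A"
        using composition_op_mem_iff_Wop_mem[OF A(1) K(1) \<zeta> l(1) kap_\<phi> \<phi>] K(2) by blast
      then have "Wop \<zeta> m c \<in> A"
        using Wop_generated[OF A(1) \<zeta> l(1) kap_\<phi>, of n c] kap_\<psi> \<open>m = l powi n\<close> by simp
      then show ?thesis
        using composition_op_mem_iff_Wop_mem[OF A(1) K(1) \<zeta> m(1) kap_\<psi> \<psi>] by blast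
    qed
    then show "composition_op \<psi> \<in> cstar_generated (insert (composition_op \<phi>) compact_ops)"
      unfolding cstar_generated_def by blast
  qed
qed

end
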